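(* Consider the setting of the context: functions $F$, $\mathrm{F}_n$, $\Theta_n$ and a sequence of random vectors $(\mathbf{h}_n)_{n\ge 1}$ generated by the stochastic MM subspace algorithm. Suppose that the following three groups of assumptions hold. (A1) (a) For every $s\in\{1,\ldots,S\}$, $\psi_s$ is an even, lower-bounded, continuously differentiable function and $\lim_{t\to 0,\,t\ne 0}\dot\psi_s(t)/t\in\mathbb{R}$, where $\dot\psi_s$ is the derivative of $\psi_s$. (b) For every $s$, $\psi_s(\sqrt{\cdot})$ is concave on $[0,+\infty)$. (c) There exists $\overline{\nu}\in[0,+\infty)$ such that, for every $s\in\{1,\ldots,S\}$ and $t\in[0,+\infty)$, $0\le \nu_s(t)\le\overline{\nu}$, where $\nu_s(t)=\dot\psi_s(t)/t$ (extended by continuity at $t=0$). (A2) For every $n\ge 1$, $\{\nabla \mathrm{F}_n(\mathbf{h}_n),\mathbf{h}_n\}\subset \operatorname{ran}\mathbf{D}_n$. (A3) (a) $R+V_0$ is positive definite. (b) $((\mathbf{X}_n,\mathbf{y}_n))_{n\ge1}$ is a stationary ergodic sequence and, for every $n\ge 1$, the elements of $\mathbf{X}_n$ and the components of $\mathbf{y}_n$ have finite fourth-order moments. (c) For every $n\ge 1$, $\mathsf{E}(\|\mathbf{y}_{n+1}\|^2\mid\mathcal{X}_n)=\varrho$, $\mathsf{E}(\mathbf{X}_{n+1}\mathbf{y}_{n+1}\mid\mathcal{X}_n)=r$ and $\mathsf{E}(\mathbf{X}_{n+1}\mathbf{X}_{n+1}^\top\mid\mathcal{X}_n)=R$. (d)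 $\mathbf{h}_1$ is $\mathcal{X}_1$-measurable and, for every $n\ge 1$, $\mathbf{D}_n$ is $\mathcal{X}_n$-measurable. Then the following hold: (i) The set of cluster points of $(\mathbf{h}_n)_{n\ge 1}$ is almost surely a nonempty compact connected set. (ii) Almost surely, any element of this set is a critical point of $F$ (that is, a zero of $\nabla F$). (iii) If the functions $(\psi_s)_{1\le s\le S}$ are convex, then $(\mathbf{h}_n)_{n\ge1}$ converges almost surely to the unique (global) minimizer of $F$.
   Context: Let $(\Omega,\mathcal{F},\mathsf{P})$ be a probability space, $N,Q,S\ge 1$ integers, and let $(\mathbf{X}_n)_{n\ge1}$ be random matrices in $\mathbb{R}^{N\times Q}$ and $(\mathbf{y}_n)_{n\ge 1}$ random vectors in $\mathbb{R}^Q$ such that, for every $n\ge1$, $\mathsf{E}(\|\mathbf{y}_n\|^2)=\varrho$, $\mathsf{E}(\mathbf{X}_n\mathbf{y}_n)=r$, $\mathsf{E}(\mathbf{X}_n\mathbf{X}_n^\top)=R$, with $\varrho\in(0,+\infty)$, $r\in\mathbb{R}^N$, $R\in\mathbb{R}^{N\times N}$ symmetric positive semi-definite. $\|\cdot\|$ is the Euclidean norm. $\mathcal{X}_n=\sigma((\mathbf{X}_k,\mathbf{y}_k)_{1\le k\le n})$. Regularization: $\Psi(h)=\frac12 h^\top V_0h-v_0^\top h+\sum_{s=1}^S\psi_s(\|V_sh-v_s\|)$ for $h\in\mathbb{R}^N$, where $v_0\in\mathbb{R}^N$, $V_0\in\mathbb{R}^{N\times N}$ is symmetric positive semi-definite and,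 for every $s\in\{1,\ldots,S\}$, $v_s\in\mathbb{R}^{P_s}$, $V_s\in\mathbb{R}^{P_s\times N}$, $\psi_s:\mathbb{R}\to\mathbb{R}$. Cost functions: $F(h)=\frac12\mathsf{E}(\|\mathbf{y}_n-\mathbf{X}_n^\top h\|^2)+\Psi(h)=\frac12\varrho-r^\top h+\frac12h^\top Rh+\Psi(h)$ (independent of $n$), and for $n\ge 1$, $$\mathrm{F}_n(h)=\frac1{2n}\sum_{k=1}^n\|\mathbf{y}_k-\mathbf{X}_k^\top h\|^2+\Psi(h)=\tfrac12\rho_n-\mathbf{r}_n^\top h+\tfrac12h^\top\mathbf{R}_nh+\Psi(h),$$ with $\rho_n=\frac1n\sum_{k=1}^n\|\mathbf{y}_k\|^2$, $\mathbf{r}_n=\frac1n\sum_{k=1}^n\mathbf{X}_k\mathbf{y}_k$, $\mathbf{R}_n=\frac1n\sum_{k=1}^n\mathbf{X}_k\mathbf{X}_k^\top$. Quadratic majorant: $\Theta_n(h',h)=\mathrm{F}_n(h)+\nabla\mathrm{F}_n(h)^\top(h'-h)+\frac12(h'-h)^\top\mathbf{A}_n(h)(h'-h)$, where $\mathbf{A}_n(h)=\mathbf{R}_n+V_0+V^\top\operatorname{Diag}(b(h))V$, $V=[V_1^\top\ldots V_S^\top]^\top$, and $b(h)=[\nu_1(\|V_1h-v_1\|)\mathbf{1}_{P_1}^\top\ldots\nu_S(\|V_Sh-v_S\|)\mathbf{1}_{P_S}^\top]^\top$ with $\mathbf{1}_P$ the all-ones vector of $\mathbb{R}^P$. Algorithm: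 $\mathbf{h}_1$ is an initial random vector in $\mathbb{R}^N$ and, for every $n\ge1$, given a (random) matrix $\mathbf{D}_n\in\mathbb{R}^{N\times M_n}$ with range $\operatorname{ran}\mathbf{D}_n$, $\mathbf{h}_{n+1}\in\operatorname{argmin}_{h\in\operatorname{ran}\mathbf{D}_n}\Theta_n(h,\mathbf{h}_n)$; the minimizer is taken as $\mathbf{h}_{n+1}=\mathbf{D}_n\mathbf{u}_n$ with $\mathbf{u}_n=(\mathbf{D}_n^\top\mathbf{A}_n(\mathbf{h}_n)\mathbf{D}_n)^\dagger\mathbf{D}_n^\top\mathbf{c}_n(\mathbf{h}_n)$, where $^\dagger$ is the pseudo-inverse, $\mathbf{c}_n(h)=\mathbf{r}_n+v_0+V^\top\operatorname{Diag}(b(h))v$ and $v=[v_1^\top\ldots v_S^\top]^\top$. *)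

theory Defs
  imports "HOL-Probability.Probability" "Jordan_Normal_Form.Matrix"
begin

no_notation vec_index (infixl "$" 100)
no_notation scalar_prod (infix "\<bullet>" 70)

definition grad :: "('v::real_inner \<Rightarrow> real) \<Rightarrow> 'v \<Rightarrow> 'v" where
  "grad f x = (THE g. GDERIV f x :> g)"

definition critical_point :: "('v::real_inner \<Rightarrow> real) \<Rightarrow> 'v \<Rightarrow> bool" where
  "critical_point f x \<longleftrightarrow> GDERIV f x :> 0"

definition cluster_points :: "(nat \<Rightarrow> 'v::metric_space) \<Rightarrow> 'v set" where
  "cluster_points x = {c. \<exists>\<sigma>::nat \<Rightarrow> nat. strict_mono \<sigma> \<and> (x \<circ> \<sigma>) \<longlonglongrightarrow> c}"

definition sym_psd :: "real^'n^'n \<Rightarrow> bool" where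
  "sym_psd A \<longleftrightarrow> transpose A = A \<and> (\<forall>x. 0 \<le> x \<bullet> (A *v x))"

definition sym_pd :: "real^'n^'n \<Rightarrow> bool" where
  "sym_pd A \<longleftrightarrow> transpose A = A \<and> (\<forall>x. x \<noteq> 0 \<longrightarrow> 0 < x \<bullet> (A *v x))"

definition Diag :: "real^'p \<Rightarrow> real^'p^'p" where
  "Diag b = (\<chi> i j. if i = j then b $ i else 0)"

definition path_law :: "'a measure \<Rightarrow> (nat \<Rightarrow> 'a \<Rightarrow> 'z::topological_space) \<Rightarrow> (nat \<Rightarrow> 'z) measure" where
  "path_law M Z = distr M (PiM UNIV (\<lambda>_. borel)) (\<lambda>\<omega> k. Z k \<omega>)"

definition stationary_seq :: "'a measure \<Rightarrow> (nat \<Rightarrow> 'a \<Rightarrow> 'z::topological_space) \<Rightarrow> bool" where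
  "stationary_seq M Z \<longleftrightarrow> path_law M (\<lambda>k. Z (Suc k)) = path_law M Z"

definition ergodic_seq :: "'a measure \<Rightarrow> (nat \<Rightarrow> 'a \<Rightarrow> 'z::topological_space) \<Rightarrow> bool" where
  "ergodic_seq M Z \<longleftrightarrow>
     (\<forall>B \<in> sets (PiM UNIV (\<lambda>_::nat. borel :: 'z measure)).
        (\<lambda>x k. x (Suc k)) -` B = B \<longrightarrow> measure (path_law M Z) B \<in> {0, 1})"

definition history :: "'a measure \<Rightarrow> (nat \<Rightarrow> 'a \<Rightarrow> 'z::topological_space) \<Rightarrow> nat \<Rightarrow> 'a measure" where
  "history M Z n =
     sigma (space M) {Z k -` B \<inter> space M | k B. k \<in> {1..n} \<and> B \<in> sets borel}"

text \<open>The blocks \<open>V\<^sub>s\<close>, \<open>v\<^sub>s\<close>, of arbitrary heights \<open>P\<^sub>s\<close>, are given through the stacked matrix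
  \<open>V\<close> and vector \<open>v\<close>: row \<open>p\<close> belongs to the block \<open>blk p\<close>, so that
  \<open>P\<^sub>s = card {p. blk p = s}\<close>.\<close>

definition block_norm ::
    "real^'n^'p \<Rightarrow> real^'p \<Rightarrow> ('p \<Rightarrow> 's) \<Rightarrow> 's \<Rightarrow> real^'n \<Rightarrow> real" where
  "block_norm V v blk s h = L2_set (\<lambda>p. (V *v h - v) $ p) {p. blk p = s}"

definition regularizer ::
    "('s::finite \<Rightarrow> real \<Rightarrow> real) \<Rightarrow> real^'n^'n \<Rightarrow> real^'n \<Rightarrow> real^'n^'p \<Rightarrow> real^'p \<Rightarrow> ('p \<Rightarrow> 's)
      \<Rightarrow> real^'n \<Rightarrow> real" where
  "regularizer \<psi> V0 v0 V v blk h =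
     1/2 * (h \<bullet> (V0 *v h)) - v0 \<bullet> h + (\<Sum>s\<in>UNIV. \<psi> s (block_norm V v blk s h))"

text \<open>The index 1 is immaterial when the second-order moments do not depend on \<open>n\<close>, see
  \<open>mean_square_error_eq\<close> below.\<close>

definition cost ::
    "'a measure \<Rightarrow> (nat \<Rightarrow> 'a \<Rightarrow> real^'q^'n) \<Rightarrow> (nat \<Rightarrow> 'a \<Rightarrow> real^'q) \<Rightarrow> (real^'n \<Rightarrow> real)
      \<Rightarrow> real^'n \<Rightarrow> real" where
  "cost M X y \<Psi> h =
     1/2 * (\<integral>\<omega>. (norm (y 1 \<omega> - transpose (X 1 \<omega>) *v h))\<^sup>2 \<partial>M) + \<Psi> h"

lemma mean_square_error_eq:
  fixes X :: "nat \<Rightarrow> 'a \<Rightarrow> real^'q^'n" and y :: "nat \<Rightarrow> 'a \<Rightarrow> real^'q"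
  assumes rho: "has_bochner_integral M (\<lambda>\<omega>. (norm (y n \<omega>))\<^sup>2) \<rho>"
    and r: "has_bochner_integral M (\<lambda>\<omega>. X n \<omega> *v y n \<omega>) r"
    and R: "has_bochner_integral M (\<lambda>\<omega>. X n \<omega> ** transpose (X n \<omega>)) R"
  shows "1/2 * (\<integral>\<omega>. (norm (y n \<omega> - transpose (X n \<omega>) *v h))\<^sup>2 \<partial>M)
           = 1/2 * \<rho> - r \<bullet> h + 1/2 * (h \<bullet> (R *v h))"
proof -
  have exp: "(norm (y n \<omega> - transpose (X n \<omega>) *v h))\<^sup>2
      = (norm (y n \<omega>))\<^sup>2 - 2 * ((X n \<omega> *v y n \<omega>) \<bullet> h)
        + h \<bullet> ((X n \<omega> ** transpose (X n \<omega>)) *v h)" for \<omega>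
  proof -
    have 1: "(transpose (X n \<omega>) *v h) \<bullet> y n \<omega> = (X n \<omega> *v y n \<omega>) \<bullet> h"
      by (metis dot_lmul_matrix inner_commute transpose_matrix_vector)
    have 2: "(transpose (X n \<omega>) *v h) \<bullet> (transpose (X n \<omega>) *v h)
        = h \<bullet> ((X n \<omega> ** transpose (X n \<omega>)) *v h)"
      by (metis dot_lmul_matrix matrix_vector_mul_assoc transpose_matrix_vector)
    show ?thesis
      unfolding power2_norm_eq_inner
      using 1 2 by (simp add: inner_diff_left inner_diff_right inner_commute)
  qed
  have "bounded_linear (\<lambda>A::real^'n^'n. h \<bullet> (A *v h))"
    by (rule linear_conv_bounded_linear[THEN iffD1])
       (auto intro!: linearI simp: matrix_vector_mult_add_rdistrib inner_add_right
          scaleR_matrix_vector_assoc[symmetric])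
  then have "has_bochner_integral M (\<lambda>\<omega>. h \<bullet> ((X n \<omega> ** transpose (X n \<omega>)) *v h)) (h \<bullet> (R *v h))"
    using R by (rule has_bochner_integral_bounded_linear)
  moreover have "has_bochner_integral M (\<lambda>\<omega>. 2 * ((X n \<omega> *v y n \<omega>) \<bullet> h)) (2 * (r \<bullet> h))"
    using r by (intro has_bochner_integral_mult_right has_bochner_integral_inner_left)
  ultimately have "has_bochner_integral M (\<lambda>\<omega>. (norm (y n \<omega> - transpose (X n \<omega>) *v h))\<^sup>2)
      (\<rho> - 2 * (r \<bullet> h) + h \<bullet> (R *v h))"
    unfolding exp using rho by (intro has_bochner_integral_add has_bochner_integral_diff)
  then show ?thesis
    by (simp add: has_bochner_integral_integral_eq)
qed

definition emp_cost ::
    "(nat \<Rightarrow> 'a \<Rightarrow> real^'q^'n) \<Rightarrow> (nat \<Rightarrow> 'a \<Rightarrow> real^'q) \<Rightarrow> (real^'n \<Rightarrow> real)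
      \<Rightarrow> nat \<Rightarrow> 'a \<Rightarrow> real^'n \<Rightarrow> real" where
  "emp_cost X y \<Psi> n \<omega> h =
     1 / (2 * real n) * (\<Sum>k=1..n. (norm (y k \<omega> - transpose (X k \<omega>) *v h))\<^sup>2) + \<Psi> h"

definition emp_r ::
    "(nat \<Rightarrow> 'a \<Rightarrow> real^'q^'n) \<Rightarrow> (nat \<Rightarrow> 'a \<Rightarrow> real^'q) \<Rightarrow> nat \<Rightarrow> 'a \<Rightarrow> real^'n" where
  "emp_r X y n \<omega> = (1 / real n) *\<^sub>R (\<Sum>k=1..n. X k \<omega> *v y k \<omega>)"

definition emp_R :: "(nat \<Rightarrow> 'a \<Rightarrow> real^'q^'n) \<Rightarrow> nat \<Rightarrow> 'a \<Rightarrow> real^'n^'n" where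
  "emp_R X n \<omega> = (1 / real n) *\<^sub>R (\<Sum>k=1..n. X k \<omega> ** transpose (X k \<omega>))"

definition nu :: "(real \<Rightarrow> real) \<Rightarrow> real \<Rightarrow> real" where
  "nu \<psi> t = (if t = 0 then Lim (at 0) (\<lambda>u. deriv \<psi> u / u) else deriv \<psi> t / t)"

definition weights ::
    "('s \<Rightarrow> real \<Rightarrow> real) \<Rightarrow> real^'n^'p \<Rightarrow> real^'p \<Rightarrow> ('p \<Rightarrow> 's) \<Rightarrow> real^'n \<Rightarrow> real^'p" where
  "weights \<psi> V v blk h = (\<chi> p. nu (\<psi> (blk p)) (block_norm V v blk (blk p) h))"

definition maj_A ::
    "(nat \<Rightarrow> 'a \<Rightarrow> real^'q^'n) \<Rightarrow> ('s \<Rightarrow> real \<Rightarrow> real) \<Rightarrow> real^'n^'n \<Rightarrow> real^'n^'p \<Rightarrow> real^'p \<Rightarrow> ('p \<Rightarrow> 's)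
      \<Rightarrow> nat \<Rightarrow> 'a \<Rightarrow> real^'n \<Rightarrow> real^'n^'n" where
  "maj_A X \<psi> V0 V v blk n \<omega> h =
     emp_R X n \<omega> + V0 + transpose V ** Diag (weights \<psi> V v blk h) ** V"

definition maj_c ::
    "(nat \<Rightarrow> 'a \<Rightarrow> real^'q^'n) \<Rightarrow> (nat \<Rightarrow> 'a \<Rightarrow> real^'q) \<Rightarrow> ('s \<Rightarrow> real \<Rightarrow> real)
      \<Rightarrow> real^'n \<Rightarrow> real^'n^'p \<Rightarrow> real^'p \<Rightarrow> ('p \<Rightarrow> 's) \<Rightarrow> nat \<Rightarrow> 'a \<Rightarrow> real^'n \<Rightarrow> real^'n" where
  "maj_c X y \<psi> v0 V v blk n \<omega> h =
     emp_r X y n \<omega> + v0 + transpose V *v (Diag (weights \<psi> V v blk h) *v v)"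

definition quad_majorant ::
    "(real^'n \<Rightarrow> real) \<Rightarrow> (real^'n \<Rightarrow> real^'n^'n) \<Rightarrow> real^'n \<Rightarrow> real^'n \<Rightarrow> real" where
  "quad_majorant f A h' h =
     f h + grad f h \<bullet> (h' - h) + 1/2 * ((h' - h) \<bullet> (A h *v (h' - h)))"

text \<open>A matrix with \<open>m\<close> columns in \<open>real^'n\<close>, where \<open>m\<close> is a number and not a type, is represented
  by its columns \<open>d 0, \<dots>, d (m - 1)\<close>.\<close>

definition mult_cols :: "nat \<Rightarrow> (nat \<Rightarrow> real^'n) \<Rightarrow> (nat \<Rightarrow> real) \<Rightarrow> real^'n" where
  "mult_cols m d u = (\<Sum>j<m. u j *\<^sub>R d j)"

definition ran_cols :: "nat \<Rightarrow> (nat \<Rightarrow> real^'n) \<Rightarrow> (real^'n) set" where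
  "ran_cols m d = range (mult_cols m d)"

definition pseudo_inverse :: "real mat \<Rightarrow> real mat" where
  "pseudo_inverse G = (THE H. H \<in> carrier_mat (dim_col G) (dim_row G) \<and>
     G * H * G = G \<and> H * G * H = H \<and>
     transpose_mat (G * H) = G * H \<and> transpose_mat (H * G) = H * G)"

text \<open>\<open>D u\<close> with \<open>u = (D\<^sup>T A D)\<^sup>\<dagger> D\<^sup>T c\<close>, for the matrix \<open>D\<close> with columns \<open>d\<close>.\<close>

definition subspace_step ::
    "nat \<Rightarrow> (nat \<Rightarrow> real^'n) \<Rightarrow> real^'n^'n \<Rightarrow> real^'n \<Rightarrow> real^'n" where
  "subspace_step m d A c =
     mult_cols m d (vec_index
       (pseudo_inverse (Matrix.mat m m (\<lambda>(i, j). d i \<bullet> (A *v d j))) *\<^sub>v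
        Matrix.vec m (\<lambda>i. d i \<bullet> c)))"

end

theory Submission
  imports Defs "HOL-Library.Discrete_Functions"
begin

text \<open>With \<open>z\<^sub>k = (\<parallel>y\<^sub>k\<parallel>\<^sup>2, X\<^sub>k y\<^sub>k, X\<^sub>k X\<^sub>k\<^sup>T)\<close>, both \<open>F\<close> and \<open>F\<^sub>n\<close> have the form
  \<open>\<zeta> \<bullet> q(h) + \<Psi>(h)\<close>, where \<open>\<zeta>\<close> is the mean of \<open>z\<^sub>k\<close>, respectively the empirical mean \<open>\<zeta>\<^sub>n\<close>. The
  fourth moments, bounded uniformly by stationarity, and the martingale property of \<open>z\<^sub>k - \<zeta>\<close> give
  \<open>E \<parallel>\<zeta>\<^sub>n - \<zeta>\<parallel>\<^sup>2 = O(1/n)\<close> and \<open>\<zeta>\<^sub>n \<rightarrow> \<zeta>\<close> almost surely.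

  Since \<open>0\<close> lies in the subspace, the minimizing property bounds \<open>h\<^sub>n\<^sub>+\<^sub>1\<close> as soon as \<open>\<zeta>\<^sub>n\<close> is close to
  \<open>\<zeta>\<close>. A step decreases \<open>F\<^sub>n\<close> by at least \<open>\<epsilon>/2 \<parallel>h\<^sub>n\<^sub>+\<^sub>1 - h\<^sub>n\<parallel>\<^sup>2\<close>, and passing from \<open>F\<^sub>n\<close> to \<open>F\<^sub>n\<^sub>+\<^sub>1\<close> costs
  \<open>O(n powr (-3/2))\<close> in expectation, because \<open>h\<^sub>n\<^sub>+\<^sub>1\<close> is known at time \<open>n\<close>. Restricted to the event that
  the iterates have stayed bounded, taking expectations yields \<open>\<Sum> \<parallel>h\<^sub>n\<^sub>+\<^sub>1 - h\<^sub>n\<parallel>\<^sup>2 < \<infinity>\<close> almost surely. Hence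
  the cluster set is connected; and since \<open>\<nabla>F\<^sub>n(h\<^sub>n)\<close> lies in the subspace, optimality bounds it by a
  multiple of \<open>\<parallel>h\<^sub>n\<^sub>+\<^sub>1 - h\<^sub>n\<parallel>\<close>, so cluster points are critical.\<close>

section \<open>Potentials with concave composition with the square root\<close>

text \<open>Three obstacles shape the proof. No moments of the iterates are available, and their
  bound depends on the path through the random time after which the empirical moments stay close to
  their limit; expectations are therefore taken on truncating events. These involve only data up to
  time n, shrink with n and are indexed by two natural numbers, so countably many null sets are
  enough to cover almost every path.

  The martingale argument needs the next iterate to be measurable for the uncompleted history,
  whereas the recursion holds only almost surely. An everywhere defined copy of the iteration is
  used instead, and the formula with the pseudo-inverse makes it measurable: early matrices
  \<open>A n \<omega> g\<close> may be singular, so minimality alone need not determine the next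
  iterate.

  Differentiability of the cost is not obtained by the chain rule, which would single out points
  where a block norm vanishes; it is extracted from the majorant. Likewise, in the convex case a
  minimizer is found as a cluster point of a random path.\<close>

lemma C1_UNIV_deriv:
  fixes \<psi> :: "real \<Rightarrow> real"
  assumes "\<psi> C1_differentiable_on UNIV"
  shows "(\<psi> has_real_derivative deriv \<psi> t) (at t)" and "isCont (deriv \<psi>) t"
proof -
  obtain d where d: "\<And>x. (\<psi> has_vector_derivative d x) (at x)" and c: "continuous_on UNIV d"
    using assms unfolding C1_differentiable_on_def by auto
  have dd: "(\<psi> has_real_derivative d x) (at x)" for x
    using d[of x] by (simp add: has_real_derivative_iff_has_vector_derivative)
  then have e: "deriv \<psi> = d"
    by (intro ext DERIV_imp_deriv)
  show "(\<psi> has_real_derivative deriv \<psi> t) (at t)"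
    using dd e by simp
  show "isCont (deriv \<psi>) t"
    using c e by (simp add: continuous_on_eq_continuous_at)
qed

locale mm_potential =
  fixes \<psi> :: "real \<Rightarrow> real"
  assumes C1: "\<psi> C1_differentiable_on UNIV"
    and ratio_lim: "\<exists>l. ((\<lambda>t. deriv \<psi> t / t) \<longlongrightarrow> l) (at 0)"
    and concave_sqrt: "concave_on {0..} (\<lambda>t. \<psi> (sqrt t))"
begin

lemma isCont_nu: "isCont (nu \<psi>) t"
proof (cases "t = 0")
  case True
  obtain l where l: "((\<lambda>t. deriv \<psi> t / t) \<longlongrightarrow> l) (at 0)"
    using ratio_lim by auto
  then have "nu \<psi> 0 = l"
    by (simp add: nu_def tendsto_Lim)
  moreover have "(nu \<psi> \<longlongrightarrow> l) (at 0)"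
    by (rule Lim_transform_eventually[OF l]) (auto simp: eventually_at_filter nu_def)
  ultimately show ?thesis
    using True by (simp add: isCont_def)
next
  case False
  have "isCont (\<lambda>t. deriv \<psi> t / t) t"
    using C1_UNIV_deriv(2)[OF C1, of t] False by (intro continuous_divide) auto
  moreover have "eventually (\<lambda>x. deriv \<psi> x / x = nu \<psi> x) (nhds t)"
    using t1_space_nhds[OF False] by eventually_elim (simp add: nu_def)
  ultimately show ?thesis
    using isCont_cong[of "\<lambda>t. deriv \<psi> t / t" "nu \<psi>" t] by simp
qed

lemma nu_right: "(nu \<psi> \<longlongrightarrow> nu \<psi> t) (at_right t)"
  by (rule isCont_nu[unfolded isCont_def, THEN tendsto_within_subset]) simp

lemma continuous_on_nu: "continuous_on S (nu \<psi>)"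
  by (simp add: continuous_at_imp_continuous_on isCont_nu)

lemma isCont_self: "isCont \<psi> t"
  using C1_UNIV_deriv(1)[OF C1] by (rule DERIV_isCont)

lemma deriv_eq_nu:
  assumes "0 < t" shows "deriv \<psi> t = nu \<psi> t * t"
  using assms by (simp add: nu_def)

text \<open>The concave function \<open>\<psi> (sqrt u)\<close> lies below its tangent at
  \<open>u = t0\<^sup>2\<close>, and by the chain rule that tangent has slope
  \<open>deriv \<psi> t0 / (2 * t0)\<close>, half of \<open>nu \<psi> t0\<close>.\<close>

lemma tangent_pos:
  assumes "0 \<le> t" "0 < t0"
  shows "\<psi> t \<le> \<psi> t0 + 1/2 * nu \<psi> t0 * (t\<^sup>2 - t0\<^sup>2)"
proof -
  let ?f = "\<lambda>u. \<psi> (sqrt u)"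
  have conv: "convex_on {0..} (\<lambda>u. - ?f u)"
    using concave_sqrt by (simp add: concave_on_def)
  have d: "(?f has_real_derivative 1/2 * nu \<psi> t0) (at (t0\<^sup>2))"
  proof -
    have "(sqrt has_real_derivative inverse (sqrt (t0\<^sup>2)) / 2) (at (t0\<^sup>2))"
      using assms by (intro DERIV_real_sqrt) auto
    from DERIV_chain2[OF C1_UNIV_deriv(1)[OF C1] this]
    have "(?f has_real_derivative deriv \<psi> (sqrt (t0\<^sup>2)) * (inverse (sqrt (t0\<^sup>2)) / 2)) (at (t0\<^sup>2))" .
    then show ?thesis
      using assms by (simp add: nu_def field_simps)
  qed
  have d': "((\<lambda>u. - ?f u) has_real_derivative - (1/2 * nu \<psi> t0)) (at (t0\<^sup>2) within {0..})"
    using DERIV_minus[OF d] by (rule has_field_derivative_at_within)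
  have i: "t0\<^sup>2 \<in> interior {0..}"
    using assms by simp
  have "- ?f (t\<^sup>2) - - ?f (t0\<^sup>2) \<ge> - (1/2 * nu \<psi> t0) * (t\<^sup>2 - t0\<^sup>2)"
    using convex_on_imp_above_tangent[OF conv _ i _ d', of "t\<^sup>2"] by simp
  then show ?thesis
    using assms by (simp add: algebra_simps)
qed

lemma tangent:
  assumes "0 \<le> t" "0 \<le> t0"
  shows "\<psi> t \<le> \<psi> t0 + 1/2 * nu \<psi> t0 * (t\<^sup>2 - t0\<^sup>2)"
proof (cases "t0 = 0")
  case True
  \<comment> \<open>At \<open>t0 = 0\<close> the square root has no derivative, so the bound is
    carried over from base points \<open>u > 0\<close> by continuity of \<open>\<psi>\<close> and
    \<open>nu \<psi>\<close>.\<close>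
  have "((\<lambda>u. \<psi> u + 1/2 * nu \<psi> u * (t\<^sup>2 - u\<^sup>2)) \<longlongrightarrow> \<psi> 0 + 1/2 * nu \<psi> 0 * (t\<^sup>2 - 0\<^sup>2)) (at_right 0)"
    by (intro tendsto_intros nu_right isCont_self[unfolded isCont_def, THEN tendsto_within_subset]) simp
  moreover have "eventually (\<lambda>u. \<psi> t \<le> \<psi> u + 1/2 * nu \<psi> u * (t\<^sup>2 - u\<^sup>2)) (at_right 0)"
    using tangent_pos[OF assms(1)] by (auto simp: eventually_at_filter)
  ultimately show ?thesis
    using True by (intro tendsto_lowerbound) auto
qed (use assms tangent_pos in auto)

end

text \<open>For \<open>a \<noteq> 0\<close> the tangent of \<open>\<psi>\<close> at
  \<open>norm a\<close> has slope \<open>nu \<psi> (norm a) * norm a\<close>, and Cauchy-Schwarz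
  compares the increment of the norm with the inner product; the sign of \<open>nu\<close> keeps the
  inequality in the right direction.\<close>

lemma convex_potential_tangent:
  fixes a a' :: "'b::real_inner"
  assumes "mm_potential \<psi>" "convex_on UNIV \<psi>" and nn: "\<And>t. 0 \<le> t \<Longrightarrow> 0 \<le> nu \<psi> t"
  shows "\<psi> (norm a) + nu \<psi> (norm a) * (a \<bullet> (a' - a)) \<le> \<psi> (norm a')"
proof -
  interpret mm_potential \<psi> by fact
  have tan: "\<psi> s + deriv \<psi> s * (t - s) \<le> \<psi> t" for s t
  proof -
    have "\<psi> t - \<psi> s \<ge> deriv \<psi> s * (t - s)"
      using C1_UNIV_deriv(1)[OF C1] by (intro convex_on_imp_above_tangent[OF assms(2)]) auto
    then show ?thesis by simp
  qed
  show ?thesis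
  proof (cases "a = 0")
    case True
    \<comment> \<open>Continuity of \<open>nu\<close> at 0 forces \<open>deriv \<psi> 0 = 0\<close>,
      so the tangent of \<open>\<psi>\<close> at 0 is horizontal, in agreement with the inner
      product vanishing for \<open>a = 0\<close>.\<close>
    have "((\<lambda>u. nu \<psi> u * u) \<longlongrightarrow> nu \<psi> 0 * 0) (at_right 0)"
      by (intro tendsto_intros nu_right)
    moreover have "(deriv \<psi> \<longlongrightarrow> deriv \<psi> 0) (at_right 0)"
      by (rule C1_UNIV_deriv(2)[OF C1, unfolded isCont_def, THEN tendsto_within_subset]) simp
    moreover have "eventually (\<lambda>u. nu \<psi> u * u = deriv \<psi> u) (at_right 0)"
      by (auto simp: eventually_at_filter nu_def)
    ultimately have "(deriv \<psi> \<longlongrightarrow> nu \<psi> 0 * 0) (at_right 0)"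
      using Lim_transform_eventually by blast
    with \<open>(deriv \<psi> \<longlongrightarrow> deriv \<psi> 0) (at_right 0)\<close> have "deriv \<psi> 0 = 0"
      using tendsto_unique[of "at_right (0::real)"] by fastforce
    then show ?thesis
      using tan[of 0 "norm a'"] True by simp
  next
    case False
    then have p: "0 < norm a" by simp
    have "a \<bullet> (a' - a) \<le> norm a * (norm a' - norm a)"
      using norm_cauchy_schwarz[of a a'] by (simp add: inner_diff_right right_diff_distrib dot_square_norm power2_eq_square)
    then have "nu \<psi> (norm a) * (a \<bullet> (a' - a)) \<le> nu \<psi> (norm a) * (norm a * (norm a' - norm a))"
      by (intro mult_left_mono nn) auto
    also have "\<dots> = deriv \<psi> (norm a) * (norm a' - norm a)"
      using deriv_eq_nu[OF p] by (simp add: mult_ac)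
    finally show ?thesis
      using tan[of "norm a" "norm a'"] by simp
  qed
qed

section \<open>Cluster points of sequences with vanishing steps\<close>

lemma cluster_pointsI:
  fixes x :: "nat \<Rightarrow> 'v::metric_space"
  assumes "\<And>e N. 0 < e \<Longrightarrow> \<exists>n\<ge>N. dist (x n) c < e"
  shows "c \<in> cluster_points x"
proof -
  have "\<exists>\<sigma>. \<forall>k. dist (x (\<sigma> k)) c < 1 / real (Suc k) \<and> \<sigma> k < \<sigma> (Suc k)"
  proof (rule dependent_nat_choice)
    show "\<exists>n. dist (x n) c < 1 / real (Suc 0)"
      using assms[of 1 0] by auto
  next
    fix n k assume "dist (x n) c < 1 / real (Suc k)"
    show "\<exists>n'. dist (x n') c < 1 / real (Suc (Suc k)) \<and> n < n'"
      using assms[of "1 / real (Suc (Suc k))" "Suc n"] by (auto simp: Suc_le_eq)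
  qed
  then obtain \<sigma> where \<sigma>: "\<And>k. dist (x (\<sigma> k)) c < 1 / real (Suc k)" "strict_mono \<sigma>"
    by (auto simp: strict_mono_Suc_iff)
  have le: "dist (x (\<sigma> k)) c \<le> 1 / real (Suc k)" for k
    by (rule less_imp_le[OF \<sigma>(1)])
  have "(\<lambda>k. dist (x (\<sigma> k)) c) \<longlonglongrightarrow> 0"
    by (rule tendsto_sandwich[OF _ _ tendsto_const LIMSEQ_Suc[OF lim_1_over_n]])
       (simp_all add: le del: of_nat_Suc)
  then have "(x \<circ> \<sigma>) \<longlonglongrightarrow> c"
    unfolding o_def by (rule tendsto_dist_iff[THEN iffD2])
  with \<sigma>(2) show ?thesis
    unfolding cluster_points_def by blast
qed

lemma cluster_points_frequently:
  fixes x :: "nat \<Rightarrow> 'v::metric_space"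
  assumes "c \<in> cluster_points x" "open U" "c \<in> U"
  shows "\<exists>n\<ge>N. x n \<in> U"
proof -
  obtain \<sigma> where \<sigma>: "strict_mono \<sigma>" "(x \<circ> \<sigma>) \<longlonglongrightarrow> c"
    using assms(1) unfolding cluster_points_def by blast
  obtain K where K: "\<And>k. K \<le> k \<Longrightarrow> (x \<circ> \<sigma>) k \<in> U"
    using topological_tendstoD[OF \<sigma>(2) assms(2,3)] by (auto simp: eventually_sequentially)
  have "N \<le> \<sigma> (max K N)"
    using seq_suble[OF \<sigma>(1), of "max K N"] by simp
  then show ?thesis
    using K[of "max K N"] by auto
qed

text \<open>Bolzano-Weierstrass inside a prescribed infinite index set. In the arguments by
  contradiction, \<open>I\<close> collects the offending indices, so that the misbehaviour is
  inherited by a subsequence converging to a cluster point.\<close>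

lemma bounded_subseq_cluster_point:
  fixes x :: "nat \<Rightarrow> 'v::euclidean_space"
  assumes "bounded (range x)" "infinite I"
  obtains \<sigma> c where "strict_mono \<sigma>" "range \<sigma> \<subseteq> I" "(x \<circ> \<sigma>) \<longlonglongrightarrow> c" "c \<in> cluster_points x"
proof -
  obtain \<tau> :: "nat \<Rightarrow> nat" where \<tau>: "strict_mono \<tau>" "\<And>n. \<tau> n \<in> I"
    using infinite_enumerate[OF assms(2)] by metis
  have "bounded (range (x \<circ> \<tau>))"
    using assms(1) by (rule bounded_subset) auto
  then obtain c \<kappa> where \<kappa>: "strict_mono \<kappa>" "((x \<circ> \<tau>) \<circ> \<kappa>) \<longlonglongrightarrow> c"
    using bounded_imp_convergent_subsequence by blast
  have "strict_mono (\<tau> \<circ> \<kappa>)"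
    using \<tau>(1) \<kappa>(1) by (rule strict_mono_o)
  with \<kappa>(2) have "c \<in> cluster_points x"
    unfolding cluster_points_def by (auto simp: o_assoc)
  with \<open>strict_mono (\<tau> \<circ> \<kappa>)\<close> \<tau>(2) \<kappa>(2) show thesis
    by (intro that[of "\<tau> \<circ> \<kappa>" c]) (auto simp: o_assoc)
qed

lemma cluster_points_nonempty:
  fixes x :: "nat \<Rightarrow> 'v::euclidean_space"
  assumes "bounded (range x)"
  shows "cluster_points x \<noteq> {}"
  by (rule bounded_subseq_cluster_point[OF assms infinite_UNIV_nat]) auto

lemma closed_cluster_points:
  fixes x :: "nat \<Rightarrow> 'v::metric_space"
  shows "closed (cluster_points x)"
proof -
  have "c \<in> cluster_points x" if c: "\<And>e. 0 < e \<Longrightarrow> \<exists>y\<in>cluster_points x. dist y c < e" for c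
  proof (rule cluster_pointsI)
    fix e :: real and N :: nat assume "0 < e"
    then obtain y where y: "y \<in> cluster_points x" "dist y c < e / 2"
      using c[of "e / 2"] by auto
    obtain n where "N \<le> n" "x n \<in> ball y (e / 2)"
      using cluster_points_frequently[OF y(1), of "ball y (e / 2)" N] \<open>0 < e\<close> by auto
    moreover from this y(2) have "dist (x n) c < e"
      using dist_triangle_half_r[of y "x n" e c] by (auto simp: dist_commute)
    ultimately show "\<exists>n\<ge>N. dist (x n) c < e"
      by auto
  qed
  then have "closure (cluster_points x) \<subseteq> cluster_points x"
    by (auto simp: closure_approachable)
  then show ?thesis
    by (simp add: closure_subset_eq)
qed

lemma compact_cluster_points:
  fixes x :: "nat \<Rightarrow> 'v::euclidean_space"
  assumes "bounded (range x)"
  shows "compact (cluster_points x)"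
proof -
  have "cluster_points x \<subseteq> closure (range x)"
  proof
    fix c assume "c \<in> cluster_points x"
    then have "\<exists>n\<ge>0. x n \<in> ball c e" if "0 < e" for e
      using that by (intro cluster_points_frequently) auto
    then show "c \<in> closure (range x)"
      by (auto simp: closure_approachable dist_commute)
  qed
  then have "bounded (cluster_points x)"
    using bounded_closure[OF assms] bounded_subset by blast
  then show ?thesis
    by (simp add: compact_eq_bounded_closed closed_cluster_points)
qed

text \<open>A splitting of the compact cluster set would give disjoint open \<open>U\<close> and
  \<open>W\<close> around its two parts. The sequence ends up in their union and visits both for
  ever, hence jumps from \<open>U\<close> to \<open>W\<close> infinitely often. Along the jumps a
  subsequence converges, and since the steps vanish both ends of a jump have the same limit, which
  cannot lie in \<open>U\<close> nor in \<open>W\<close>.\<close>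

lemma connected_cluster_points:
  fixes x :: "nat \<Rightarrow> 'v::euclidean_space"
  assumes bd: "bounded (range x)" and step: "(\<lambda>n. x (Suc n) - x n) \<longlonglongrightarrow> 0"
  shows "connected (cluster_points x)"
proof (rule ccontr)
  assume "\<not> connected (cluster_points x)"
  then obtain A B where AB: "closed A" "closed B" "cluster_points x \<subseteq> A \<union> B"
      "A \<inter> B \<inter> cluster_points x = {}" "A \<inter> cluster_points x \<noteq> {}" "B \<inter> cluster_points x \<noteq> {}"
    unfolding connected_closed by blast
  have c: "compact (cluster_points x \<inter> A)" "compact (cluster_points x \<inter> B)"
    using compact_cluster_points[OF bd] AB(1,2) by (auto intro: compact_Int_closed)
  obtain U W where UW: "open U" "open W" "cluster_points x \<inter> A \<subseteq> U" "cluster_points x \<inter> B \<subseteq> W"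
      "U \<inter> W = {}"
  proof -
    have disj: "(cluster_points x \<inter> A) \<inter> (cluster_points x \<inter> B) = {}"
      using AB(4) by blast
    show thesis
      by (rule separation_normal_compact[OF c(1) compact_imp_closed[OF c(2)] disj])
         (rule that; assumption)
  qed
  have sub: "cluster_points x \<subseteq> U \<union> W"
    using UW AB(3) by auto
  have ev: "eventually (\<lambda>n. x n \<in> U \<union> W) sequentially"
  proof (rule ccontr)
    assume "\<not> ?thesis"
    then have "infinite {n. x n \<notin> U \<union> W}"
      unfolding cofinite_eq_sequentially[symmetric] eventually_cofinite by simp
    then obtain \<sigma> c where
      \<sigma>: "strict_mono \<sigma>" "range \<sigma> \<subseteq> {n. x n \<notin> U \<union> W}" "(x \<circ> \<sigma>) \<longlonglongrightarrow> c" "c \<in> cluster_points x"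
      by (rule bounded_subseq_cluster_point[OF bd])
    have "eventually (\<lambda>k. (x \<circ> \<sigma>) k \<in> U \<union> W) sequentially"
      by (rule topological_tendstoD[OF \<sigma>(3)]) (use \<sigma>(4) sub UW in auto)
    then show False
      using \<sigma>(2) by (auto dest!: eventually_happens)
  qed
  then obtain N where N: "\<And>n. N \<le> n \<Longrightarrow> x n \<in> U \<or> x n \<in> W"
    by (auto simp: eventually_sequentially)
  have freqU: "\<exists>n\<ge>k. x n \<in> U" for k
    using cluster_points_frequently[OF _ UW(1), of _ x] AB(5) UW(3) by blast
  have freqW: "\<exists>n\<ge>k. x n \<in> W" for k
    using cluster_points_frequently[OF _ UW(2), of _ x] AB(6) UW(4) by blast
  have cross: "\<exists>n\<ge>k. x n \<in> U \<and> x (Suc n) \<in> W" for k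
  proof (rule ccontr)
    assume nc: "\<not> ?thesis"
    obtain n0 where n0: "max k N \<le> n0" "x n0 \<in> U" using freqU by blast
    have "x n \<in> U" if "n0 \<le> n" for n
      using that
    proof (induction n rule: dec_induct)
      case (step n)
      then show ?case using nc n0 N[of "Suc n"] by auto
    qed (use n0 in auto)
    then show False
      using freqW[of n0] UW(5) by auto
  qed
  then have "infinite {n. x n \<in> U \<and> x (Suc n) \<in> W}"
    unfolding infinite_nat_iff_unbounded_le by auto
  then obtain \<sigma> c where
    \<sigma>: "strict_mono \<sigma>" "range \<sigma> \<subseteq> {n. x n \<in> U \<and> x (Suc n) \<in> W}" "(x \<circ> \<sigma>) \<longlonglongrightarrow> c"
       "c \<in> cluster_points x"
    by (rule bounded_subseq_cluster_point[OF bd])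
  have \<sigma>': "(\<lambda>k. x (Suc (\<sigma> k))) \<longlonglongrightarrow> c"
    using tendsto_add[OF \<sigma>(3) LIMSEQ_subseq_LIMSEQ[OF step \<sigma>(1)]] by (simp add: o_def)
  show False
  proof (cases "c \<in> U")
    case True
    have "eventually (\<lambda>k. x (Suc (\<sigma> k)) \<in> U) sequentially"
      using topological_tendstoD[OF \<sigma>' UW(1) True] .
    then obtain k where "x (Suc (\<sigma> k)) \<in> U"
      by (auto dest!: eventually_happens)
    then show False
      using \<sigma>(2) UW(5) by auto
  next
    case False
    then have "c \<in> W" using \<sigma>(4) sub by auto
    have "eventually (\<lambda>k. (x \<circ> \<sigma>) k \<in> W) sequentially"
      using topological_tendstoD[OF \<sigma>(3) UW(2) \<open>c \<in> W\<close>] .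
    then obtain k where "x (\<sigma> k) \<in> W"
      by (auto dest!: eventually_happens)
    then show False
      using \<sigma>(2) UW(5) by auto
  qed
qed

lemma LIMSEQ_unique_cluster_point:
  fixes x :: "nat \<Rightarrow> 'v::euclidean_space"
  assumes bd: "bounded (range x)" and "\<And>c. c \<in> cluster_points x \<Longrightarrow> c = g"
  shows "x \<longlonglongrightarrow> g"
proof (rule topological_tendstoI, rule ccontr)
  fix S assume S: "open S" "g \<in> S" and "\<not> eventually (\<lambda>n. x n \<in> S) sequentially"
  then have "infinite {n. x n \<notin> S}"
    unfolding cofinite_eq_sequentially[symmetric] eventually_cofinite by simp
  then obtain \<sigma> c where
    \<sigma>: "strict_mono \<sigma>" "range \<sigma> \<subseteq> {n. x n \<notin> S}" "(x \<circ> \<sigma>) \<longlonglongrightarrow> c" "c \<in> cluster_points x"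
    by (rule bounded_subseq_cluster_point[OF bd])
  have "eventually (\<lambda>k. (x \<circ> \<sigma>) k \<in> S) sequentially"
    using S(1) S(2)[folded assms(2)[OF \<sigma>(4)]] by (rule topological_tendstoD[OF \<sigma>(3)])
  then show False
    using \<sigma>(2) by (auto dest!: eventually_happens)
qed

section \<open>Measurability of the pseudo-inverse\<close>

text \<open>The size of the Gram matrix is a number varying with the iteration, and measurability is
  an entrywise question, so matrices are handled as functions of which only the entries below
  \<open>m\<close> matter.\<close>

definition sqm_mult :: "nat \<Rightarrow> (nat \<Rightarrow> nat \<Rightarrow> real) \<Rightarrow> (nat \<Rightarrow> nat \<Rightarrow> real) \<Rightarrow> nat \<Rightarrow> nat \<Rightarrow> real" where
  "sqm_mult m f g i j = (\<Sum>l<m. f i l * g l j)"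

text \<open>The sum is the squared Frobenius norm of \<open>g\<close>. The step times this norm
  stays below 1, and the added 1 covers the zero matrix.\<close>

definition sqm_step :: "nat \<Rightarrow> (nat \<Rightarrow> nat \<Rightarrow> real) \<Rightarrow> real" where
  "sqm_step m g = 1 / (1 + (\<Sum>i<m. \<Sum>j<m. (g i j)\<^sup>2))"

text \<open>The Landweber iteration \<open>H \<leftarrow> H + \<alpha> G (I - G H)\<close>. Its entries are rational functions of those of
  \<open>G\<close>, and for symmetric \<open>G\<close> it converges to the Moore--Penrose inverse whenever there is one, so
  measurability of the pseudo-inverse needs no existence proof.\<close>

fun landweber :: "nat \<Rightarrow> (nat \<Rightarrow> nat \<Rightarrow> real) \<Rightarrow> nat \<Rightarrow> nat \<Rightarrow> nat \<Rightarrow> real" where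
  "landweber m g 0 = (\<lambda>i j. 0)"
| "landweber m g (Suc k) = (\<lambda>i j. landweber m g k i j +
     sqm_step m g * (g i j - sqm_mult m g (sqm_mult m g (landweber m g k)) i j))"

definition penrose :: "nat \<Rightarrow> (nat \<Rightarrow> nat \<Rightarrow> real) \<Rightarrow> (nat \<Rightarrow> nat \<Rightarrow> real) \<Rightarrow> bool" where
  "penrose m g h \<longleftrightarrow> (\<forall>i<m. \<forall>j<m.
     sqm_mult m (sqm_mult m g h) g i j = g i j \<and>
     sqm_mult m (sqm_mult m h g) h i j = h i j \<and>
     sqm_mult m g h j i = sqm_mult m g h i j \<and>
     sqm_mult m h g j i = sqm_mult m h g i j)"

lemma sqm_mult_assoc:
  "sqm_mult m (sqm_mult m f g) h i j = sqm_mult m f (sqm_mult m g h) i j"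
proof -
  have "(\<Sum>l<m. \<Sum>p<m. f i p * g p l * h l j) = (\<Sum>p<m. \<Sum>l<m. f i p * g p l * h l j)"
    by (rule sum.swap)
  then show ?thesis
    by (simp add: sqm_mult_def sum_distrib_left sum_distrib_right mult.assoc)
qed

lemma sqm_mult_cong:
  assumes "\<And>l. l < m \<Longrightarrow> f i l = f' i l" "\<And>l. l < m \<Longrightarrow> g l j = g' l j"
  shows "sqm_mult m f g i j = sqm_mult m f' g' i j"
  using assms by (simp add: sqm_mult_def)

lemma sqm_mult_vec_bound:
  "(\<Sum>i<m. (\<Sum>l<m. f i l * x l)\<^sup>2) \<le> (\<Sum>i<m. \<Sum>l<m. (f i l)\<^sup>2) * (\<Sum>l<m. (x l :: real)\<^sup>2)"
  unfolding sum_distrib_right by (intro sum_mono) (simp add: Cauchy_Schwarz_ineq_sum flip: sum_distrib_right)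

text \<open>The second hypothesis reads \<open>e = H G e\<close>, so \<open>e\<close> is controlled
  by \<open>G e\<close> through the Frobenius norm of \<open>H\<close>. For symmetric
  \<open>G\<close> the cross term in the expansion of the square is the squared norm of
  \<open>G e\<close>; the step size lets it absorb the term in \<open>G G e\<close>, and what is
  left is a fixed fraction of the squared norm of \<open>e\<close>.\<close>

lemma sqm_contraction:
  fixes g h :: "nat \<Rightarrow> nat \<Rightarrow> real" and e :: "nat \<Rightarrow> real"
  assumes sym: "\<And>i j. i < m \<Longrightarrow> j < m \<Longrightarrow> g i j = g j i"
    and e: "\<And>i. i < m \<Longrightarrow> e i = (\<Sum>p<m. h i p * (\<Sum>l<m. g p l * e l))"
  shows "(\<Sum>i<m. (e i - sqm_step m g * (\<Sum>p<m. g i p * (\<Sum>l<m. g p l * e l)))\<^sup>2)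
    \<le> (1 - sqm_step m g / (1 + (\<Sum>i<m. \<Sum>j<m. (h i j)\<^sup>2))) * (\<Sum>i<m. (e i)\<^sup>2)"
proof -
  define S where "S = (\<Sum>i<m. \<Sum>j<m. (g i j)\<^sup>2)"
  define T where "T = (\<Sum>i<m. \<Sum>j<m. (h i j)\<^sup>2)"
  define a where "a = sqm_step m g"
  define f where "f p = (\<Sum>l<m. g p l * e l)" for p
  define q where "q i = (\<Sum>p<m. g i p * f p)" for i
  have S0: "0 \<le> S" and T0: "0 \<le> T"
    unfolding S_def T_def by (auto intro!: sum_nonneg)
  have a: "0 < a" "a * S \<le> 1"
    using S0 by (auto simp: a_def sqm_step_def S_def[symmetric] divide_simps)
  have cross: "(\<Sum>i<m. e i * q i) = (\<Sum>i<m. (f i)\<^sup>2)"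
  proof -
    have "(\<Sum>i<m. e i * q i) = (\<Sum>i<m. \<Sum>p<m. e i * (g i p * f p))"
      by (simp add: q_def sum_distrib_left)
    also have "\<dots> = (\<Sum>p<m. \<Sum>i<m. e i * (g i p * f p))"
      by (rule sum.swap)
    also have "\<dots> = (\<Sum>p<m. (\<Sum>i<m. g p i * e i) * f p)"
      unfolding sum_distrib_right using sym by (intro sum.cong) (auto simp: mult_ac)
    finally show ?thesis
      by (simp add: f_def power2_eq_square)
  qed
  have q2: "(\<Sum>i<m. (q i)\<^sup>2) \<le> S * (\<Sum>i<m. (f i)\<^sup>2)"
    unfolding q_def S_def by (rule sqm_mult_vec_bound)
  have e2: "(\<Sum>i<m. (e i)\<^sup>2) \<le> T * (\<Sum>i<m. (f i)\<^sup>2)"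
  proof -
    have "(\<Sum>i<m. (e i)\<^sup>2) = (\<Sum>i<m. (\<Sum>p<m. h i p * f p)\<^sup>2)"
      using e by (intro sum.cong) (auto simp: f_def)
    then show ?thesis
      unfolding T_def using sqm_mult_vec_bound by simp
  qed
  have f0: "0 \<le> (\<Sum>i<m. (f i)\<^sup>2)" by (auto intro!: sum_nonneg)
  have "(\<Sum>i<m. (e i - a * q i)\<^sup>2)
      = (\<Sum>i<m. (e i)\<^sup>2) - 2 * a * (\<Sum>i<m. (f i)\<^sup>2) + a\<^sup>2 * (\<Sum>i<m. (q i)\<^sup>2)"
    unfolding cross[symmetric]
    by (simp add: power2_diff sum.distrib sum_subtractf sum_distrib_left power_mult_distrib mult_ac)
  also have "a\<^sup>2 * (\<Sum>i<m. (q i)\<^sup>2) \<le> a\<^sup>2 * (S * (\<Sum>i<m. (f i)\<^sup>2))"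
    using q2 by (intro mult_left_mono) auto
  also have "a\<^sup>2 * (S * (\<Sum>i<m. (f i)\<^sup>2)) = (a * S) * (a * (\<Sum>i<m. (f i)\<^sup>2))"
    by (simp add: power2_eq_square)
  also have "\<dots> \<le> 1 * (a * (\<Sum>i<m. (f i)\<^sup>2))"
    using a f0 by (intro mult_right_mono) auto
  finally have "(\<Sum>i<m. (e i - a * q i)\<^sup>2) \<le> (\<Sum>i<m. (e i)\<^sup>2) - a * (\<Sum>i<m. (f i)\<^sup>2)"
    by simp
  moreover have "a / (1 + T) * (\<Sum>i<m. (e i)\<^sup>2) \<le> a * (\<Sum>i<m. (f i)\<^sup>2)"
  proof -
    have "(\<Sum>i<m. (e i)\<^sup>2) \<le> (1 + T) * (\<Sum>i<m. (f i)\<^sup>2)"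
      using e2 f0 by (simp add: distrib_right)
    then have "a / (1 + T) * (\<Sum>i<m. (e i)\<^sup>2) \<le> a / (1 + T) * ((1 + T) * (\<Sum>i<m. (f i)\<^sup>2))"
      using a T0 by (intro mult_left_mono) auto
    then show ?thesis
      using T0 by simp
  qed
  ultimately show ?thesis
    by (simp add: q_def f_def a_def T_def left_diff_distrib)
qed

text \<open>Column \<open>j\<close> of the error satisfies
  \<open>e \<leftarrow> e - \<alpha> G G e\<close>, because \<open>G G H = G\<close> makes
  \<open>H\<close> a fixed point. The relation \<open>e = H G e\<close> needed for contraction holds
  for the initial error \<open>- H\<close> and is preserved because \<open>H G G = G\<close>. The
  conclusion also gives uniqueness of \<open>H\<close>.\<close>

lemma landweber_tendsto:
  assumes sym: "\<And>i j. i < m \<Longrightarrow> j < m \<Longrightarrow> g i j = g j i"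
    and pen: "penrose m g h" and "i < m" "j < m"
  shows "(\<lambda>k. landweber m g k i j) \<longlonglongrightarrow> h i j"
proof -
  define e where "e k p = landweber m g k p j - h p j" for k p
  define a where "a = sqm_step m g"
  define T where "T = 1 + (\<Sum>i<m. \<Sum>j<m. (h i j)\<^sup>2)"
  \<comment> \<open>As \<open>G\<close> and \<open>G H\<close> are symmetric, \<open>G G H\<close>
    is the transpose of \<open>G H G\<close>, that is, \<open>G\<close> again.\<close>
  have ggh: "sqm_mult m g (sqm_mult m g h) p l = g p l" if "p < m" "l < m" for p l
  proof -
    have "sqm_mult m g (sqm_mult m g h) p l = sqm_mult m g (\<lambda>i j. sqm_mult m g h j i) p l"
      using pen that by (intro sqm_mult_cong) (auto simp: penrose_def)
    also have "\<dots> = sqm_mult m (sqm_mult m g h) g l p"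
      unfolding sqm_mult_def[of m g "\<lambda>i j. sqm_mult m g h j i"] sqm_mult_def[of m "sqm_mult m g h" g]
      using sym that by (intro sum.cong) auto
    also have "\<dots> = g p l"
      using pen sym that by (auto simp: penrose_def)
    finally show ?thesis .
  qed
  have hgg: "sqm_mult m (sqm_mult m h g) g p l = g p l" if "p < m" "l < m" for p l
  proof -
    have "sqm_mult m (sqm_mult m h g) g p l = sqm_mult m g (sqm_mult m h g) l p"
      unfolding sqm_mult_def[of m g "sqm_mult m h g"] sqm_mult_def[of m "sqm_mult m h g" g]
      using sym that pen by (intro sum.cong) (auto simp: penrose_def)
    also have "\<dots> = sqm_mult m (sqm_mult m g h) g l p"
      by (simp add: sqm_mult_assoc)
    also have "\<dots> = g p l"
      using pen sym that by (auto simp: penrose_def)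
    finally show ?thesis .
  qed
  have e_Suc: "e (Suc k) p = e k p - a * (\<Sum>q<m. g p q * (\<Sum>l<m. g q l * e k l))" if "p < m" for k p
  proof -
    have "(\<Sum>q<m. g p q * (\<Sum>l<m. g q l * e k l))
        = sqm_mult m g (sqm_mult m g (landweber m g k)) p j - sqm_mult m g (sqm_mult m g h) p j"
      by (simp add: e_def sqm_mult_def right_diff_distrib sum_subtractf)
    moreover have "e (Suc k) p = e k p + a * (g p j - sqm_mult m g (sqm_mult m g (landweber m g k)) p j)"
      by (simp add: e_def a_def)
    ultimately show ?thesis
      using ggh[OF that \<open>j < m\<close>] by (simp add: right_diff_distrib)
  qed
  have inv: "\<forall>p<m. e k p = (\<Sum>q<m. h p q * (\<Sum>l<m. g q l * e k l))" for k
  proof (induction k)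
    case 0
    have "(\<Sum>q<m. h p q * (\<Sum>l<m. g q l * e 0 l)) = - sqm_mult m h (sqm_mult m g h) p j" for p
      by (simp add: e_def sqm_mult_def sum_negf)
    moreover have "sqm_mult m h (sqm_mult m g h) p j = h p j" if "p < m" for p
      using pen that \<open>j < m\<close> by (simp add: penrose_def flip: sqm_mult_assoc)
    ultimately show ?case
      by (simp add: e_def)
  next
    case (Suc k)
    define u where "u q = (\<Sum>l<m. g q l * e k l)" for q
    have step: "e (Suc k) p = e k p - a * (\<Sum>q<m. g p q * u q)" if "p < m" for p
      using e_Suc[OF that] by (simp add: u_def)
    show ?case
    proof (intro allI impI)
      fix p assume p: "p < m"
      have "(\<Sum>q<m. h p q * (\<Sum>l<m. g q l * e (Suc k) l))
          = (\<Sum>q<m. h p q * (\<Sum>l<m. g q l * (e k l - a * (\<Sum>r<m. g l r * u r))))"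
        using step by simp
      also have "\<dots> = (\<Sum>q<m. h p q * (\<Sum>l<m. g q l * e k l))
          - a * sqm_mult m h (sqm_mult m g (sqm_mult m g (\<lambda>r _. u r))) p j"
        by (simp add: sqm_mult_def right_diff_distrib sum_subtractf sum_distrib_left mult_ac)
      also have "sqm_mult m h (sqm_mult m g (sqm_mult m g (\<lambda>r _. u r))) p j
          = sqm_mult m (sqm_mult m (sqm_mult m h g) g) (\<lambda>r _. u r) p j"
        by (simp add: sqm_mult_assoc)
      also have "\<dots> = sqm_mult m g (\<lambda>r _. u r) p j"
        using hgg p by (intro sqm_mult_cong) auto
      finally show "e (Suc k) p = (\<Sum>q<m. h p q * (\<Sum>l<m. g q l * e (Suc k) l))"
        using Suc p step[OF p] by (simp add: sqm_mult_def)
    qed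
  qed
  define c where "c = 1 - a / T"
  have "0 \<le> (\<Sum>i<m. \<Sum>j<m. (g i j)\<^sup>2)" "1 \<le> T"
    by (auto simp: T_def intro!: sum_nonneg)
  then have "0 < a" "a \<le> 1" "1 \<le> T"
    by (auto simp: a_def sqm_step_def divide_simps)
  then have c: "0 \<le> c" "c < 1"
    by (auto simp: c_def divide_simps)
  have bound: "(\<Sum>i<m. (e k i)\<^sup>2) \<le> c ^ k * (\<Sum>i<m. (e 0 i)\<^sup>2)" for k
  proof (induction k)
    case (Suc k)
    have "(\<Sum>i<m. (e (Suc k) i)\<^sup>2) = (\<Sum>i<m. (e k i - a * (\<Sum>q<m. g i q * (\<Sum>l<m. g q l * e k l)))\<^sup>2)"
      using e_Suc by (intro sum.cong) auto
    also have "\<dots> \<le> c * (\<Sum>i<m. (e k i)\<^sup>2)"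
      unfolding c_def T_def a_def using sym inv by (intro sqm_contraction) auto
    also have "\<dots> \<le> c * (c ^ k * (\<Sum>i<m. (e 0 i)\<^sup>2))"
      using Suc c by (intro mult_left_mono) auto
    finally show ?case
      by (simp add: mult.assoc)
  qed simp
  have "(\<lambda>k. c ^ k * (\<Sum>i<m. (e 0 i)\<^sup>2)) \<longlonglongrightarrow> 0 * (\<Sum>i<m. (e 0 i)\<^sup>2)"
    using c by (intro tendsto_mult LIMSEQ_realpow_zero tendsto_const)
  then have lim: "(\<lambda>k. c ^ k * (\<Sum>i<m. (e 0 i)\<^sup>2)) \<longlonglongrightarrow> 0"
    by simp
  have le: "(e k i)\<^sup>2 \<le> c ^ k * (\<Sum>i<m. (e 0 i)\<^sup>2)" for k
    using bound[of k] member_le_sum[of i "{..<m}" "\<lambda>i. (e k i)\<^sup>2"] \<open>i < m\<close> by simp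
  have "(\<lambda>k. (e k i)\<^sup>2) \<longlonglongrightarrow> 0"
    by (rule tendsto_sandwich[OF _ _ tendsto_const lim]) (simp_all add: le)
  then have "(\<lambda>k. e k i) \<longlonglongrightarrow> 0"
    using power_tendsto_0_iff[of 2] by fastforce
  then show ?thesis
    unfolding e_def by (rule LIM_zero_cancel)
qed

lemma penrose_iff:
  assumes "G \<in> carrier_mat m m" "H \<in> carrier_mat m m"
  shows "penrose m (\<lambda>i j. G $$ (i, j)) (\<lambda>i j. H $$ (i, j)) \<longleftrightarrow>
    G * H * G = G \<and> H * G * H = H \<and>
    transpose_mat (G * H) = G * H \<and> transpose_mat (H * G) = H * G"
proof -
  have mult: "(A * B) $$ (i, j) = sqm_mult m (\<lambda>i j. A $$ (i, j)) (\<lambda>i j. B $$ (i, j)) i j"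
    if "A \<in> carrier_mat m m" "B \<in> carrier_mat m m" "i < m" "j < m" for A B :: "real mat" and i j
    using that by (auto simp: sqm_mult_def Matrix.scalar_prod_def lessThan_atLeast0)
  have mult3: "(A * B * C) $$ (i, j) = sqm_mult m (sqm_mult m (\<lambda>i j. A $$ (i, j)) (\<lambda>i j. B $$ (i, j))) (\<lambda>i j. C $$ (i, j)) i j"
    if "A \<in> carrier_mat m m" "B \<in> carrier_mat m m" "C \<in> carrier_mat m m" "i < m" "j < m" for A B C :: "real mat" and i j
    using that mult[OF mult_carrier_mat[OF that(1,2)] that(3-5)] mult
    by (auto intro!: sqm_mult_cong)
  have eq: "A = B \<longleftrightarrow> (\<forall>i<m. \<forall>j<m. A $$ (i, j) = B $$ (i, j))"
    if "A \<in> carrier_mat m m" "B \<in> carrier_mat m m" for A B :: "real mat"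
    using that by (auto intro!: eq_matI)
  let ?g = "\<lambda>i j. G $$ (i, j)" and ?h = "\<lambda>i j. H $$ (i, j)"
  have c: "G * H \<in> carrier_mat m m" "H * G \<in> carrier_mat m m"
      "G * H * G \<in> carrier_mat m m" "H * G * H \<in> carrier_mat m m"
    using assms by auto
  have t: "transpose_mat (A * B) $$ (i, j) = sqm_mult m (\<lambda>i j. A $$ (i, j)) (\<lambda>i j. B $$ (i, j)) j i"
    if "A \<in> carrier_mat m m" "B \<in> carrier_mat m m" "i < m" "j < m" for A B :: "real mat" and i j
    using that mult[OF that(1,2,4,3)] by (subst index_transpose_mat) auto
  have "G * H * G = G \<longleftrightarrow> (\<forall>i<m. \<forall>j<m. sqm_mult m (sqm_mult m ?g ?h) ?g i j = G $$ (i, j))"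
    unfolding eq[OF c(3) assms(1)] using mult3[OF assms(1) assms(2) assms(1)] by metis
  moreover have "H * G * H = H \<longleftrightarrow> (\<forall>i<m. \<forall>j<m. sqm_mult m (sqm_mult m ?h ?g) ?h i j = H $$ (i, j))"
    unfolding eq[OF c(4) assms(2)] using mult3[OF assms(2) assms(1) assms(2)] by metis
  moreover have "transpose_mat (G * H) = G * H \<longleftrightarrow>
      (\<forall>i<m. \<forall>j<m. sqm_mult m ?g ?h j i = sqm_mult m ?g ?h i j)"
    unfolding eq[OF transpose_carrier_mat[THEN iffD2, OF c(1)] c(1)] using mult[OF assms] t[OF assms] by metis
  moreover have "transpose_mat (H * G) = H * G \<longleftrightarrow>
      (\<forall>i<m. \<forall>j<m. sqm_mult m ?h ?g j i = sqm_mult m ?h ?g i j)"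
    unfolding eq[OF transpose_carrier_mat[THEN iffD2, OF c(2)] c(2)]
    using mult[OF assms(2,1)] t[OF assms(2,1)] by metis
  ultimately show ?thesis
    by (simp only: penrose_def all_conj_distrib imp_conjR)
qed

text \<open>Any solution of the Penrose equations is the limit \<open>L\<close> of the iteration, so
  testing the equations on \<open>L\<close> decides whether a solution exists. If the test fails,
  the predicate under \<open>THE\<close> is identically false and its value is one fixed matrix, the
  same for every such \<open>G\<close>; this is what measurability requires.\<close>

lemma pseudo_inverse_eq:
  assumes G: "G \<in> carrier_mat m m" and sym: "\<And>i j. i < m \<Longrightarrow> j < m \<Longrightarrow> G $$ (i, j) = G $$ (j, i)"
  defines "L \<equiv> \<lambda>i j. lim (\<lambda>k. landweber m (\<lambda>i j. G $$ (i, j)) k i j)"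
  shows "pseudo_inverse G =
    (if penrose m (\<lambda>i j. G $$ (i, j)) L then Matrix.mat m m (\<lambda>(i, j). L i j) else (THE H. False))"
proof -
  let ?P = "\<lambda>H. H \<in> carrier_mat (dim_col G) (dim_row G) \<and>
     G * H * G = G \<and> H * G * H = H \<and>
     transpose_mat (G * H) = G * H \<and> transpose_mat (H * G) = H * G"
  let ?L = "Matrix.mat m m (\<lambda>(i, j). L i j)"
  have P: "?P H \<longleftrightarrow> H \<in> carrier_mat m m \<and> penrose m (\<lambda>i j. G $$ (i, j)) (\<lambda>i j. H $$ (i, j))" for H
    using penrose_iff[OF G, of H] G by auto
  have unique: "H = ?L" if PH: "?P H" for H
  proof -
    have "L i j = H $$ (i, j)" if ij: "i < m" "j < m" for i j
      unfolding L_def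
    proof (rule limI, rule landweber_tendsto)
      show "penrose m (\<lambda>i j. G $$ (i, j)) (\<lambda>i j. H $$ (i, j))"
        using PH unfolding P by (rule conjunct2)
      show "G $$ (k, l) = G $$ (l, k)" if "k < m" "l < m" for k l
        using that by (rule sym)
    qed (use ij in auto)
    then show ?thesis
      using PH unfolding P by (intro eq_matI) auto
  qed
  have PL: "?P ?L \<longleftrightarrow> penrose m (\<lambda>i j. G $$ (i, j)) L"
    unfolding P by (auto simp: penrose_def sqm_mult_def)
  show ?thesis
  proof (cases "penrose m (\<lambda>i j. G $$ (i, j)) L")
    case True
    have "(THE H. ?P H) = ?L"
      by (rule the_equality) (use True PL in blast, erule unique)
    with True show ?thesis
      unfolding pseudo_inverse_def by simp
  next
    case False
    have "?P H \<longleftrightarrow> False" for H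
    proof
      assume PH: "?P H"
      from PH unique[OF PH] have "?P ?L" by (rule back_subst)
      with PL False show False by blast
    qed (erule FalseE)
    then have "(THE H. ?P H) = (THE H. False)"
      by (simp only:)
    with False show ?thesis
      unfolding pseudo_inverse_def by simp
  qed
qed

lemma borel_measurable_sqm_mult:
  assumes "\<And>i j. i < m \<Longrightarrow> j < m \<Longrightarrow> (\<lambda>\<omega>. f \<omega> i j) \<in> borel_measurable N"
    and "\<And>i j. i < m \<Longrightarrow> j < m \<Longrightarrow> (\<lambda>\<omega>. g \<omega> i j) \<in> borel_measurable N" and "i < m" "j < m"
  shows "(\<lambda>\<omega>. sqm_mult m (f \<omega>) (g \<omega>) i j) \<in> borel_measurable N"
  unfolding sqm_mult_def using assms by (intro borel_measurable_sum borel_measurable_times) auto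

lemma borel_measurable_landweber:
  assumes g: "\<And>i j. i < m \<Longrightarrow> j < m \<Longrightarrow> (\<lambda>\<omega>. g \<omega> i j) \<in> borel_measurable N" and "i < m" "j < m"
  shows "(\<lambda>\<omega>. landweber m (g \<omega>) k i j) \<in> borel_measurable N"
  using assms(2,3)
proof (induction k arbitrary: i j)
  case (Suc k)
  have "(\<lambda>\<omega>. sqm_step m (g \<omega>)) \<in> borel_measurable N"
    unfolding sqm_step_def using g
    by (intro borel_measurable_divide borel_measurable_add borel_measurable_const borel_measurable_sum
        borel_measurable_power) auto
  then show ?case
    unfolding landweber.simps using Suc g
    by (intro borel_measurable_add borel_measurable_times borel_measurable_diff borel_measurable_sqm_mult) auto
qed simp

lemma pred_penrose:
  assumes g: "\<And>i j. i < m \<Longrightarrow> j < m \<Longrightarrow> (\<lambda>\<omega>. g \<omega> i j) \<in> borel_measurable N"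
    and h: "\<And>i j. i < m \<Longrightarrow> j < m \<Longrightarrow> (\<lambda>\<omega>. h \<omega> i j) \<in> borel_measurable N"
  shows "Measurable.pred N (\<lambda>\<omega>. penrose m (g \<omega>) (h \<omega>))"
proof -
  have eq: "Measurable.pred N (\<lambda>\<omega>. u \<omega> = w \<omega>)"
    if "u \<in> borel_measurable N" "w \<in> borel_measurable N" for u w :: "_ \<Rightarrow> real"
    using that by measurable
  show ?thesis
    unfolding penrose_def Ball_def[symmetric] lessThan_iff[symmetric]
    using g h
    by (intro pred_intros_finite pred_intros_logic eq borel_measurable_sqm_mult) auto
qed

text \<open>Outside its dimension, a vector has an unspecified but fixed entry.\<close>

lemma borel_measurable_mult_mat_vec:
  fixes Z :: "real mat"
  assumes b: "\<And>j. j < m \<Longrightarrow> (\<lambda>\<omega>. b \<omega> j) \<in> borel_measurable N"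
  shows "(\<lambda>\<omega>. vec_index (Z *\<^sub>v Matrix.vec m (b \<omega>)) i) \<in> borel_measurable N"
proof (cases "i < dim_row Z")
  case True
  then have "vec_index (Z *\<^sub>v Matrix.vec m (b \<omega>)) i = (\<Sum>j<m. vec_index (row Z i) j * b \<omega> j)" for \<omega>
    by (simp add: Matrix.scalar_prod_def lessThan_atLeast0)
  then show ?thesis
    using b by (auto intro!: borel_measurable_sum borel_measurable_times)
next
  case False
  have "vec_index (Matrix.vec n f) i = undef_vec (i - n)" if "\<not> i < n" for n and f :: "nat \<Rightarrow> real"
    using that by transfer (auto simp: mk_vec_def)
  then have "vec_index (Z *\<^sub>v Matrix.vec m (b \<omega>)) i = undef_vec (i - dim_row Z)" for \<omega>
    unfolding mult_mat_vec_def using False by blast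
  then show ?thesis by simp
qed

lemma borel_measurable_subspace_step:
  fixes A :: "'a \<Rightarrow> real^'n^'n"
  assumes d: "\<And>j. j < m \<Longrightarrow> (\<lambda>\<omega>. d \<omega> j) \<in> borel_measurable N"
    and g: "\<And>i j. i < m \<Longrightarrow> j < m \<Longrightarrow> (\<lambda>\<omega>. d \<omega> i \<bullet> (A \<omega> *v d \<omega> j)) \<in> borel_measurable N"
    and b: "\<And>i. i < m \<Longrightarrow> (\<lambda>\<omega>. d \<omega> i \<bullet> c \<omega>) \<in> borel_measurable N"
    and sym: "\<And>\<omega>. transpose (A \<omega>) = A \<omega>"
  shows "(\<lambda>\<omega>. subspace_step m (d \<omega>) (A \<omega>) (c \<omega>)) \<in> borel_measurable N"
proof -
  define G where "G \<omega> = Matrix.mat m m (\<lambda>(i, j). d \<omega> i \<bullet> (A \<omega> *v d \<omega> j))" for \<omega>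
  define L where "L \<omega> i j = lim (\<lambda>k. landweber m (\<lambda>i j. G \<omega> $$ (i, j)) k i j)" for \<omega> i j
  define Z :: "real mat" where "Z = (THE H. False)"
  define w where "w \<omega> = Matrix.vec m (\<lambda>i. d \<omega> i \<bullet> c \<omega>)" for \<omega>
  have G: "G \<omega> \<in> carrier_mat m m" for \<omega>
    by (simp add: G_def)
  have G_meas: "(\<lambda>\<omega>. G \<omega> $$ (i, j)) \<in> borel_measurable N" if "i < m" "j < m" for i j
    using g that by (simp add: G_def)
  have G_sym: "G \<omega> $$ (i, j) = G \<omega> $$ (j, i)" if "i < m" "j < m" for \<omega> i j
    using that sym[of \<omega>]
    by (simp add: G_def) (metis dot_lmul_matrix inner_commute transpose_matrix_vector)
  have pinv: "pseudo_inverse (G \<omega>) =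
      (if penrose m (\<lambda>i j. G \<omega> $$ (i, j)) (L \<omega>) then Matrix.mat m m (\<lambda>(i, j). L \<omega> i j) else Z)" for \<omega>
    unfolding L_def Z_def by (rule pseudo_inverse_eq[OF G G_sym])
  have L_meas: "(\<lambda>\<omega>. L \<omega> i j) \<in> borel_measurable N" if "i < m" "j < m" for i j
    unfolding L_def using that G_meas
    by (intro borel_measurable_lim_metric borel_measurable_landweber) auto
  have "(\<lambda>\<omega>. vec_index (pseudo_inverse (G \<omega>) *\<^sub>v w \<omega>) i) \<in> borel_measurable N" if "i < m" for i
  proof -
    \<comment> \<open>Where the Penrose test fails, the matrix is the constant \<open>Z\<close>. Its
      dimensions are unknown, so the entry cannot be expanded and its measurability comes from
      \<open>borel_measurable_mult_mat_vec\<close>.\<close>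
    have "vec_index (pseudo_inverse (G \<omega>) *\<^sub>v w \<omega>) i =
        (if penrose m (\<lambda>i j. G \<omega> $$ (i, j)) (L \<omega>) then \<Sum>j<m. L \<omega> i j * (d \<omega> j \<bullet> c \<omega>)
         else vec_index (Z *\<^sub>v w \<omega>) i)" for \<omega>
      using that pinv[of \<omega>] by (simp add: w_def Matrix.scalar_prod_def lessThan_atLeast0)
    moreover have "Measurable.pred N (\<lambda>\<omega>. penrose m (\<lambda>i j. G \<omega> $$ (i, j)) (L \<omega>))"
      using G_meas L_meas by (rule pred_penrose)
    moreover have "(\<lambda>\<omega>. \<Sum>j<m. L \<omega> i j * (d \<omega> j \<bullet> c \<omega>)) \<in> borel_measurable N"
      using L_meas b that by (intro borel_measurable_sum borel_measurable_times) auto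
    moreover have "(\<lambda>\<omega>. vec_index (Z *\<^sub>v w \<omega>) i) \<in> borel_measurable N"
      unfolding w_def using b by (rule borel_measurable_mult_mat_vec)
    ultimately show ?thesis
      by (simp add: measurable_If)
  qed
  then show ?thesis
    unfolding subspace_step_def mult_cols_def G_def[symmetric] w_def[symmetric]
    using d by (intro borel_measurable_sum borel_measurable_scaleR) auto
qed

section \<open>Square-integrable martingale noise\<close>

text \<open>By monotone convergence the sum has finite expectation, hence is finite almost
  surely.\<close>

lemma AE_summable_of_summable_integral:
  fixes f :: "nat \<Rightarrow> 'a \<Rightarrow> real"
  assumes int: "\<And>n. integrable M (f n)" and nn: "\<And>n \<omega>. 0 \<le> f n \<omega>"
    and sum: "summable (\<lambda>n. \<integral>\<omega>. f n \<omega> \<partial>M)"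
  shows "AE \<omega> in M. summable (\<lambda>n. f n \<omega>)"
proof -
  have meas: "\<And>n. f n \<in> borel_measurable M"
    using int by auto
  have "(\<integral>\<^sup>+\<omega>. (\<Sum>n. ennreal (f n \<omega>)) \<partial>M) = (\<Sum>n. ennreal (\<integral>\<omega>. f n \<omega> \<partial>M))"
    using meas by (subst nn_integral_suminf) (auto simp: nn_integral_eq_integral[OF int] nn)
  also have "\<dots> < \<infinity>"
    using sum nn by (subst suminf_ennreal2) auto
  finally have "AE \<omega> in M. (\<Sum>n. ennreal (f n \<omega>)) \<noteq> \<infinity>"
    using meas by (intro nn_integral_noteq_infinite) auto
  then show ?thesis
  proof eventually_elim
    case (elim \<omega>)
    then show ?case
      using nn by (intro summable_suminf_not_top) auto
  qed
qed

lemma integrable_mult_L2: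
  fixes f g :: "'a \<Rightarrow> real"
  assumes "f \<in> borel_measurable M" "g \<in> borel_measurable M"
    and "integrable M (\<lambda>\<omega>. (f \<omega>)\<^sup>2)" "integrable M (\<lambda>\<omega>. (g \<omega>)\<^sup>2)"
  shows "integrable M (\<lambda>\<omega>. f \<omega> * g \<omega>)"
proof (rule Bochner_Integration.integrable_bound[OF Bochner_Integration.integrable_add[OF assms(3,4)]])
  have "\<bar>f \<omega> * g \<omega>\<bar> \<le> (f \<omega>)\<^sup>2 + (g \<omega>)\<^sup>2" for \<omega>
  proof -
    have "2 * (\<bar>f \<omega>\<bar> * \<bar>g \<omega>\<bar>) \<le> (f \<omega>)\<^sup>2 + (g \<omega>)\<^sup>2"
      using sum_squares_bound[of "\<bar>f \<omega>\<bar>" "\<bar>g \<omega>\<bar>"] by simp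
    moreover have "0 \<le> \<bar>f \<omega>\<bar> * \<bar>g \<omega>\<bar>" by simp
    ultimately show ?thesis
      unfolding abs_mult by linarith
  qed
  then show "AE \<omega> in M. norm (f \<omega> * g \<omega>) \<le> norm ((f \<omega>)\<^sup>2 + (g \<omega>)\<^sup>2)"
    by simp
qed (use assms in measurable)

text \<open>The martingale condition is imposed on each component since \<open>real_cond_exp\<close>
  acts on real functions. The single bound \<open>C\<close> on all variances is what produces rates.
  Indices start at 1, as for the data.\<close>

locale noise_seq = prob_space M for M :: "'a measure" +
  fixes H :: "nat \<Rightarrow> 'a measure" and z :: "nat \<Rightarrow> 'a \<Rightarrow> 'z::euclidean_space" and \<mu> :: 'z and C :: real
  assumes subalg: "\<And>n. 1 \<le> n \<Longrightarrow> subalgebra M (H n)"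
    and filtration: "\<And>n. 1 \<le> n \<Longrightarrow> subalgebra (H (Suc n)) (H n)"
    and z_meas: "\<And>n. 1 \<le> n \<Longrightarrow> z n \<in> borel_measurable (H n)"
    and z_L2: "\<And>n. 1 \<le> n \<Longrightarrow> integrable M (\<lambda>\<omega>. (norm (z n \<omega> - \<mu>))\<^sup>2)"
    and z_var: "\<And>n. 1 \<le> n \<Longrightarrow> (\<integral>\<omega>. (norm (z n \<omega> - \<mu>))\<^sup>2 \<partial>M) \<le> C"
    and z_cond: "\<And>n b. 1 \<le> n \<Longrightarrow> b \<in> Basis \<Longrightarrow>
      AE \<omega> in M. real_cond_exp M (H n) (\<lambda>\<omega>. z (Suc n) \<omega> \<bullet> b) \<omega> = \<mu> \<bullet> b"
begin

definition zbar :: "nat \<Rightarrow> 'a \<Rightarrow> 'z" where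
  "zbar n \<omega> = (1 / real n) *\<^sub>R (\<Sum>k=1..n. z k \<omega>)"

lemma C_nonneg: "0 \<le> C"
  using z_var[of 1] by (intro order_trans[OF Bochner_Integration.integral_nonneg z_var[of 1]]) auto

lemma subalg_mono:
  assumes "1 \<le> m" "m \<le> n"
  shows "subalgebra (H n) (H m)"
  using assms(2)
proof (induction n rule: dec_induct)
  case (step n)
  then show ?case
    using filtration[of n] assms(1) unfolding subalgebra_def by auto
qed (simp add: subalgebra_def)

lemma z_meas':
  assumes "1 \<le> k" "k \<le> n"
  shows "z k \<in> borel_measurable (H n)"
  using measurable_from_subalg[OF subalg_mono[OF assms] z_meas[OF assms(1)]] .

lemma z_borel: "1 \<le> n \<Longrightarrow> z n \<in> borel_measurable M"
  using measurable_from_subalg[OF subalg z_meas] by blast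

lemma zbar_meas: "1 \<le> n \<Longrightarrow> zbar n \<in> borel_measurable (H n)"
  unfolding zbar_def using z_meas' by (intro borel_measurable_scaleR borel_measurable_sum) auto

text \<open>A factor \<open>w\<close> known at time \<open>n\<close> can be moved inside the
  conditional expectation, which replaces the component of \<open>z (Suc n)\<close> by that of
  \<open>\<mu>\<close>.\<close>

lemma noise_orthogonal:
  assumes n: "1 \<le> n" and b: "b \<in> Basis" and w: "w \<in> borel_measurable (H n)"
    and int: "integrable M w" "integrable M (\<lambda>\<omega>. w \<omega> * ((z (Suc n) \<omega> - \<mu>) \<bullet> b))"
  shows "(\<integral>\<omega>. w \<omega> * ((z (Suc n) \<omega> - \<mu>) \<bullet> b) \<partial>M) = 0"
proof -
  interpret finite_measure_subalgebra M "H n"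
    using subalg[OF n] by unfold_locales
  have meas: "(\<lambda>\<omega>. z (Suc n) \<omega> \<bullet> b) \<in> borel_measurable M"
    using z_borel[of "Suc n"] by (intro borel_measurable_inner) auto
  have wM: "w \<in> borel_measurable M"
    using int(1) by auto
  have e: "w \<omega> * (z (Suc n) \<omega> \<bullet> b) = w \<omega> * ((z (Suc n) \<omega> - \<mu>) \<bullet> b) + w \<omega> * (\<mu> \<bullet> b)" for \<omega>
    by (simp add: inner_diff_left algebra_simps)
  have i: "integrable M (\<lambda>\<omega>. w \<omega> * (z (Suc n) \<omega> \<bullet> b))"
    unfolding e using int by (intro Bochner_Integration.integrable_add integrable_mult_left) auto
  have "(\<integral>\<omega>. w \<omega> * (z (Suc n) \<omega> \<bullet> b) \<partial>M)
      = (\<integral>\<omega>. w \<omega> * real_cond_exp M (H n) (\<lambda>\<omega>. z (Suc n) \<omega> \<bullet> b) \<omega> \<partial>M)"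
    using real_cond_exp_intg(2)[OF i w meas] by simp
  also have "\<dots> = (\<integral>\<omega>. w \<omega> * (\<mu> \<bullet> b) \<partial>M)"
  proof (rule integral_cong_AE)
    show "AE \<omega> in M. w \<omega> * real_cond_exp M (H n) (\<lambda>\<omega>. z (Suc n) \<omega> \<bullet> b) \<omega> = w \<omega> * (\<mu> \<bullet> b)"
      using z_cond[OF n b] by eventually_elim simp
    show "(\<lambda>\<omega>. w \<omega> * real_cond_exp M (H n) (\<lambda>\<omega>. z (Suc n) \<omega> \<bullet> b) \<omega>) \<in> borel_measurable M"
      using wM by (intro borel_measurable_times borel_measurable_cond_exp2)
  qed (use wM in auto)
  finally have "(\<integral>\<omega>. w \<omega> * ((z (Suc n) \<omega> - \<mu>) \<bullet> b) \<partial>M) + (\<integral>\<omega>. w \<omega> * (\<mu> \<bullet> b) \<partial>M)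
      = (\<integral>\<omega>. w \<omega> * (\<mu> \<bullet> b) \<partial>M)"
    unfolding e using int by (subst (asm) Bochner_Integration.integral_add) auto
  then show ?thesis by simp
qed

definition psum :: "'z \<Rightarrow> nat \<Rightarrow> nat \<Rightarrow> 'a \<Rightarrow> real" where
  "psum b a n \<omega> = (\<Sum>k\<in>{a<..n}. (z k \<omega> - \<mu>) \<bullet> b)"

lemma z_comp_L2:
  assumes "1 \<le> n" "b \<in> Basis"
  shows "integrable M (\<lambda>\<omega>. ((z n \<omega> - \<mu>) \<bullet> b)\<^sup>2)" "(\<integral>\<omega>. ((z n \<omega> - \<mu>) \<bullet> b)\<^sup>2 \<partial>M) \<le> C"
proof -
  have le: "((z n \<omega> - \<mu>) \<bullet> b)\<^sup>2 \<le> (norm (z n \<omega> - \<mu>))\<^sup>2" for \<omega>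
    using Basis_le_norm[OF assms(2), of "z n \<omega> - \<mu>"] by (simp add: abs_le_square_iff[symmetric])
  have m: "(\<lambda>\<omega>. ((z n \<omega> - \<mu>) \<bullet> b)\<^sup>2) \<in> borel_measurable M"
    using z_borel[OF assms(1)] by measurable
  show i: "integrable M (\<lambda>\<omega>. ((z n \<omega> - \<mu>) \<bullet> b)\<^sup>2)"
    by (rule Bochner_Integration.integrable_bound[OF z_L2[OF assms(1)] m]) (auto simp: le)
  show "(\<integral>\<omega>. ((z n \<omega> - \<mu>) \<bullet> b)\<^sup>2 \<partial>M) \<le> C"
    using integral_mono[OF i z_L2[OF assms(1)]] le z_var[OF assms(1)] by force
qed

lemma psum_meas:
  assumes "1 \<le> n" shows "psum b a n \<in> borel_measurable (H n)"
  unfolding psum_def using assms z_meas'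
  by (intro borel_measurable_sum borel_measurable_inner borel_measurable_diff) auto

lemma psum_borel: "psum b a n \<in> borel_measurable M"
  unfolding psum_def using z_borel
  by (intro borel_measurable_sum borel_measurable_inner borel_measurable_diff) auto

text \<open>Each new increment is orthogonal to the partial sum before it, so variances add up and
  every index contributes at most \<open>C\<close>. The free starting point \<open>a\<close> serves
  to estimate sums over blocks of indices.\<close>

lemma psum_L2:
  assumes "a \<le> n" and b: "b \<in> Basis"
  shows "integrable M (\<lambda>\<omega>. (psum b a n \<omega>)\<^sup>2) \<and> (\<integral>\<omega>. (psum b a n \<omega>)\<^sup>2 \<partial>M) \<le> C * real (n - a)"
  using assms(1)
proof (induction n rule: dec_induct)
  case base
  then show ?case by (simp add: psum_def)
next
  case (step n)
  define \<xi> where "\<xi> \<omega> = (z (Suc n) \<omega> - \<mu>) \<bullet> b" for \<omega>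
  have \<xi>: "integrable M (\<lambda>\<omega>. (\<xi> \<omega>)\<^sup>2)" "(\<integral>\<omega>. (\<xi> \<omega>)\<^sup>2 \<partial>M) \<le> C" "\<xi> \<in> borel_measurable M"
    unfolding \<xi>_def[abs_def] using z_comp_L2[OF _ b, of "Suc n"] z_borel[of "Suc n"] by auto
  have i: "integrable M (\<lambda>\<omega>. psum b a n \<omega> * \<xi> \<omega>)"
    using step \<xi> psum_borel by (intro integrable_mult_L2) auto
  \<comment> \<open>The case \<open>n = a\<close> is separated because \<open>a\<close> may be 0,
    while the hypotheses on \<open>H n\<close> begin at 1; there the sum is empty.\<close>
  have o: "(\<integral>\<omega>. psum b a n \<omega> * \<xi> \<omega> \<partial>M) = 0"
  proof (cases "n = a")
    case True
    then show ?thesis by (simp add: psum_def)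
  next
    case False
    then have n: "1 \<le> n" using step by simp
    have "integrable M (psum b a n)"
      by (rule square_integrable_imp_integrable[OF psum_borel conjunct1[OF step.IH]])
    then show ?thesis
      using noise_orthogonal[OF n b psum_meas[OF n]] i unfolding \<xi>_def by blast
  qed
  have "{a<..Suc n} = insert (Suc n) {a<..n}"
    using step by auto
  then have "psum b a (Suc n) \<omega> = psum b a n \<omega> + \<xi> \<omega>" for \<omega>
    by (simp add: psum_def \<xi>_def)
  then have e: "(psum b a (Suc n) \<omega>)\<^sup>2 = (psum b a n \<omega>)\<^sup>2 + (\<xi> \<omega>)\<^sup>2 + 2 * (psum b a n \<omega> * \<xi> \<omega>)" for \<omega>
    by (simp add: power2_sum)
  have "(\<integral>\<omega>. (psum b a (Suc n) \<omega>)\<^sup>2 \<partial>M)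
      = (\<integral>\<omega>. (psum b a n \<omega>)\<^sup>2 \<partial>M) + (\<integral>\<omega>. (\<xi> \<omega>)\<^sup>2 \<partial>M)"
    unfolding e using step i \<xi> o by simp
  also have "\<dots> \<le> C * real (n - a) + C"
    using step \<xi> by simp
  also have "\<dots> = C * real (Suc n - a)"
    using step by (simp add: Suc_diff_le algebra_simps)
  finally show ?case
    unfolding e using step i \<xi> by simp
qed

lemma zbar_comp:
  assumes "1 \<le> n" shows "(zbar n \<omega> - \<mu>) \<bullet> b = psum b 0 n \<omega> / real n"
proof -
  have "{0<..n} = {1..n}" by auto
  then have "psum b 0 n \<omega> = (\<Sum>k=1..n. z k \<omega>) \<bullet> b - real n * (\<mu> \<bullet> b)"
    by (simp add: psum_def inner_diff_left inner_sum_left sum_subtractf)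
  then show ?thesis
    using assms by (simp add: zbar_def inner_diff_left field_simps)
qed

lemma norm_sq_zbar:
  assumes "1 \<le> n"
  shows "(norm (zbar n \<omega> - \<mu>))\<^sup>2 = (\<Sum>b\<in>Basis. (psum b 0 n \<omega>)\<^sup>2 / (real n)\<^sup>2)"
proof -
  have "(norm (zbar n \<omega> - \<mu>))\<^sup>2 = (\<Sum>b\<in>Basis. ((zbar n \<omega> - \<mu>) \<bullet> b) * ((zbar n \<omega> - \<mu>) \<bullet> b))"
    unfolding power2_norm_eq_inner by (rule euclidean_inner)
  then show ?thesis
    by (simp only: zbar_comp[OF assms]) (simp add: power2_eq_square)
qed

lemma zbar_L2:
  assumes n: "1 \<le> n"
  shows "integrable M (\<lambda>\<omega>. (norm (zbar n \<omega> - \<mu>))\<^sup>2)"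
    "(\<integral>\<omega>. (norm (zbar n \<omega> - \<mu>))\<^sup>2 \<partial>M) \<le> DIM('z) * C / real n"
proof -
  have i: "integrable M (\<lambda>\<omega>. (psum b 0 n \<omega>)\<^sup>2 / (real n)\<^sup>2)" if "b \<in> Basis" for b
    using psum_L2[of 0 n b] that by auto
  then show "integrable M (\<lambda>\<omega>. (norm (zbar n \<omega> - \<mu>))\<^sup>2)"
    unfolding norm_sq_zbar[OF n] by (rule Bochner_Integration.integrable_sum)
  have "(\<integral>\<omega>. (norm (zbar n \<omega> - \<mu>))\<^sup>2 \<partial>M) = (\<Sum>b\<in>Basis. (\<integral>\<omega>. (psum b 0 n \<omega>)\<^sup>2 \<partial>M) / (real n)\<^sup>2)"
    unfolding norm_sq_zbar[OF n] using i by (subst Bochner_Integration.integral_sum) auto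
  also have "\<dots> \<le> (\<Sum>b\<in>(Basis :: 'z set). (C * real n) / (real n)\<^sup>2)"
    using psum_L2[of 0 n] by (intro sum_mono divide_right_mono) auto
  also have "\<dots> = DIM('z) * C / real n"
    using n by (simp add: power2_eq_square)
  finally show "(\<integral>\<omega>. (norm (zbar n \<omega> - \<mu>))\<^sup>2 \<partial>M) \<le> DIM('z) * C / real n" .
qed

lemma zbar_borel: "zbar n \<in> borel_measurable M"
  unfolding zbar_def using z_borel by (intro borel_measurable_scaleR borel_measurable_sum) auto

lemma zbar_L1:
  assumes n: "1 \<le> n"
  shows "integrable M (\<lambda>\<omega>. norm (zbar n \<omega> - \<mu>))"
    "(\<integral>\<omega>. norm (zbar n \<omega> - \<mu>) \<partial>M) \<le> (DIM('z) * C + 1) / sqrt n"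
proof -
  show i: "integrable M (\<lambda>\<omega>. norm (zbar n \<omega> - \<mu>))"
    by (rule square_integrable_imp_integrable[OF _ zbar_L2(1)[OF n]])
       (use zbar_borel in measurable)
  \<comment> \<open>The weight \<open>sqrt n\<close> balances the two terms: with a second moment of
    order \<open>1 / n\<close>, both have expectation of order \<open>1 / sqrt n\<close>.\<close>
  have le: "t \<le> sqrt n * t\<^sup>2 + 1 / sqrt n" for t :: real
  proof -
    have "2 * (sqrt n * t) \<le> (sqrt n * t)\<^sup>2 + 1"
      using sum_squares_bound[of "sqrt n * t" 1] by simp
    moreover have "0 \<le> (sqrt n * t)\<^sup>2 + 1" by (simp add: add_nonneg_nonneg)
    ultimately have "sqrt n * t \<le> (sqrt n * t)\<^sup>2 + 1" by linarith
    then have "sqrt n * t \<le> sqrt n * (sqrt n * t\<^sup>2 + 1 / sqrt n)"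
      using n by (simp add: power_mult_distrib distrib_left flip: mult.assoc)
    then show ?thesis
      using n by (simp add: mult_le_cancel_left_pos)
  qed
  have "(\<integral>\<omega>. norm (zbar n \<omega> - \<mu>) \<partial>M) \<le> (\<integral>\<omega>. sqrt n * (norm (zbar n \<omega> - \<mu>))\<^sup>2 + 1 / sqrt n \<partial>M)"
    using zbar_L2(1)[OF n] i le by (intro integral_mono) auto
  also have "\<dots> = sqrt n * (\<integral>\<omega>. (norm (zbar n \<omega> - \<mu>))\<^sup>2 \<partial>M) + 1 / sqrt n"
    using zbar_L2(1)[OF n] by (simp add: prob_space)
  also have "\<dots> \<le> sqrt n * (DIM('z) * C / real n) + 1 / sqrt n"
    using zbar_L2(2)[OF n] by (intro add_mono mult_left_mono) auto
  also have "\<dots> = (DIM('z) * C + 1) / sqrt n"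
  proof -
    have "sqrt n * (DIM('z) * C / real n) = DIM('z) * C * (sqrt n / real n)"
      by simp
    also have "sqrt n / real n = 1 / sqrt n"
      by (simp add: sqrt_divide_self_eq inverse_eq_divide)
    finally have "sqrt n * (DIM('z) * C / real n) = DIM('z) * C / sqrt n"
      by simp
    then show ?thesis
      by (simp add: add_divide_distrib)
  qed
  finally show "(\<integral>\<omega>. norm (zbar n \<omega> - \<mu>) \<partial>M) \<le> (DIM('z) * C + 1) / sqrt n" .
qed

lemma psum_split:
  assumes "a \<le> n" shows "psum b 0 n \<omega> = psum b 0 a \<omega> + psum b a n \<omega>"
proof -
  have "{0<..n} = {0<..a} \<union> {a<..n}" "{0<..a} \<inter> {a<..n} = {}"
    using assms by auto
  then show ?thesis
    by (simp add: psum_def sum.union_disjoint)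
qed

text \<open>Second moments control the mean along the squares \<open>k\<^sup>2\<close> and also the fluctuations between
  consecutive squares.\<close>

lemma psum_strong_law:
  assumes b: "b \<in> Basis"
  shows "AE \<omega> in M. (\<lambda>n. psum b 0 n \<omega> / real n) \<longlonglongrightarrow> 0"
proof -
  \<comment> \<open>\<open>G k\<close> dominates, up to the factor 2, all squared means with index
    in the block from \<open>k\<^sup>2\<close> to \<open>(Suc k)\<^sup>2\<close>; replacing the
    maximum over the block by a sum costs only a factor of order \<open>k\<close>, which the
    normalization \<open>k ^ 4\<close> can afford.\<close>
  define G where "G k \<omega> = ((psum b 0 (k\<^sup>2) \<omega>)\<^sup>2 + (\<Sum>n\<in>{k\<^sup>2..<(Suc k)\<^sup>2}. (psum b (k\<^sup>2) n \<omega>)\<^sup>2)) / real k ^ 4"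
    for k \<omega>
  have iG: "integrable M (G k)" for k
    unfolding G_def[abs_def] using psum_L2[OF _ b]
    by (intro integrable_divide_zero Bochner_Integration.integrable_add Bochner_Integration.integrable_sum) auto
  have G0: "0 \<le> G k \<omega>" for k \<omega>
    unfolding G_def by (intro divide_nonneg_nonneg add_nonneg_nonneg sum_nonneg) auto
  \<comment> \<open>The constant is \<open>10 = 1 + 3 * 3\<close>: one \<open>C * k\<^sup>2\<close>
    for the sum up to the square, and \<open>2 * k + 1 \<le> 3 * k\<close> block members with at
    most \<open>3 * k\<close> increments each. For \<open>k = 0\<close> both sides are 0, as
    division by 0 yields 0.\<close>
  have EG: "(\<integral>\<omega>. G k \<omega> \<partial>M) \<le> 10 * C * (1 / real k ^ 2)" for k
  proof (cases "k = 0")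
    case False
    then have k: "1 \<le> real k" by simp
    have "(\<integral>\<omega>. G k \<omega> \<partial>M) = ((\<integral>\<omega>. (psum b 0 (k\<^sup>2) \<omega>)\<^sup>2 \<partial>M)
        + (\<Sum>n\<in>{k\<^sup>2..<(Suc k)\<^sup>2}. (\<integral>\<omega>. (psum b (k\<^sup>2) n \<omega>)\<^sup>2 \<partial>M))) / real k ^ 4"
      unfolding G_def using psum_L2[OF _ b]
      by (subst integral_divide_zero, subst Bochner_Integration.integral_add)
         (auto intro!: Bochner_Integration.integrable_sum Bochner_Integration.integral_sum)
    also have "\<dots> \<le> (C * real (k\<^sup>2) + (\<Sum>n\<in>{k\<^sup>2..<(Suc k)\<^sup>2}. C * real (3 * k))) / real k ^ 4"
    proof (intro divide_right_mono add_mono sum_mono)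
      show "(\<integral>\<omega>. (psum b 0 (k\<^sup>2) \<omega>)\<^sup>2 \<partial>M) \<le> C * real (k\<^sup>2)"
        using psum_L2[OF _ b, of 0 "k\<^sup>2"] by simp
      fix n assume n: "n \<in> {k\<^sup>2..<(Suc k)\<^sup>2}"
      then have "(\<integral>\<omega>. (psum b (k\<^sup>2) n \<omega>)\<^sup>2 \<partial>M) \<le> C * real (n - k\<^sup>2)"
        using psum_L2[OF _ b, of "k\<^sup>2" n] by simp
      also have "n - k\<^sup>2 \<le> 3 * k"
        using n False by (auto simp: power2_eq_square)
      then have "C * real (n - k\<^sup>2) \<le> C * real (3 * k)"
        using C_nonneg by (intro mult_left_mono) auto
      finally show "(\<integral>\<omega>. (psum b (k\<^sup>2) n \<omega>)\<^sup>2 \<partial>M) \<le> C * real (3 * k)" .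
    qed auto
    also have "(\<Sum>n\<in>{k\<^sup>2..<(Suc k)\<^sup>2}. C * real (3 * k)) = real (2 * k + 1) * (C * real (3 * k))"
      by (simp add: power2_eq_square)
    also have "\<dots> \<le> real (3 * k) * (C * real (3 * k))"
      using C_nonneg k by (intro mult_right_mono) auto
    also have "(C * real (k\<^sup>2) + real (3 * k) * (C * real (3 * k))) / real k ^ 4 = 10 * C * (1 / real k ^ 2)"
      using k by (simp add: field_simps power2_eq_square power4_eq_xxxx)
    finally show ?thesis
      by (simp add: divide_right_mono)
  qed (simp add: G_def)
  have "summable (\<lambda>k. 10 * C * (1 / real k ^ 2))"
    using inverse_power_summable[of 2, where 'a=real] by (intro summable_mult) (simp add: inverse_eq_divide)
  then have "summable (\<lambda>k. \<integral>\<omega>. G k \<omega> \<partial>M)"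
    by (rule summable_comparison_test'[where N = 0]) (use EG G0 in \<open>auto simp: Bochner_Integration.integral_nonneg\<close>)
  then have "AE \<omega> in M. summable (\<lambda>k. G k \<omega>)"
    by (rule AE_summable_of_summable_integral[OF iG G0])
  then show ?thesis
  proof eventually_elim
    case (elim \<omega>)
    then have lim: "(\<lambda>k. G k \<omega>) \<longlonglongrightarrow> 0"
      by (rule summable_LIMSEQ_zero)
    \<comment> \<open>With \<open>k = floor_sqrt n\<close>, the sum up to \<open>n\<close> is the
      sum up to the square plus one block fluctuation, and \<open>k ^ 4 \<le> n\<^sup>2\<close> lets
      the normalization of \<open>G\<close> replace the true one.\<close>
    have bound: "(psum b 0 n \<omega> / real n)\<^sup>2 \<le> 2 * G (floor_sqrt n) \<omega>" if n: "1 \<le> n" for n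
    proof -
      define k where "k = floor_sqrt n"
      have k: "k\<^sup>2 \<le> n" "n < (Suc k)\<^sup>2" "1 \<le> k"
        using n floor_sqrt_power2_le[of n] Suc_floor_sqrt_power2_gt[of n] by (auto simp: k_def Suc_le_eq)
      have "(psum b 0 n \<omega>)\<^sup>2 \<le> 2 * ((psum b 0 (k\<^sup>2) \<omega>)\<^sup>2 + (psum b (k\<^sup>2) n \<omega>)\<^sup>2)"
        unfolding psum_split[OF k(1)]
        using sum_squares_bound[of "psum b 0 (k\<^sup>2) \<omega>" "psum b (k\<^sup>2) n \<omega>"] by (simp add: power2_sum)
      also have "(psum b (k\<^sup>2) n \<omega>)\<^sup>2 \<le> (\<Sum>n\<in>{k\<^sup>2..<(Suc k)\<^sup>2}. (psum b (k\<^sup>2) n \<omega>)\<^sup>2)"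
        using k by (intro member_le_sum) auto
      finally have "(psum b 0 n \<omega>)\<^sup>2 \<le> 2 * ((psum b 0 (k\<^sup>2) \<omega>)\<^sup>2 + (\<Sum>n\<in>{k\<^sup>2..<(Suc k)\<^sup>2}. (psum b (k\<^sup>2) n \<omega>)\<^sup>2))"
        by simp
      also have "\<dots> = 2 * G k \<omega> * real k ^ 4"
        using k by (simp add: G_def)
      also have "\<dots> \<le> 2 * G k \<omega> * (real n)\<^sup>2"
      proof (rule mult_left_mono)
        have "(real (k\<^sup>2))\<^sup>2 \<le> (real n)\<^sup>2"
          using k by (intro power_mono) auto
        then show "real k ^ 4 \<le> (real n)\<^sup>2"
          by (simp add: power2_eq_square power4_eq_xxxx mult_ac)
      qed (use G0 in auto)
      finally show ?thesis
        using n by (simp add: k_def power_divide divide_le_eq)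
    qed
    have fl: "filterlim floor_sqrt at_top sequentially"
      unfolding filterlim_at_top eventually_sequentially
      by (meson dual_order.trans le_floor_sqrtI order_refl)
    have "(\<lambda>n. 2 * G (floor_sqrt n) \<omega>) \<longlonglongrightarrow> 2 * 0"
      by (intro tendsto_mult tendsto_const filterlim_compose[OF lim fl])
    then have lim2: "(\<lambda>n. 2 * G (floor_sqrt n) \<omega>) \<longlonglongrightarrow> 0"
      by simp
    have "(\<lambda>n. (psum b 0 n \<omega> / real n)\<^sup>2) \<longlonglongrightarrow> 0"
      by (rule tendsto_sandwich[OF _ _ tendsto_const lim2])
         (use bound in \<open>auto simp: eventually_sequentially simp del: power_divide\<close>)
    then show "(\<lambda>n. psum b 0 n \<omega> / real n) \<longlonglongrightarrow> 0"
      using power_tendsto_0_iff[of 2] by fastforce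
  qed
qed

lemma zbar_strong_law: "AE \<omega> in M. (\<lambda>n. zbar n \<omega>) \<longlonglongrightarrow> \<mu>"
proof -
  have "AE \<omega> in M. \<forall>b\<in>Basis. (\<lambda>n. psum b 0 n \<omega> / real n) \<longlonglongrightarrow> 0"
    using psum_strong_law by (intro AE_finite_allI) auto
  then show ?thesis
  proof eventually_elim
    case (elim \<omega>)
    have "(\<lambda>n. (zbar n \<omega> - \<mu>) \<bullet> b) \<longlonglongrightarrow> 0 \<bullet> b" if "b \<in> Basis" for b
    proof -
      have "eventually (\<lambda>n. psum b 0 n \<omega> / real n = (zbar n \<omega> - \<mu>) \<bullet> b) sequentially"
        using eventually_ge_at_top[of 1] by eventually_elim (simp add: zbar_comp)
      then show ?thesis
        using Lim_transform_eventually elim that by fastforce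
    qed
    then have "(\<lambda>n. zbar n \<omega> - \<mu>) \<longlonglongrightarrow> 0"
      by (rule tendsto_componentwise_iff[THEN iffD2, rule_format])
    then show ?case
      by (rule LIM_zero_cancel)
  qed
qed

end

lemma summable_powr_three_halves: "summable (\<lambda>n. 1 / (sqrt (real (Suc n)) * real (Suc n)))"
proof -
  have "summable (\<lambda>n. real (Suc n) powr (-3/2))"
    by (subst summable_Suc_iff) (simp add: summable_real_powr_iff)
  moreover have "real (Suc n) powr (-3/2) = 1 / (sqrt (real (Suc n)) * real (Suc n))" for n
  proof -
    have "real (Suc n) powr (-3/2) = inverse (real (Suc n) powr (1/2 + 1))"
      by (subst powr_minus[symmetric]) simp
    also have "real (Suc n) powr (1/2 + 1) = sqrt (real (Suc n)) * real (Suc n)"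
      by (subst powr_add) (simp add: powr_half_sqrt)
    finally show ?thesis by (simp add: inverse_eq_divide)
  qed
  ultimately show ?thesis by simp
qed

section \<open>Summable decrease of a randomly changing objective\<close>

context noise_seq
begin

lemma zbar_Suc:
  assumes "1 \<le> n"
  shows "zbar (Suc n) \<omega> - zbar n \<omega> = (1 / real (Suc n)) *\<^sub>R ((z (Suc n) \<omega> - \<mu>) - (zbar n \<omega> - \<mu>))"
proof -
  define S where "S = (\<Sum>k=1..n. z k \<omega>)"
  have "S = real n *\<^sub>R zbar n \<omega>"
    using assms by (simp add: zbar_def S_def)
  then have "(\<Sum>k=1..Suc n. z k \<omega>) = real n *\<^sub>R zbar n \<omega> + z (Suc n) \<omega>"
    by (simp add: S_def)
  then have "real (Suc n) *\<^sub>R zbar (Suc n) \<omega> = real n *\<^sub>R zbar n \<omega> + z (Suc n) \<omega>"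
    by (simp add: zbar_def[of "Suc n"])
  then have "real (Suc n) *\<^sub>R (zbar (Suc n) \<omega> - zbar n \<omega>) = z (Suc n) \<omega> - zbar n \<omega>"
    by (simp add: algebra_simps)
  then have "(1 / real (Suc n)) *\<^sub>R (real (Suc n) *\<^sub>R (zbar (Suc n) \<omega> - zbar n \<omega>))
      = (1 / real (Suc n)) *\<^sub>R (z (Suc n) \<omega> - zbar n \<omega>)"
    by simp
  then show ?thesis
    by (simp del: of_nat_Suc)
qed

text \<open>\<open>p\<close> is bounded only on \<open>E\<close>. Its truncated components
  \<open>w b\<close> are bounded and known at time \<open>n\<close>, so their products with the
  square-integrable noise are integrable and \<open>noise_orthogonal\<close> applies to each of
  them.\<close>

lemma noise_increment:
  assumes n: "1 \<le> n" and p: "p \<in> borel_measurable (H n)" and E: "E \<in> sets (H n)"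
    and bound: "\<And>\<omega>. \<omega> \<in> E \<Longrightarrow> norm (p \<omega>) \<le> K" and K: "0 \<le> K"
  defines "X \<equiv> \<lambda>\<omega>. indicator E \<omega> * ((zbar (Suc n) \<omega> - zbar n \<omega>) \<bullet> p \<omega>)"
  shows "integrable M X"
    and "(\<integral>\<omega>. X \<omega> \<partial>M) \<le> K * (DIM('z) * C + 1) * (1 / (sqrt n * n))"
proof -
  let ?I = "indicator E :: 'a \<Rightarrow> real"
  have EM: "E \<in> sets M"
    using E subalg[OF n] by (auto simp: subalgebra_def)
  have pM: "p \<in> borel_measurable M"
    by (rule measurable_from_subalg[OF subalg[OF n] p])
  have b_I: "?I \<in> borel_measurable (H n)"
    using E by simp
  have pb: "\<bar>?I \<omega> * (p \<omega> \<bullet> b)\<bar> \<le> K" if "b \<in> Basis" for \<omega> b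
    using Basis_le_norm[OF that, of "p \<omega>"] bound[of \<omega>] K by (auto simp: indicator_def)
  define w where "w b \<omega> = ?I \<omega> * (p \<omega> \<bullet> b)" for b \<omega>
  have w_meas: "w b \<in> borel_measurable (H n)" "w b \<in> borel_measurable M" for b
    unfolding w_def using p b_I pM EM by (auto intro!: borel_measurable_times borel_measurable_inner)
  have w_int: "integrable M (w b)" if "b \<in> Basis" for b
    using w_meas pb[OF that] by (intro integrable_const_bound[where B = K]) (auto simp: w_def)
  define \<xi> where "\<xi> b \<omega> = (z (Suc n) \<omega> - \<mu>) \<bullet> b" for b \<omega>
  have \<xi>_meas: "\<xi> b \<in> borel_measurable M" for b
    unfolding \<xi>_def using z_borel[of "Suc n"] by measurable
  have \<xi>_int: "integrable M (\<xi> b)" if "b \<in> Basis" for b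
    by (rule square_integrable_imp_integrable[OF \<xi>_meas]) (use z_comp_L2(1)[OF _ that, of "Suc n"] in \<open>simp add: \<xi>_def\<close>)
  have w\<xi>: "integrable M (\<lambda>\<omega>. w b \<omega> * \<xi> b \<omega>)" if "b \<in> Basis" for b
  proof (rule Bochner_Integration.integrable_bound[OF integrable_mult_right[OF \<xi>_int[OF that], of K]])
    show "AE \<omega> in M. norm (w b \<omega> * \<xi> b \<omega>) \<le> norm (K * \<xi> b \<omega>)"
      using pb[OF that] K by (auto simp: w_def abs_mult intro!: mult_right_mono)
  qed (use w_meas \<xi>_meas in measurable)
  have zero: "(\<integral>\<omega>. w b \<omega> * \<xi> b \<omega> \<partial>M) = 0" if "b \<in> Basis" for b
    using noise_orthogonal[OF n that w_meas(1) w_int[OF that]] w\<xi>[OF that] unfolding \<xi>_def by blast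
  define Y where "Y \<omega> = (\<Sum>b\<in>Basis. w b \<omega> * \<xi> b \<omega>)" for \<omega>
  have Y: "integrable M Y" "(\<integral>\<omega>. Y \<omega> \<partial>M) = 0"
    unfolding Y_def[abs_def] using w\<xi> zero by (auto simp: Bochner_Integration.integral_sum)
  define Q where "Q \<omega> = ?I \<omega> * ((zbar n \<omega> - \<mu>) \<bullet> p \<omega>)" for \<omega>
  have Qle: "\<bar>Q \<omega>\<bar> \<le> K * norm (zbar n \<omega> - \<mu>)" for \<omega>
  proof (cases "\<omega> \<in> E")
    case True
    have "\<bar>(zbar n \<omega> - \<mu>) \<bullet> p \<omega>\<bar> \<le> norm (zbar n \<omega> - \<mu>) * norm (p \<omega>)"
      by (rule Cauchy_Schwarz_ineq2)
    also have "\<dots> \<le> norm (zbar n \<omega> - \<mu>) * K"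
      using bound[OF True] by (intro mult_left_mono) auto
    finally show ?thesis
      using True by (simp add: Q_def mult.commute)
  qed (use K in \<open>simp add: Q_def\<close>)
  have Q_meas: "Q \<in> borel_measurable M"
    unfolding Q_def using zbar_borel pM EM by measurable
  have iQ: "integrable M Q"
    by (rule Bochner_Integration.integrable_bound[OF integrable_mult_right[OF zbar_L1(1)[OF n], of K] Q_meas])
       (use Qle K in \<open>auto simp: abs_mult\<close>)
  have X: "X = (\<lambda>\<omega>. (1 / real (Suc n)) * (Y \<omega> - Q \<omega>))"
  proof
    fix \<omega>
    have "Y \<omega> = ?I \<omega> * ((z (Suc n) \<omega> - \<mu>) \<bullet> p \<omega>)"
      unfolding euclidean_inner[of "z (Suc n) \<omega> - \<mu>" "p \<omega>"]
      by (simp add: Y_def w_def \<xi>_def sum_distrib_left mult_ac)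
    then show "X \<omega> = (1 / real (Suc n)) * (Y \<omega> - Q \<omega>)"
      unfolding X_def zbar_Suc[OF n] Q_def by (simp add: inner_diff_left right_diff_distrib mult_ac)
  qed
  show "integrable M X"
    unfolding X using Y iQ by (intro integrable_mult_right Bochner_Integration.integrable_diff) auto
  have "(\<integral>\<omega>. X \<omega> \<partial>M) = (1 / real (Suc n)) * (- (\<integral>\<omega>. Q \<omega> \<partial>M))"
    unfolding X using Y iQ by simp
  also have "\<dots> \<le> (1 / real (Suc n)) * (K * ((DIM('z) * C + 1) / sqrt n))"
  proof (rule mult_left_mono)
    have "- (\<integral>\<omega>. Q \<omega> \<partial>M) = (\<integral>\<omega>. - Q \<omega> \<partial>M)"
      by simp
    also have "\<dots> \<le> (\<integral>\<omega>. K * norm (zbar n \<omega> - \<mu>) \<partial>M)"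
    proof (rule integral_mono)
      show "- Q \<omega> \<le> K * norm (zbar n \<omega> - \<mu>)" for \<omega>
        using Qle[of \<omega>] by linarith
    qed (use iQ zbar_L1(1)[OF n] in auto)
    also have "\<dots> = K * (\<integral>\<omega>. norm (zbar n \<omega> - \<mu>) \<partial>M)"
      by simp
    also have "\<dots> \<le> K * ((DIM('z) * C + 1) / sqrt n)"
      using zbar_L1(2)[OF n] K by (rule mult_left_mono)
    finally show "- (\<integral>\<omega>. Q \<omega> \<partial>M) \<le> K * ((DIM('z) * C + 1) / sqrt n)" .
  qed simp
  also have "\<dots> \<le> (1 / real n) * (K * ((DIM('z) * C + 1) / sqrt n))"
    using n K C_nonneg by (intro mult_right_mono) (auto simp: divide_simps)
  finally show "(\<integral>\<omega>. X \<omega> \<partial>M) \<le> K * (DIM('z) * C + 1) * (1 / (sqrt n * n))"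
    by (simp add: mult_ac)
qed

text \<open>The noise is killed in expectation because \<open>p (Suc n)\<close> and the event \<open>E n\<close> are known at time
  \<open>n\<close>; what remains is the bias \<open>zbar n - \<mu>\<close> with weight \<open>1 / (n + 1)\<close>, of order \<open>n powr (-3/2)\<close>.\<close>

lemma summable_decrease:
  fixes p :: "nat \<Rightarrow> 'a \<Rightarrow> 'z" and s \<delta> :: "nat \<Rightarrow> 'a \<Rightarrow> real" and E :: "nat \<Rightarrow> 'a set"
  assumes E_meas: "\<And>n. n0 \<le> n \<Longrightarrow> E n \<in> sets (H n)"
    and E_dec: "\<And>n. n0 \<le> n \<Longrightarrow> E (Suc n) \<subseteq> E n"
    and p_meas: "\<And>n. n0 \<le> n \<Longrightarrow> p (Suc n) \<in> borel_measurable (H n)"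
    and s_meas: "\<And>n. n0 \<le> n \<Longrightarrow> s (Suc n) \<in> borel_measurable M"
    and \<delta>_meas: "\<And>n. n0 \<le> n \<Longrightarrow> \<delta> n \<in> borel_measurable M"
    and \<delta>_nonneg: "\<And>n \<omega>. 0 \<le> \<delta> n \<omega>"
    and p_bound: "\<And>n \<omega>. n0 \<le> n \<Longrightarrow> \<omega> \<in> E n \<Longrightarrow> norm (p (Suc n) \<omega>) \<le> K"
    and s_bound: "\<And>n \<omega>. n0 \<le> n \<Longrightarrow> \<omega> \<in> E n \<Longrightarrow> \<bar>s (Suc n) \<omega>\<bar> \<le> K"
    and nonneg: "\<And>n \<omega>. n0 \<le> n \<Longrightarrow> \<omega> \<in> E n \<Longrightarrow> 0 \<le> zbar (Suc n) \<omega> \<bullet> p (Suc n) \<omega>"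
    and descent: "\<And>n. Suc n0 \<le> n \<Longrightarrow> AE \<omega> in M. \<omega> \<in> E n \<longrightarrow>
      zbar n \<omega> \<bullet> p (Suc n) \<omega> + s (Suc n) \<omega> + \<delta> n \<omega> \<le> zbar n \<omega> \<bullet> p n \<omega> + s n \<omega>"
    and n0: "1 \<le> n0" and K: "0 \<le> K"
  shows "AE \<omega> in M. (\<forall>n\<ge>n0. \<omega> \<in> E n) \<longrightarrow> summable (\<lambda>n. \<delta> n \<omega>)"
proof -
  let ?I = "\<lambda>n \<omega>. indicator (E n) \<omega> :: real"
  \<comment> \<open>On \<open>E n\<close> this is the objective with mean
    \<open>zbar (Suc n)\<close> at the point described by \<open>p (Suc n)\<close> and
    \<open>s (Suc n)\<close>; adding \<open>K\<close> makes it nonnegative, since the linear part is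
    nonnegative there and \<open>s\<close> is at least \<open>- K\<close>. \<open>X n\<close> is the
    part of it due to replacing \<open>zbar n\<close> by \<open>zbar (Suc n)\<close>.\<close>
  define U where "U n \<omega> = ?I n \<omega> * (zbar (Suc n) \<omega> \<bullet> p (Suc n) \<omega> + s (Suc n) \<omega> + K)" for n \<omega>
  define W where "W n \<omega> = ?I n \<omega> * \<delta> n \<omega>" for n \<omega>
  define X where "X n \<omega> = ?I n \<omega> * ((zbar (Suc n) \<omega> - zbar n \<omega>) \<bullet> p (Suc n) \<omega>)" for n \<omega>
  define \<kappa> where "\<kappa> n = K * (DIM('z) * C + 1) * (1 / (sqrt (real n) * real n))" for n
  have EM: "E n \<in> sets M" if "n0 \<le> n" for n
    using E_meas[OF that] subalg[of n] n0 that by (auto simp: subalgebra_def)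
  have pM: "p (Suc n) \<in> borel_measurable M" if "n0 \<le> n" for n
    using n0 that by (intro measurable_from_subalg[OF subalg p_meas[OF that]]) auto
  have X: "integrable M (X n)" "(\<integral>\<omega>. X n \<omega> \<partial>M) \<le> \<kappa> n" if "n0 \<le> n" for n
    using noise_increment[OF _ p_meas[OF that] E_meas[OF that] p_bound[OF that] K] n0 that
    unfolding X_def \<kappa>_def by auto
  have U_nonneg: "0 \<le> U n \<omega>" if "n0 \<le> n" for n \<omega>
    using nonneg[OF that, of \<omega>] s_bound[OF that, of \<omega>] by (auto simp: U_def indicator_def)
  have U_int: "integrable M (U n)" if n: "n0 \<le> n" for n
  proof (rule Bochner_Integration.integrable_bound)
    show "integrable M (\<lambda>\<omega>. K * norm (zbar (Suc n) \<omega> - \<mu>) + (K * norm \<mu> + 2 * K))"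
      using zbar_L1(1)[of "Suc n"] by auto
    show "U n \<in> borel_measurable M"
      unfolding U_def using EM[OF n] pM[OF n] s_meas[OF n] zbar_borel[of "Suc n"] by measurable
    have "norm (U n \<omega>) \<le> norm (K * norm (zbar (Suc n) \<omega> - \<mu>) + (K * norm \<mu> + 2 * K))" for \<omega>
    proof (cases "\<omega> \<in> E n")
      case True
      have "\<bar>zbar (Suc n) \<omega> \<bullet> p (Suc n) \<omega>\<bar> \<le> norm (zbar (Suc n) \<omega>) * norm (p (Suc n) \<omega>)"
        by (rule Cauchy_Schwarz_ineq2)
      also have "\<dots> \<le> (norm (zbar (Suc n) \<omega> - \<mu>) + norm \<mu>) * K"
        using p_bound[OF n True] norm_triangle_sub[of "zbar (Suc n) \<omega>" \<mu>]
        by (intro mult_mono) (auto simp: add.commute)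
      finally have "\<bar>zbar (Suc n) \<omega> \<bullet> p (Suc n) \<omega>\<bar> \<le> K * norm (zbar (Suc n) \<omega> - \<mu>) + K * norm \<mu>"
        by (simp add: distrib_left mult.commute)
      then show ?thesis
        using True s_bound[OF n True] K by (simp add: U_def)
    next
      case False
      then show ?thesis using K by (simp add: U_def)
    qed
    then show "AE \<omega> in M. norm (U n \<omega>) \<le> norm (K * norm (zbar (Suc n) \<omega> - \<mu>) + (K * norm \<mu> + 2 * K))"
      by simp
  qed
  \<comment> \<open>Inside \<open>E (Suc n)\<close> this is the descent inequality with the change
    of mean added to both sides. A path that has just left the events contributes 0 on the left and
    \<open>U n\<close> on the right, which is why \<open>U\<close> has to be nonnegative.\<close>
  have step: "AE \<omega> in M. U (Suc n) \<omega> + W (Suc n) \<omega> \<le> U n \<omega> + X (Suc n) \<omega>" if n: "n0 \<le> n" for n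
    using descent[OF Suc_le_mono[THEN iffD2, OF n]]
  proof eventually_elim
    case d: (elim \<omega>)
    show ?case
    proof (cases "\<omega> \<in> E (Suc n)")
      case True
      then have "\<omega> \<in> E n" using E_dec[OF n] by auto
      with True d show ?thesis
        by (simp add: U_def W_def X_def inner_diff_left)
    next
      case False
      then show ?thesis
        using U_nonneg[OF n, of \<omega>] by (simp add: U_def[of "Suc n"] W_def X_def)
    qed
  qed
  have W_nonneg: "0 \<le> W n \<omega>" for n \<omega>
    using \<delta>_nonneg by (simp add: W_def)
  \<comment> \<open>Integrability of the decrease comes from the inequality itself: dropping the
    nonnegative \<open>U (Suc n)\<close> leaves an integrable upper bound.\<close>
  have W_int: "integrable M (W (Suc n))" if n: "n0 \<le> n" for n
  proof (rule Bochner_Integration.integrable_bound)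
    show "integrable M (\<lambda>\<omega>. U n \<omega> + X (Suc n) \<omega>)"
      using U_int[OF n] X(1)[of "Suc n"] n by auto
    show "W (Suc n) \<in> borel_measurable M"
      unfolding W_def using n
      by (intro borel_measurable_times borel_measurable_indicator EM \<delta>_meas) auto
    show "AE \<omega> in M. norm (W (Suc n) \<omega>) \<le> norm (U n \<omega> + X (Suc n) \<omega>)"
      using step[OF n]
    proof eventually_elim
      case (elim \<omega>)
      then show ?case
        using W_nonneg[of "Suc n" \<omega>] U_nonneg[of "Suc n" \<omega>] n by simp
    qed
  qed
  have int_step: "(\<integral>\<omega>. U (Suc n) \<omega> \<partial>M) + (\<integral>\<omega>. W (Suc n) \<omega> \<partial>M) \<le> (\<integral>\<omega>. U n \<omega> \<partial>M) + \<kappa> (Suc n)"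
    if n: "n0 \<le> n" for n
  proof -
    have "(\<integral>\<omega>. U (Suc n) \<omega> + W (Suc n) \<omega> \<partial>M) \<le> (\<integral>\<omega>. U n \<omega> + X (Suc n) \<omega> \<partial>M)"
      using U_int W_int X(1) n step[OF n] by (intro integral_mono_AE) auto
    also have "\<dots> = (\<integral>\<omega>. U n \<omega> \<partial>M) + (\<integral>\<omega>. X (Suc n) \<omega> \<partial>M)"
      using n by (intro Bochner_Integration.integral_add U_int X(1)) auto
    also have "(\<integral>\<omega>. U (Suc n) \<omega> + W (Suc n) \<omega> \<partial>M) = (\<integral>\<omega>. U (Suc n) \<omega> \<partial>M) + (\<integral>\<omega>. W (Suc n) \<omega> \<partial>M)"
      using n by (intro Bochner_Integration.integral_add U_int W_int) auto
    finally show ?thesis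
      using X(2)[of "Suc n"] n by simp
  qed
  have "summable (\<lambda>n. \<kappa> (Suc n))"
    unfolding \<kappa>_def by (intro summable_mult summable_powr_three_halves)
  then have \<kappa>: "summable (\<lambda>n. \<kappa> (Suc (n + n0)))"
    by (rule summable_ignore_initial_segment)
  have \<kappa>0: "0 \<le> \<kappa> n" for n
    using K C_nonneg by (simp add: \<kappa>_def)
  have tele: "(\<Sum>n<N. \<integral>\<omega>. W (Suc (n + n0)) \<omega> \<partial>M) + (\<integral>\<omega>. U (N + n0) \<omega> \<partial>M)
      \<le> (\<integral>\<omega>. U n0 \<omega> \<partial>M) + (\<Sum>n<N. \<kappa> (Suc (n + n0)))" for N
  proof (induction N)
    case (Suc N)
    then show ?case using int_step[of "N + n0"] by simp
  qed simp
  have "summable (\<lambda>n. \<integral>\<omega>. W (Suc (n + n0)) \<omega> \<partial>M)"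
  proof (rule summableI_nonneg_bounded)
    show "0 \<le> (\<integral>\<omega>. W (Suc (n + n0)) \<omega> \<partial>M)" for n
      using W_nonneg by (intro Bochner_Integration.integral_nonneg) auto
    show "(\<Sum>n<N. \<integral>\<omega>. W (Suc (n + n0)) \<omega> \<partial>M) \<le> (\<integral>\<omega>. U n0 \<omega> \<partial>M) + (\<Sum>n. \<kappa> (Suc (n + n0)))" for N
    proof -
      have "0 \<le> (\<integral>\<omega>. U (N + n0) \<omega> \<partial>M)"
        using U_nonneg by (intro Bochner_Integration.integral_nonneg) auto
      moreover have "(\<Sum>n<N. \<kappa> (Suc (n + n0))) \<le> (\<Sum>n. \<kappa> (Suc (n + n0)))"
        using \<kappa> \<kappa>0 by (intro sum_le_suminf) auto
      ultimately show ?thesis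
        using tele[of N] by linarith
    qed
  qed
  then have "AE \<omega> in M. summable (\<lambda>n. W (Suc (n + n0)) \<omega>)"
    using W_int W_nonneg by (intro AE_summable_of_summable_integral) auto
  then show ?thesis
  proof eventually_elim
    case (elim \<omega>)
    show ?case
    proof
      assume "\<forall>n\<ge>n0. \<omega> \<in> E n"
      then have "W (Suc (n + n0)) \<omega> = \<delta> (n + Suc n0) \<omega>" for n
        by (simp add: W_def)
      with elim have "summable (\<lambda>n. \<delta> (n + Suc n0) \<omega>)"
        by simp
      then show "summable (\<lambda>n. \<delta> n \<omega>)"
        using summable_iff_shift[of "\<lambda>n. \<delta> n \<omega>"] by blast
    qed
  qed
qed

end

section \<open>The quadratic majorant\<close>

lemma bounded_bilinear_matrix_vector: "bounded_bilinear ((*v) :: real^'n^'m \<Rightarrow> real^'n \<Rightarrow> real^'m)"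
proof -
  have "bilinear ((*v) :: real^'n^'m \<Rightarrow> real^'n \<Rightarrow> real^'m)"
    unfolding bilinear_def
    by (auto intro!: linearI simp: matrix_vector_mult_add_rdistrib matrix_vector_right_distrib
        vector_scalar_commute scaleR_matrix_vector_assoc)
  then show ?thesis
    by (simp add: bilinear_conv_bounded_bilinear)
qed

lemma borel_measurable_matrix_vector:
  fixes A :: "'a \<Rightarrow> real^'n^'m"
  assumes "A \<in> borel_measurable N" "x \<in> borel_measurable N"
  shows "(\<lambda>\<omega>. A \<omega> *v x \<omega>) \<in> borel_measurable N"
  using assms
  by (rule borel_measurable_continuous_Pair)
     (intro bounded_bilinear.continuous_on[OF bounded_bilinear_matrix_vector] continuous_intros)

text \<open>The rank-one matrix \<open>x x^T\<close>. It turns a quadratic form into an inner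
  product, linear in the matrix, as needed to view the cost as a linear function of the
  moments.\<close>

definition outer :: "real^'n \<Rightarrow> real^'n^'n" where
  "outer x = (\<chi> i j. x $ i * x $ j)"

lemma inner_outer: "M \<bullet> outer x = x \<bullet> (M *v x)"
  by (simp add: outer_def inner_vec_def matrix_vector_mult_def sum_distrib_left mult_ac)

lemma norm_outer: "norm (outer x) = (norm x)\<^sup>2"
proof -
  have "outer x *v x = (x \<bullet> x) *\<^sub>R x"
  proof (rule Finite_Cartesian_Product.vec_eq_iff[THEN iffD2], rule allI)
    show "(outer x *v x) $ i = ((x \<bullet> x) *\<^sub>R x) $ i" for i
      by (simp add: outer_def inner_vec_def matrix_vector_mult_def sum_distrib_left mult_ac)
  qed
  then have "outer x \<bullet> outer x = (x \<bullet> x) * (x \<bullet> x)"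
    by (simp add: inner_outer)
  then have "(norm (outer x))\<^sup>2 = ((norm x)\<^sup>2)\<^sup>2"
    unfolding power2_norm_eq_inner power2_eq_square[of "x \<bullet> x"] .
  then show ?thesis
    by (rule power2_eq_imp_eq) auto
qed

lemma quadratic_form_le: "\<bar>x \<bullet> (M *v x)\<bar> \<le> norm M * (norm x)\<^sup>2" for M :: "real^'n^'n"
  using Cauchy_Schwarz_ineq2[of M "outer x"] by (simp add: inner_outer norm_outer)

lemma inner_matrix_symmetric:
  fixes M :: "real^'n^'n"
  assumes "transpose M = M"
  shows "x \<bullet> (M *v y) = y \<bullet> (M *v x)"
  using assms by (metis dot_lmul_matrix inner_commute transpose_matrix_vector)

lemma quadratic_expansion:
  fixes M :: "real^'n^'n"
  assumes "transpose M = M"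
  shows "1/2 * (h' \<bullet> (M *v h')) = 1/2 * (h \<bullet> (M *v h)) + (h' - h) \<bullet> (M *v h)
    + 1/2 * ((h' - h) \<bullet> (M *v (h' - h)))"
  using inner_matrix_symmetric[OF assms, of h' h]
  by (simp add: inner_diff_left inner_diff_right matrix_vector_mult_diff_distrib algebra_simps)

text \<open>The constant is the minimum of the quadratic form on the compact unit sphere;
  homogeneity extends it to all vectors.\<close>

lemma sym_pd_coercive:
  fixes M :: "real^'n^'n"
  assumes "sym_pd M"
  obtains \<epsilon> where "0 < \<epsilon>" "\<And>x. \<epsilon> * (norm x)\<^sup>2 \<le> x \<bullet> (M *v x)"
proof -
  have "compact (sphere (0::real^'n) 1)" "sphere (0::real^'n) 1 \<noteq> {}"
    by auto
  moreover have "continuous_on (sphere 0 1) (\<lambda>x::real^'n. x \<bullet> (M *v x))"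
    by (intro continuous_intros)
  ultimately obtain u where u: "u \<in> sphere 0 1" "\<And>x. x \<in> sphere 0 1 \<Longrightarrow> u \<bullet> (M *v u) \<le> x \<bullet> (M *v x)"
    using continuous_attains_inf by (metis (no_types, lifting))
  show thesis
  proof
    have "u \<noteq> 0" using u(1) by auto
    then show "0 < u \<bullet> (M *v u)"
      using assms by (simp add: sym_pd_def)
    fix x :: "real^'n"
    show "u \<bullet> (M *v u) * (norm x)\<^sup>2 \<le> x \<bullet> (M *v x)"
    proof (cases "x = 0")
      case False
      define y where "y = (1 / norm x) *\<^sub>R x"
      have x: "x = norm x *\<^sub>R y" and y: "y \<in> sphere 0 1"
        using False by (auto simp: y_def)
      have "x \<bullet> (M *v x) = (norm x)\<^sup>2 * (y \<bullet> (M *v y))"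
        by (subst (1 2) x) (simp add: vector_scalar_commute power2_eq_square matrix_vector_mult_scaleR)
      then show ?thesis
        using mult_right_mono[OF u(2)[OF y], of "(norm x)\<^sup>2"] by (simp add: mult.commute)
    qed simp
  qed
qed

lemma GDERIV_unique: "GDERIV f x :> a \<Longrightarrow> GDERIV f x :> b \<Longrightarrow> a = b"
proof -
  assume "GDERIV f x :> a" "GDERIV f x :> b"
  then have "(\<lambda>h. h \<bullet> a) = (\<lambda>h. h \<bullet> b)"
    unfolding gderiv_def by (rule has_derivative_unique)
  then have "(a - b) \<bullet> a = (a - b) \<bullet> b"
    by metis
  then have "(a - b) \<bullet> (a - b) = 0"
    by (simp add: inner_diff_right)
  then show "a = b"
    by simp
qed

lemma grad_eq: "GDERIV f x :> g \<Longrightarrow> grad f x = g"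
  unfolding grad_def using GDERIV_unique by (intro the_equality) auto

text \<open>A quadratic upper bound at every point is also a lower bound, after exchanging the two points.\<close>

lemma GDERIV_quadratic_upper_bound:
  fixes f :: "'v::real_inner \<Rightarrow> real"
  assumes ub: "\<And>x y. f y \<le> f x + g x \<bullet> (y - x) + \<beta> * (norm (y - x))\<^sup>2"
    and cont: "isCont g x" and \<beta>: "0 \<le> \<beta>"
  shows "GDERIV f x :> g x"
proof -
  have bound: "\<bar>f y - f x - (y - x) \<bullet> g x\<bar> \<le> norm (y - x) * (norm (g y - g x) + \<beta> * norm (y - x))" for y
  proof -
    have "\<bar>(g y - g x) \<bullet> (y - x)\<bar> \<le> norm (g y - g x) * norm (y - x)"
      by (rule Cauchy_Schwarz_ineq2)
    moreover have "f y - f x - (y - x) \<bullet> g x \<le> \<beta> * (norm (y - x))\<^sup>2"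
      using ub[of y x] by (simp add: inner_commute)
    moreover have "f y - f x - (y - x) \<bullet> g x \<ge> (g y - g x) \<bullet> (y - x) - \<beta> * (norm (y - x))\<^sup>2"
      using ub[of x y] by (simp add: inner_commute inner_diff_left inner_diff_right norm_minus_commute)
    moreover have "0 \<le> norm (g y - g x) * norm (y - x)" by simp
    ultimately have "\<bar>f y - f x - (y - x) \<bullet> g x\<bar> \<le> norm (g y - g x) * norm (y - x) + \<beta> * (norm (y - x))\<^sup>2"
      by linarith
    then show ?thesis
      by (simp add: algebra_simps power2_eq_square)
  qed
  have "((\<lambda>y. norm (g y - g x) + \<beta> * norm (y - x)) \<longlongrightarrow> norm (g x - g x) + \<beta> * norm (x - x)) (at x)"
    using cont unfolding isCont_def by (intro tendsto_intros)
  then have lim: "((\<lambda>y. norm (g y - g x) + \<beta> * norm (y - x)) \<longlongrightarrow> 0) (at x)"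
    by simp
  have "((\<lambda>y. norm (f y - f x - (y - x) \<bullet> g x) / norm (y - x)) \<longlongrightarrow> 0) (at x)"
  proof (rule tendsto_sandwich[OF _ _ tendsto_const lim])
    show "eventually (\<lambda>y. norm (f y - f x - (y - x) \<bullet> g x) / norm (y - x)
        \<le> norm (g y - g x) + \<beta> * norm (y - x)) (at x)"
      using bound by (auto simp: eventually_at_filter divide_le_eq mult.commute)
  qed simp
  then show ?thesis
    unfolding gderiv_def has_derivative_iff_norm by (simp add: bounded_linear_inner_left)
qed

lemma subspace_ran_cols: "subspace (ran_cols m d)"
proof -
  have "mult_cols m d u + mult_cols m d w = mult_cols m d (\<lambda>j. u j + w j)" for u w
    by (simp add: mult_cols_def sum.distrib scaleR_add_left)
  moreover have "c *\<^sub>R mult_cols m d u = mult_cols m d (\<lambda>j. c * u j)" for c u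
    by (simp add: mult_cols_def scaleR_sum_right)
  moreover have "0 = mult_cols m d (\<lambda>_. 0)"
    by (simp add: mult_cols_def)
  ultimately show ?thesis
    unfolding subspace_def ran_cols_def by (auto simp: image_iff)
qed

text \<open>Along \<open>x1 + t *\<^sub>R w\<close>, which stays in \<open>W\<close>, the objective
  changes by \<open>t * l + 1/2 * t\<^sup>2 * q\<close>; if this is nonnegative for every real
  \<open>t\<close>, then \<open>l\<close> vanishes. No invertibility of \<open>A\<close> is
  involved.\<close>

lemma arg_min_quadratic_orthogonal:
  fixes A :: "real^'n^'n"
  assumes W: "subspace W" and min: "is_arg_min (\<lambda>x. a + g \<bullet> (x - x0) + 1/2 * ((x - x0) \<bullet> (A *v (x - x0)))) (\<lambda>x. x \<in> W) x1"
    and sym: "transpose A = A" and w: "w \<in> W"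
  shows "(g + A *v (x1 - x0)) \<bullet> w = 0"
proof (rule ccontr)
  define l where "l = (g + A *v (x1 - x0)) \<bullet> w"
  define q where "q = w \<bullet> (A *v w)"
  define e where "e = x1 - x0"
  assume "\<not> ?thesis"
  then have l0: "l \<noteq> 0" by (simp add: l_def)
  have "0 \<le> t * l + 1/2 * t\<^sup>2 * q" for t
  proof -
    have "x1 + t *\<^sub>R w \<in> W" "x1 \<in> W"
      using W w min by (auto simp: is_arg_min_def subspace_add subspace_scale)
    then have "g \<bullet> e + 1/2 * (e \<bullet> (A *v e))
        \<le> g \<bullet> (e + t *\<^sub>R w) + 1/2 * ((e + t *\<^sub>R w) \<bullet> (A *v (e + t *\<^sub>R w)))"
      using min unfolding is_arg_min_def e_def by (simp add: not_less add_diff_eq diff_add_eq)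
    moreover have "w \<bullet> (A *v e) = e \<bullet> (A *v w)"
      by (rule inner_matrix_symmetric[OF sym])
    ultimately show ?thesis
      by (simp add: l_def q_def e_def[symmetric] inner_add_left inner_add_right matrix_vector_right_distrib
          matrix_vector_mult_scaleR inner_commute[of _ w] power2_eq_square algebra_simps)
  qed note pos = this
  \<comment> \<open>This minimizes the parabola with curvature \<open>1 + \<bar>q\<bar>\<close>,
    which dominates \<open>q\<close> and is positive even when \<open>q\<close> is not.\<close>
  define t where "t = - l / (1 + \<bar>q\<bar>)"
  have "t * l + 1/2 * t\<^sup>2 * q \<le> t * l + 1/2 * t\<^sup>2 * (1 + \<bar>q\<bar>)"
    by (intro add_left_mono mult_left_mono) auto
  also have "\<dots> = - (1/2) * (l\<^sup>2 / (1 + \<bar>q\<bar>))"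
  proof -
    have "1 + \<bar>q\<bar> \<noteq> 0" by linarith
    then show ?thesis
      by (simp add: t_def power2_eq_square divide_simps)
  qed
  also have "\<dots> < 0"
  proof -
    have "0 < 1 + \<bar>q\<bar>" by linarith
    then show ?thesis using l0 by simp
  qed
  finally show False using pos[of t] by simp
qed

text \<open>The vector \<open>qvec h\<close> represents the quadratic cost of \<open>h\<close> as a linear functional of the moments
  \<open>(\<parallel>y\<parallel>\<^sup>2, X y, X X\<^sup>T)\<close>.\<close>

definition qvec :: "real^'n \<Rightarrow> real \<times> (real^'n) \<times> (real^'n^'n)" where
  "qvec h = (1/2, - h, (1/2) *\<^sub>R outer h)"

lemma inner_qvec: "(\<rho>, r, R) \<bullet> qvec h = 1/2 * \<rho> - r \<bullet> h + 1/2 * (h \<bullet> (R *v h))"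
  by (simp add: qvec_def inner_outer)

lemma continuous_on_qvec: "continuous_on S qvec"
  unfolding qvec_def outer_def by (intro continuous_intros)

lemma norm_le_of_inner:
  fixes a :: "'v::real_inner"
  assumes "\<And>x. x \<bullet> a \<le> c * norm x" and "0 \<le> c" shows "norm a \<le> c"
proof (cases "a = 0")
  case False
  have "norm a * norm a \<le> c * norm a"
    using assms(1)[of a] by (simp add: dot_square_norm power2_eq_square)
  then show ?thesis using False by simp
qed (use assms in simp)

section \<open>The regularizer, its gradient and its half-quadratic majorant\<close>

locale mm_regularizer =
  fixes \<psi> :: "'s::finite \<Rightarrow> real \<Rightarrow> real" and V0 :: "real^'n^'n" and v0 :: "real^'n"
    and V :: "real^'n^'p" and v :: "real^'p" and blk :: "'p \<Rightarrow> 's" and \<nu>max :: real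
  assumes potential: "\<And>s. mm_potential (\<psi> s)"
    and V0_psd: "sym_psd V0"
    and nu_bounds: "\<And>s t. 0 \<le> t \<Longrightarrow> 0 \<le> nu (\<psi> s) t \<and> nu (\<psi> s) t \<le> \<nu>max"
begin

definition wt :: "real^'n \<Rightarrow> real^'p" where
  "wt h = weights \<psi> V v blk h"

definition B :: "real^'n \<Rightarrow> real^'n^'n" where
  "B h = V0 + transpose V ** Diag (wt h) ** V"

definition dvec :: "real^'n \<Rightarrow> real^'n" where
  "dvec h = v0 + transpose V *v (Diag (wt h) *v v)"

abbreviation Psi :: "real^'n \<Rightarrow> real" where
  "Psi \<equiv> regularizer \<psi> V0 v0 V v blk"

text \<open>As \<open>deriv \<psi> t = nu \<psi> t * t\<close>, the gradient of \<open>Psi\<close>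
  looks affine once the weights are frozen at \<open>h\<close>. That it is indeed the gradient is a
  consequence of \<open>Psi_majorant\<close>, drawn in \<open>GDERIV_Fz\<close>.\<close>

definition gradPsi :: "real^'n \<Rightarrow> real^'n" where
  "gradPsi h = B h *v h - dvec h"

lemma wt_bounds: "0 \<le> wt h $ p" "wt h $ p \<le> \<nu>max"
  using nu_bounds by (auto simp: wt_def weights_def block_norm_def L2_set_nonneg)

lemma numax_nonneg: "0 \<le> \<nu>max"
  using nu_bounds[of 0 undefined] by auto

lemma continuous_on_wt: "continuous_on S (\<lambda>h. wt h $ p)"
proof -
  have "continuous_on S (block_norm V v blk (blk p))"
    unfolding block_norm_def L2_set_def by (intro continuous_intros)
  then show ?thesis
    unfolding wt_def weights_def
    using continuous_on_compose2[OF mm_potential.continuous_on_nu[OF potential, of UNIV] _ subset_UNIV] by simp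
qed

lemma Diag_vec: "(Diag b *v x) $ p = b $ p * x $ p"
  by (simp add: Diag_def matrix_vector_mult_def if_distrib[of "\<lambda>t. t * _"] cong: if_cong)

lemma inner_transpose_mult: "x \<bullet> (transpose V *v y) = (V *v x) \<bullet> y"
  by (metis dot_lmul_matrix inner_commute transpose_matrix_vector transpose_transpose)

lemma inner_B: "x \<bullet> (B h *v y) = x \<bullet> (V0 *v y) + (\<Sum>p\<in>UNIV. wt h $ p * (V *v x) $ p * (V *v y) $ p)"
proof -
  have "x \<bullet> ((transpose V ** Diag (wt h) ** V) *v y) = (V *v x) \<bullet> (Diag (wt h) *v (V *v y))"
    by (simp add: inner_transpose_mult del: transpose_matrix_vector flip: matrix_vector_mul_assoc)
  also have "\<dots> = (\<Sum>p\<in>UNIV. wt h $ p * (V *v x) $ p * (V *v y) $ p)"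
    by (simp add: inner_vec_def Diag_vec mult_ac)
  finally show ?thesis
    by (simp add: B_def matrix_vector_mult_add_rdistrib inner_add_right)
qed

lemma inner_dvec: "x \<bullet> dvec h = x \<bullet> v0 + (\<Sum>p\<in>UNIV. wt h $ p * (V *v x) $ p * v $ p)"
proof -
  have "x \<bullet> dvec h = x \<bullet> v0 + (V *v x) \<bullet> (Diag (wt h) *v v)"
    by (simp add: dvec_def inner_add_right inner_transpose_mult del: transpose_matrix_vector)
  then show ?thesis
    by (simp add: inner_vec_def[of "V *v x"] Diag_vec mult_ac)
qed

lemma V0_sym: "transpose V0 = V0" and V0_nonneg: "0 \<le> x \<bullet> (V0 *v x)"
  using V0_psd by (auto simp: sym_psd_def)

lemma B_sym: "transpose (B h) = B h"
proof -
  have "transpose (Diag (wt h)) = Diag (wt h)"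
  proof (intro Finite_Cartesian_Product.vec_eq_iff[THEN iffD2] allI)
    show "transpose (Diag (wt h)) $ i $ j = Diag (wt h) $ i $ j" for i j
      by (simp add: Diag_def transpose_def)
  qed
  moreover have "transpose (P + Q) = transpose P + transpose Q" for P Q :: "real^'n^'n"
    by (simp add: transpose_def Finite_Cartesian_Product.vec_eq_iff)
  ultimately show ?thesis
    using V0_sym by (simp add: B_def matrix_transpose_mul matrix_mul_assoc)
qed

lemma B_ge_V0: "x \<bullet> (V0 *v x) \<le> x \<bullet> (B h *v x)"
  unfolding inner_B using wt_bounds by (auto intro!: sum_nonneg simp: mult.assoc)

text \<open>The bound is uniform in \<open>h\<close> because the weights never exceed
  \<open>\<nu>max\<close>. Each component is estimated by the full norm, hence the factor
  \<open>CARD('p)\<close>.\<close>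

lemma B_bounded: obtains \<beta> where "0 \<le> \<beta>" "\<And>h x. norm (B h *v x) \<le> \<beta> * norm x"
proof
  define \<beta> where "\<beta> = onorm ((*v) V0) + \<nu>max * (onorm ((*v) V))\<^sup>2 * CARD('p)"
  have V: "norm (V *v x) \<le> onorm ((*v) V) * norm x" and V0: "norm (V0 *v x) \<le> onorm ((*v) V0) * norm x" for x
    by (auto intro: onorm)
  have o: "0 \<le> onorm ((*v) V)" "0 \<le> onorm ((*v) V0)"
    by (auto intro: onorm_pos_le)
  show "0 \<le> \<beta>"
    using o numax_nonneg by (simp add: \<beta>_def)
  fix h x
  show "norm (B h *v x) \<le> \<beta> * norm x"
  proof (rule norm_le_of_inner)
    show "0 \<le> \<beta> * norm x" using \<open>0 \<le> \<beta>\<close> by simp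
    fix u
    have "u \<bullet> (V0 *v x) \<le> norm u * (onorm ((*v) V0) * norm x)"
      using norm_cauchy_schwarz[of u "V0 *v x"] mult_left_mono[OF V0[of x], of "norm u"] by simp
    moreover have "wt h $ p * (V *v u) $ p * (V *v x) $ p
        \<le> \<nu>max * ((onorm ((*v) V) * norm u) * (onorm ((*v) V) * norm x))" for p
    proof -
      have "wt h $ p * (V *v u) $ p * (V *v x) $ p \<le> wt h $ p * (\<bar>(V *v u) $ p\<bar> * \<bar>(V *v x) $ p\<bar>)"
        using wt_bounds[of h p] by (simp add: mult.assoc mult_left_mono flip: abs_mult)
      also have "\<dots> \<le> \<nu>max * ((onorm ((*v) V) * norm u) * (onorm ((*v) V) * norm x))"
        using component_le_norm_cart[of "V *v u" p] component_le_norm_cart[of "V *v x" p] V[of u] V[of x] o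
          wt_bounds[of h p] numax_nonneg
        by (intro mult_mono) auto
      finally show ?thesis .
    qed
    ultimately have "u \<bullet> (B h *v x) \<le> norm u * (onorm ((*v) V0) * norm x) +
        (\<Sum>p\<in>(UNIV::'p set). \<nu>max * ((onorm ((*v) V) * norm u) * (onorm ((*v) V) * norm x)))"
      unfolding inner_B by (intro add_mono sum_mono) auto
    also have "\<dots> = \<beta> * norm x * norm u"
      by (simp add: \<beta>_def power2_eq_square algebra_simps)
    finally show "u \<bullet> (B h *v x) \<le> \<beta> * norm x * norm u" .
  qed
qed

lemma dvec_bounded: obtains \<beta> where "0 \<le> \<beta>" "\<And>h. norm (dvec h) \<le> \<beta>"
proof
  define \<beta> where "\<beta> = norm v0 + \<nu>max * (onorm ((*v) V) * norm v) * CARD('p)"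
  have V: "norm (V *v x) \<le> onorm ((*v) V) * norm x" for x
    by (auto intro: onorm)
  have o: "0 \<le> onorm ((*v) V)"
    by (auto intro: onorm_pos_le)
  show "0 \<le> \<beta>"
    using o numax_nonneg by (simp add: \<beta>_def)
  fix h
  show "norm (dvec h) \<le> \<beta>"
  proof (rule norm_le_of_inner)
    show "0 \<le> \<beta>" by fact
    fix u
    have "wt h $ p * (V *v u) $ p * v $ p \<le> \<nu>max * ((onorm ((*v) V) * norm u) * norm v)" for p
    proof -
      have "wt h $ p * (V *v u) $ p * v $ p \<le> wt h $ p * (\<bar>(V *v u) $ p\<bar> * \<bar>v $ p\<bar>)"
        using wt_bounds[of h p] by (simp add: mult.assoc mult_left_mono flip: abs_mult)
      also have "\<dots> \<le> \<nu>max * ((onorm ((*v) V) * norm u) * norm v)"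
        using component_le_norm_cart[of "V *v u" p] component_le_norm_cart[of v p] V[of u] o
          wt_bounds[of h p] numax_nonneg
        by (intro mult_mono) auto
      finally show ?thesis .
    qed
    then have "u \<bullet> dvec h \<le> norm u * norm v0 + (\<Sum>p\<in>(UNIV::'p set). \<nu>max * ((onorm ((*v) V) * norm u) * norm v))"
      unfolding inner_dvec using norm_cauchy_schwarz[of u v0] by (intro add_mono sum_mono) auto
    also have "\<dots> = \<beta> * norm u"
      by (simp add: \<beta>_def algebra_simps)
    finally show "u \<bullet> dvec h \<le> \<beta> * norm u" .
  qed
qed

lemma inner_gradPsi:
  "gradPsi h \<bullet> x = x \<bullet> (V0 *v h) - x \<bullet> v0 + (\<Sum>p\<in>UNIV. wt h $ p * (V *v x) $ p * (V *v h - v) $ p)"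
  unfolding gradPsi_def inner_commute[of _ x] inner_diff_right inner_B inner_dvec
  by (simp add: right_diff_distrib sum_subtractf)

lemma isCont_gradPsi: "isCont gradPsi h"
proof -
  have "continuous_on UNIV (\<lambda>h. gradPsi h \<bullet> b)" for b
    unfolding inner_gradPsi by (intro continuous_intros continuous_on_wt)
  then have "continuous_on UNIV gradPsi"
    by (intro continuous_on_componentwise[THEN iffD2]) auto
  then show ?thesis
    by (simp add: continuous_on_eq_continuous_at)
qed

text \<open>The residual \<open>V\<^sub>s h - v\<^sub>s\<close> padded with zeros, so that blocks of
  different heights live in one space and \<open>block_norm\<close> becomes an ordinary
  norm.\<close>

definition block :: "'s \<Rightarrow> real^'n \<Rightarrow> real^'p" where
  "block s h = (\<chi> p. if blk p = s then (V *v h - v) $ p else 0)"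

lemma norm_block: "norm (block s h) = block_norm V v blk s h"
proof -
  have "(\<Sum>p\<in>UNIV. (if blk p = s then ((V *v h - v) $ p)\<^sup>2 else 0)) = (\<Sum>p | blk p = s. ((V *v h - v) $ p)\<^sup>2)"
    by (simp add: sum.If_cases)
  then show ?thesis
    by (simp add: norm_vec_def L2_set_def block_norm_def block_def if_distrib[of "\<lambda>t. t\<^sup>2"] cong: if_cong)
qed

lemma sum_blocks:
  "(\<Sum>s\<in>UNIV. nu (\<psi> s) (norm (block s h)) * (block s a \<bullet> block s b))
    = (\<Sum>p\<in>UNIV. wt h $ p * (V *v a - v) $ p * (V *v b - v) $ p)"
proof -
  have "nu (\<psi> s) (norm (block s h)) * (block s a \<bullet> block s b)
      = (\<Sum>p | blk p = s. wt h $ p * (V *v a - v) $ p * (V *v b - v) $ p)" for s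
  proof -
    have "block s a \<bullet> block s b = (\<Sum>p | blk p = s. (V *v a - v) $ p * (V *v b - v) $ p)"
      by (simp add: block_def inner_vec_def if_distrib[of "\<lambda>t. t * _"] sum.If_cases cong: if_cong)
    then show ?thesis
      by (simp add: norm_block wt_def weights_def sum_distrib_left mult.assoc)
  qed
  then show ?thesis
    using sum.group[of UNIV UNIV blk "\<lambda>p. wt h $ p * (V *v a - v) $ p * (V *v b - v) $ p"] by simp
qed

lemma Psi_eq: "Psi h = 1/2 * (h \<bullet> (V0 *v h)) - v0 \<bullet> h + (\<Sum>s\<in>UNIV. \<psi> s (norm (block s h)))"
  by (simp add: regularizer_def norm_block)

text \<open>The bound \<open>mm_potential.tangent\<close> for each block is affine in the squared
  norm of the block at \<open>h'\<close>, hence quadratic in \<open>h'\<close>. Summed over rows,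
  its first-order part belongs to \<open>gradPsi h\<close> and its second-order part to
  \<open>B h\<close>; the \<open>V0\<close> part is exact.\<close>

lemma Psi_majorant: "Psi h' \<le> Psi h + gradPsi h \<bullet> (h' - h) + 1/2 * ((h' - h) \<bullet> (B h *v (h' - h)))"
proof -
  define e where "e = h' - h"
  have comp: "(V *v h' - v) $ p = (V *v h - v) $ p + (V *v e) $ p" for p
    by (simp add: e_def matrix_vector_mult_diff_distrib)
  have "(\<Sum>s\<in>UNIV. \<psi> s (norm (block s h'))) \<le> (\<Sum>s\<in>UNIV. \<psi> s (norm (block s h))
      + 1/2 * nu (\<psi> s) (norm (block s h)) * ((norm (block s h'))\<^sup>2 - (norm (block s h))\<^sup>2))"
    by (intro sum_mono mm_potential.tangent[OF potential]) auto
  also have "\<dots> = (\<Sum>s\<in>UNIV. \<psi> s (norm (block s h)))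
      + 1/2 * ((\<Sum>s\<in>UNIV. nu (\<psi> s) (norm (block s h)) * (block s h' \<bullet> block s h'))
        - (\<Sum>s\<in>UNIV. nu (\<psi> s) (norm (block s h)) * (block s h \<bullet> block s h)))"
    by (simp add: sum.distrib sum_subtractf right_diff_distrib sum_distrib_left power2_norm_eq_inner sum_divide_distrib diff_divide_distrib)
  also have "(\<Sum>s\<in>UNIV. nu (\<psi> s) (norm (block s h)) * (block s h' \<bullet> block s h'))
        - (\<Sum>s\<in>UNIV. nu (\<psi> s) (norm (block s h)) * (block s h \<bullet> block s h))
      = (\<Sum>p\<in>UNIV. 2 * (wt h $ p * (V *v e) $ p * (V *v h - v) $ p) + wt h $ p * (V *v e) $ p * (V *v e) $ p)"
    unfolding sum_blocks comp sum_subtractf[symmetric] by (intro sum.cong) (auto simp: algebra_simps)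
  also have "1/2 * \<dots> = (\<Sum>p\<in>UNIV. wt h $ p * (V *v e) $ p * (V *v h - v) $ p)
      + 1/2 * (\<Sum>p\<in>UNIV. wt h $ p * (V *v e) $ p * (V *v e) $ p)"
    unfolding sum.distrib sum_distrib_left[symmetric] by simp
  finally show ?thesis
    unfolding Psi_eq[of h] Psi_eq[of h'] inner_gradPsi inner_B e_def[symmetric]
    using quadratic_expansion[OF V0_sym, of h' h, folded e_def] by (simp add: e_def inner_diff_left inner_commute[of v0] algebra_simps)
qed

text \<open>Convexity bounds each block term from below by its tangent, while the full curvature of
  \<open>V0\<close> is kept: together with \<open>R\<close> it gives the positive definite matrix
  that makes the minimizer unique.\<close>

lemma Psi_convex_tangent:
  assumes conv: "\<And>s. convex_on UNIV (\<psi> s)"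
  shows "Psi h + gradPsi h \<bullet> (h' - h) + 1/2 * ((h' - h) \<bullet> (V0 *v (h' - h))) \<le> Psi h'"
proof -
  define e where "e = h' - h"
  have comp: "(V *v h' - v) $ p = (V *v h - v) $ p + (V *v e) $ p" for p
    by (simp add: e_def matrix_vector_mult_diff_distrib)
  have "(\<Sum>p\<in>UNIV. wt h $ p * (V *v e) $ p * (V *v h - v) $ p)
      = (\<Sum>s\<in>UNIV. nu (\<psi> s) (norm (block s h)) * (block s h \<bullet> block s h'))
        - (\<Sum>s\<in>UNIV. nu (\<psi> s) (norm (block s h)) * (block s h \<bullet> block s h))"
    unfolding sum_blocks comp sum_subtractf[symmetric] by (intro sum.cong) (auto simp: algebra_simps)
  moreover have "(\<Sum>s\<in>UNIV. \<psi> s (norm (block s h)) + nu (\<psi> s) (norm (block s h)) * (block s h \<bullet> (block s h' - block s h)))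
      \<le> (\<Sum>s\<in>UNIV. \<psi> s (norm (block s h')))"
    using nu_bounds by (intro sum_mono convex_potential_tangent[OF potential conv]) auto
  ultimately have "(\<Sum>s\<in>UNIV. \<psi> s (norm (block s h))) + (\<Sum>p\<in>UNIV. wt h $ p * (V *v e) $ p * (V *v h - v) $ p)
      \<le> (\<Sum>s\<in>UNIV. \<psi> s (norm (block s h')))"
    by (simp add: sum.distrib inner_diff_right right_diff_distrib sum_subtractf)
  then show ?thesis
    unfolding Psi_eq[of h] Psi_eq[of h'] inner_gradPsi e_def[symmetric]
    using quadratic_expansion[OF V0_sym, of h' h, folded e_def] by (simp add: e_def inner_diff_left inner_commute[of v0] algebra_simps)
qed

end

lemma norm_le_fst: "norm (fst x) \<le> norm x" and norm_le_snd: "norm (snd x) \<le> norm x"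
  by (cases x, simp add: norm_fst_le norm_snd_le)+

section \<open>The cost as a function of the second-order moments\<close>

context mm_regularizer
begin

text \<open>With \<open>\<zeta> = (\<rho>, r, R)\<close> the limiting moments, \<open>Fz \<zeta>\<close> is the cost \<open>F\<close>; with \<open>\<zeta>\<close> the empirical
  moments, it is \<open>F\<^sub>n\<close>.\<close>

definition Fz :: "real \<times> (real^'n) \<times> (real^'n^'n) \<Rightarrow> real^'n \<Rightarrow> real" where
  "Fz \<zeta> h = \<zeta> \<bullet> qvec h + Psi h"

definition Gz :: "real \<times> (real^'n) \<times> (real^'n^'n) \<Rightarrow> real^'n \<Rightarrow> real^'n" where
  "Gz \<zeta> h = snd (snd \<zeta>) *v h - fst (snd \<zeta>) + gradPsi h"

definition Az :: "real \<times> (real^'n) \<times> (real^'n^'n) \<Rightarrow> real^'n \<Rightarrow> real^'n^'n" where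
  "Az \<zeta> h = snd (snd \<zeta>) + B h"

lemma inner_qvec': "\<zeta> \<bullet> qvec h = 1/2 * fst \<zeta> - fst (snd \<zeta>) \<bullet> h + 1/2 * (h \<bullet> (snd (snd \<zeta>) *v h))"
  using inner_qvec[of "fst \<zeta>" "fst (snd \<zeta>)" "snd (snd \<zeta>)" h] by simp

lemma Az_mult: "Az \<zeta> h *v x = snd (snd \<zeta>) *v x + B h *v x"
  by (simp add: Az_def matrix_vector_mult_add_rdistrib)

lemma Gz_eq: "Gz \<zeta> h = Az \<zeta> h *v h - (fst (snd \<zeta>) + dvec h)"
  by (simp add: Gz_def gradPsi_def Az_mult)

lemma Az_sym: "transpose (snd (snd \<zeta>)) = snd (snd \<zeta>) \<Longrightarrow> transpose (Az \<zeta> h) = Az \<zeta> h"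
  using B_sym[of h] by (simp add: Az_def transpose_def Finite_Cartesian_Product.vec_eq_iff)

text \<open>The quadratic part is expanded exactly, so that the last bracket can be bounded from
  above by \<open>Psi_majorant\<close> or from below by \<open>Psi_convex_tangent\<close>.\<close>

lemma Fz_expansion:
  assumes "transpose (snd (snd \<zeta>)) = snd (snd \<zeta>)"
  shows "Fz \<zeta> h' = Fz \<zeta> h + Gz \<zeta> h \<bullet> (h' - h) + 1/2 * ((h' - h) \<bullet> (snd (snd \<zeta>) *v (h' - h)))
    + (Psi h' - Psi h - gradPsi h \<bullet> (h' - h))"
  using quadratic_expansion[OF assms, of h' h]
  by (simp add: Fz_def Gz_def inner_qvec' inner_diff_left inner_diff_right inner_add_left inner_add_right
      inner_commute algebra_simps)

lemma Fz_majorant: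
  assumes "transpose (snd (snd \<zeta>)) = snd (snd \<zeta>)"
  shows "Fz \<zeta> h' \<le> Fz \<zeta> h + Gz \<zeta> h \<bullet> (h' - h) + 1/2 * ((h' - h) \<bullet> (Az \<zeta> h *v (h' - h)))"
  using Fz_expansion[OF assms, of h' h] Psi_majorant[of h' h]
  by (simp add: Az_mult inner_add_right)

lemma isCont_Gz: "isCont (Gz \<zeta>) h"
  unfolding Gz_def[abs_def]
  by (intro continuous_add continuous_diff isCont_gradPsi continuous_const linear_continuous_at
      matrix_vector_mul_bounded_linear)

text \<open>The majorant holds at every base point with curvature bounded uniformly, and
  \<open>Gz \<zeta>\<close> is continuous, so \<open>GDERIV_quadratic_upper_bound\<close> applies
  and blocks of norm zero need no special treatment.\<close>

lemma GDERIV_Fz: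
  assumes "transpose (snd (snd \<zeta>)) = snd (snd \<zeta>)"
  shows "GDERIV (Fz \<zeta>) h :> Gz \<zeta> h"
proof -
  obtain \<beta> where \<beta>: "0 \<le> \<beta>" "\<And>h x. norm (B h *v x) \<le> \<beta> * norm x"
    by (rule B_bounded) blast
  have "Fz \<zeta> y \<le> Fz \<zeta> x + Gz \<zeta> x \<bullet> (y - x) + (norm (snd (snd \<zeta>)) + \<beta>) * (norm (y - x))\<^sup>2" for x y
  proof -
    define e where "e = y - x"
    have "e \<bullet> (B x *v e) \<le> norm e * (\<beta> * norm e)"
      using norm_cauchy_schwarz[of e "B x *v e"] mult_left_mono[OF \<beta>(2)[of x e], of "norm e"] by simp
    moreover have "e \<bullet> (snd (snd \<zeta>) *v e) \<le> norm (snd (snd \<zeta>)) * (norm e)\<^sup>2"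
      using quadratic_form_le[of e "snd (snd \<zeta>)"] by linarith
    ultimately have "e \<bullet> (Az \<zeta> x *v e) \<le> (norm (snd (snd \<zeta>)) + \<beta>) * (norm e)\<^sup>2"
      by (simp add: Az_mult inner_add_right power2_eq_square algebra_simps)
    moreover have "0 \<le> (norm (snd (snd \<zeta>)) + \<beta>) * (norm e)\<^sup>2"
      using \<beta> by simp
    ultimately show ?thesis
      using Fz_majorant[OF assms, of y x, folded e_def] unfolding e_def[symmetric] by linarith
  qed
  then show ?thesis
    by (rule GDERIV_quadratic_upper_bound[OF _ isCont_Gz]) (use \<beta>(1) in simp)
qed

section \<open>One step of the subspace algorithm\<close>

context
  fixes \<zeta> W h0 h1
  assumes sym: "transpose (snd (snd \<zeta>)) = snd (snd \<zeta>)"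
    and W: "subspace W" and h0: "h0 \<in> W"
    and min: "is_arg_min (\<lambda>g. quad_majorant (Fz \<zeta>) (Az \<zeta>) g h0) (\<lambda>g. g \<in> W) h1"
begin

lemma mm_step_orthogonal:
  assumes "w \<in> W" shows "(Gz \<zeta> h0 + Az \<zeta> h0 *v (h1 - h0)) \<bullet> w = 0"
  using min assms unfolding quad_majorant_def grad_eq[OF GDERIV_Fz[OF sym]]
  by (intro arg_min_quadratic_orthogonal[OF W _ Az_sym[OF sym]])

lemma mm_step_mem: "h1 \<in> W"
  using min by (simp add: is_arg_min_def)

text \<open>Both points lie in \<open>W\<close>, so optimality can be tested with
  \<open>h1 - h0\<close>: the linear term of the majorant is minus twice its quadratic term.\<close>

lemma mm_step_descent: "Fz \<zeta> h1 + 1/2 * ((h1 - h0) \<bullet> (Az \<zeta> h0 *v (h1 - h0))) \<le> Fz \<zeta> h0"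
proof -
  have "(Gz \<zeta> h0 + Az \<zeta> h0 *v (h1 - h0)) \<bullet> (h1 - h0) = 0"
    using W h0 mm_step_mem by (intro mm_step_orthogonal subspace_diff)
  then have "Gz \<zeta> h0 \<bullet> (h1 - h0) = - ((h1 - h0) \<bullet> (Az \<zeta> h0 *v (h1 - h0)))"
    unfolding inner_add_left inner_commute[of "Az \<zeta> h0 *v (h1 - h0)"] by linarith
  then show ?thesis
    using Fz_majorant[OF sym, of h1 h0] by simp
qed

text \<open>Optimality tested with \<open>h1\<close> itself, after writing the gradient of the
  majorant at \<open>h1\<close> as \<open>A h1 - c\<close>. The old point \<open>h0\<close> survives
  only in the weights.\<close>

lemma mm_step_size: "h1 \<bullet> (Az \<zeta> h0 *v h1) = (fst (snd \<zeta>) + dvec h0) \<bullet> h1"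
proof -
  have "Gz \<zeta> h0 + Az \<zeta> h0 *v (h1 - h0) = Az \<zeta> h0 *v h1 - (fst (snd \<zeta>) + dvec h0)"
    by (simp add: Gz_eq matrix_vector_mult_diff_distrib)
  then show ?thesis
    using mm_step_orthogonal[OF mm_step_mem] by (simp add: inner_diff_left inner_commute[of h1])
qed

lemma mm_step_gradient:
  assumes "Gz \<zeta> h0 \<in> W" shows "norm (Gz \<zeta> h0) \<le> norm (Az \<zeta> h0 *v (h1 - h0))"
proof (cases "Gz \<zeta> h0 = 0")
  case False
  have "Gz \<zeta> h0 \<bullet> Gz \<zeta> h0 = (- (Az \<zeta> h0 *v (h1 - h0))) \<bullet> Gz \<zeta> h0"
    using mm_step_orthogonal[OF assms] by (simp add: inner_add_left)
  also have "\<dots> \<le> norm (Az \<zeta> h0 *v (h1 - h0)) * norm (Gz \<zeta> h0)"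
    using norm_cauchy_schwarz[of "- (Az \<zeta> h0 *v (h1 - h0))"] by simp
  finally show ?thesis
    using False by (simp add: dot_square_norm power2_eq_square)
qed simp

end

context
  fixes \<mu> :: "real \<times> (real^'n) \<times> (real^'n^'n)" and \<epsilon> :: real
  assumes \<mu>_sym: "transpose (snd (snd \<mu>)) = snd (snd \<mu>)"
    and \<epsilon>: "0 < \<epsilon>" and coercive: "\<And>x. 2 * \<epsilon> * (norm x)\<^sup>2 \<le> x \<bullet> ((snd (snd \<mu>) + V0) *v x)"
begin

text \<open>The margin is \<open>2 * \<epsilon>\<close> at \<open>\<mu>\<close>; a perturbation of
  the moments by at most \<open>\<epsilon>\<close> uses up one half of it, and the weighted part of
  \<open>B h\<close> only helps.\<close>

lemma Az_coercive:
  assumes "norm (\<zeta> - \<mu>) \<le> \<epsilon>"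
  shows "\<epsilon> * (norm x)\<^sup>2 \<le> x \<bullet> (Az \<zeta> h *v x)"
proof -
  have "norm (snd (snd (\<zeta> - \<mu>))) \<le> \<epsilon>"
    using norm_le_snd norm_le_snd assms by (meson order_trans)
  then have "norm (snd (snd (\<zeta> - \<mu>))) * (norm x)\<^sup>2 \<le> \<epsilon> * (norm x)\<^sup>2"
    by (rule mult_right_mono) simp
  moreover have "- (norm (snd (snd (\<zeta> - \<mu>))) * (norm x)\<^sup>2) \<le> x \<bullet> (snd (snd (\<zeta> - \<mu>)) *v x)"
    using quadratic_form_le[of x "snd (snd (\<zeta> - \<mu>))"] by linarith
  moreover have "x \<bullet> (snd (snd (\<zeta> - \<mu>)) *v x) = x \<bullet> (snd (snd \<zeta>) *v x) - x \<bullet> (snd (snd \<mu>) *v x)"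
    by (simp add: matrix_vector_mult_diff_rdistrib inner_diff_right)
  ultimately show ?thesis
    using coercive[of x] B_ge_V0[of x h]
    by (simp add: Az_mult matrix_vector_mult_add_rdistrib inner_add_right)
qed

text \<open>Coercivity and the bound on \<open>dvec\<close> do not depend on \<open>h0\<close>, so
  the new point is bounded whatever the old one was, and boundedness of a path requires no
  induction.\<close>

lemma mm_step_bounded:
  assumes \<zeta>: "norm (\<zeta> - \<mu>) \<le> \<epsilon>" and sym: "transpose (snd (snd \<zeta>)) = snd (snd \<zeta>)"
    and W: "subspace W" and h0: "h0 \<in> W"
    and min: "is_arg_min (\<lambda>g. quad_majorant (Fz \<zeta>) (Az \<zeta>) g h0) (\<lambda>g. g \<in> W) h1"
    and \<beta>: "\<And>h. norm (dvec h) \<le> \<beta>"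
  shows "norm h1 \<le> (norm \<mu> + \<epsilon> + \<beta>) / \<epsilon>"
proof (cases "h1 = 0")
  case False
  have "norm (fst (snd \<zeta>)) \<le> norm \<zeta>"
    using norm_le_fst norm_le_snd by (rule order_trans)
  then have b: "norm (fst (snd \<zeta>) + dvec h0) \<le> norm \<mu> + \<epsilon> + \<beta>"
    using norm_triangle_ineq[of "fst (snd \<zeta>)" "dvec h0"] norm_triangle_sub[of \<zeta> \<mu>] \<zeta> \<beta>[of h0] by linarith
  have "\<epsilon> * (norm h1)\<^sup>2 \<le> (fst (snd \<zeta>) + dvec h0) \<bullet> h1"
    using Az_coercive[OF \<zeta>, of h1 h0] mm_step_size[OF sym W h0 min] by simp
  also have "\<dots> \<le> (norm \<mu> + \<epsilon> + \<beta>) * norm h1"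
    using norm_cauchy_schwarz[of "fst (snd \<zeta>) + dvec h0" h1] mult_right_mono[OF b, of "norm h1"] by simp
  finally have "\<epsilon> * norm h1 \<le> norm \<mu> + \<epsilon> + \<beta>"
    using False by (simp add: power2_eq_square)
  then show ?thesis
    using \<epsilon> by (simp add: field_simps)
next
  case True
  have "0 \<le> \<beta>" using \<beta>[of 0] norm_ge_zero order_trans by blast
  then show ?thesis using True \<epsilon> by simp
qed

section \<open>Deterministic behaviour of a path with converging moments\<close>

context
  fixes \<zeta> :: "nat \<Rightarrow> real \<times> (real^'n) \<times> (real^'n^'n)" and W :: "nat \<Rightarrow> (real^'n) set" and h :: "nat \<Rightarrow> real^'n"
  assumes lim: "\<zeta> \<longlonglongrightarrow> \<mu>"
    and \<zeta>_sym: "\<And>n. 1 \<le> n \<Longrightarrow> transpose (snd (snd (\<zeta> n))) = snd (snd (\<zeta> n))"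
    and W: "\<And>n. 1 \<le> n \<Longrightarrow> subspace (W n)"
    and mem: "\<And>n. 1 \<le> n \<Longrightarrow> h n \<in> W n"
    and min: "\<And>n. 1 \<le> n \<Longrightarrow>
      is_arg_min (\<lambda>g. quad_majorant (Fz (\<zeta> n)) (Az (\<zeta> n)) g (h n)) (\<lambda>g. g \<in> W n) (h (Suc n))"
begin

lemma mm_path_near: obtains N where "1 \<le> N" "\<And>n. N \<le> n \<Longrightarrow> norm (\<zeta> n - \<mu>) \<le> \<epsilon>"
proof -
  obtain N where "\<And>n. N \<le> n \<Longrightarrow> norm (\<zeta> n - \<mu>) < \<epsilon>"
    using LIMSEQ_D[OF lim \<epsilon>] by blast
  then show thesis
    by (intro that[of "max 1 N"]) (auto intro: less_imp_le)
qed

lemma mm_path_bounded: "bounded (range h)"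
proof -
  obtain N where N: "1 \<le> N" "\<And>n. N \<le> n \<Longrightarrow> norm (\<zeta> n - \<mu>) \<le> \<epsilon>"
    by (rule mm_path_near) blast
  obtain \<beta> where \<beta>: "0 \<le> \<beta>" "\<And>h. norm (dvec h) \<le> \<beta>"
    by (rule dvec_bounded) blast
  define K where "K = (norm \<mu> + \<epsilon> + \<beta>) / \<epsilon>"
  have K: "norm (h (Suc n)) \<le> K" if "N \<le> n" for n
    unfolding K_def using that N \<beta>(2)
    by (intro mm_step_bounded[OF N(2)[OF that] \<zeta>_sym W mem min]) auto
  have "range h \<subseteq> h ` {..N} \<union> cball 0 K"
  proof
    fix x assume "x \<in> range h"
    then obtain n where "x = h n" by auto
    then show "x \<in> h ` {..N} \<union> cball 0 K"
      using K[of "n - 1"] by (cases "n \<le> N") auto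
  qed
  moreover have "bounded (h ` {..N} \<union> cball 0 K)"
    by (simp add: finite_imp_bounded)
  ultimately show ?thesis
    using bounded_subset by blast
qed

text \<open>\<open>mm_step_gradient\<close> bounds \<open>Gz (\<zeta> n) (h n)\<close> by the step,
  with matrices that stay bounded, so it tends to 0. Along a subsequence converging to
  \<open>c\<close> it also tends to \<open>Gz \<mu> c\<close>, by continuity in the moments and in
  the point.\<close>

lemma mm_path_critical:
  assumes steps: "(\<lambda>n. h (Suc n) - h n) \<longlonglongrightarrow> 0"
    and grads: "\<And>n. 1 \<le> n \<Longrightarrow> Gz (\<zeta> n) (h n) \<in> W n"
    and c: "c \<in> cluster_points h"
  shows "GDERIV (Fz \<mu>) c :> 0"
proof -
  obtain \<beta> where \<beta>: "0 \<le> \<beta>" "\<And>h x. norm (B h *v x) \<le> \<beta> * norm x"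
    by (rule B_bounded) blast
  let ?e = "\<lambda>n. h (Suc n) - h n"
  have R: "(\<lambda>n. snd (snd (\<zeta> n))) \<longlonglongrightarrow> snd (snd \<mu>)" and r: "(\<lambda>n. fst (snd (\<zeta> n))) \<longlonglongrightarrow> fst (snd \<mu>)"
    using lim by (auto intro!: tendsto_intros)
  have "(\<lambda>n. norm (snd (snd (\<zeta> n)) *v ?e n) + \<beta> * norm (?e n)) \<longlonglongrightarrow> norm (snd (snd \<mu>) *v 0) + \<beta> * norm (0 :: real^'n)"
    by (intro tendsto_intros bounded_bilinear.tendsto[OF bounded_bilinear_matrix_vector] R steps)
  then have bound: "(\<lambda>n. norm (snd (snd (\<zeta> n)) *v ?e n) + \<beta> * norm (?e n)) \<longlonglongrightarrow> 0"
    by simp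
  have "norm (Gz (\<zeta> n) (h n)) \<le> norm (snd (snd (\<zeta> n)) *v ?e n) + \<beta> * norm (?e n)" if "1 \<le> n" for n
  proof -
    have "norm (Gz (\<zeta> n) (h n)) \<le> norm (Az (\<zeta> n) (h n) *v ?e n)"
      using that by (intro mm_step_gradient[OF \<zeta>_sym W mem min grads])
    also have "\<dots> \<le> norm (snd (snd (\<zeta> n)) *v ?e n) + \<beta> * norm (?e n)"
      unfolding Az_mult using norm_triangle_ineq \<beta>(2) by (rule order_trans[OF _ add_left_mono])
    finally show ?thesis .
  qed
  then have "(\<lambda>n. norm (Gz (\<zeta> n) (h n))) \<longlonglongrightarrow> 0"
    by (intro tendsto_sandwich[OF _ _ tendsto_const bound]) (auto simp: eventually_sequentially)
  then have G: "(\<lambda>n. Gz (\<zeta> n) (h n)) \<longlonglongrightarrow> 0"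
    by (rule tendsto_norm_zero_cancel)
  obtain \<sigma> where \<sigma>: "strict_mono \<sigma>" "(h \<circ> \<sigma>) \<longlonglongrightarrow> c"
    using c unfolding cluster_points_def by blast
  have h\<sigma>: "(\<lambda>k. h (\<sigma> k)) \<longlonglongrightarrow> c"
    using \<sigma>(2) by (simp only: o_def)
  have R\<sigma>: "(\<lambda>k. snd (snd (\<zeta> (\<sigma> k)))) \<longlonglongrightarrow> snd (snd \<mu>)" and r\<sigma>: "(\<lambda>k. fst (snd (\<zeta> (\<sigma> k)))) \<longlonglongrightarrow> fst (snd \<mu>)"
    using LIMSEQ_subseq_LIMSEQ[OF R \<sigma>(1)] LIMSEQ_subseq_LIMSEQ[OF r \<sigma>(1)] by (simp_all only: o_def)
  have "(\<lambda>k. Gz (\<zeta> (\<sigma> k)) (h (\<sigma> k))) \<longlonglongrightarrow> Gz \<mu> c"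
    unfolding Gz_def
    by (intro tendsto_intros bounded_bilinear.tendsto[OF bounded_bilinear_matrix_vector] R\<sigma> r\<sigma> h\<sigma>
        isCont_tendsto_compose[OF isCont_gradPsi])
  moreover have "(\<lambda>k. Gz (\<zeta> (\<sigma> k)) (h (\<sigma> k))) \<longlonglongrightarrow> 0"
    using LIMSEQ_subseq_LIMSEQ[OF G \<sigma>(1)] by (simp only: o_def)
  ultimately have "Gz \<mu> c = 0"
    by (rule LIMSEQ_unique)
  then show ?thesis
    using GDERIV_Fz[OF \<mu>_sym, of c] by simp
qed

end

text \<open>At a critical point the expansion and the convex tangent bound leave half of the
  quadratic form of \<open>R + V0\<close>, which is at least
  \<open>\<epsilon> * (norm (h - c))\<^sup>2\<close>.\<close>

lemma critical_strict_minimum: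
  assumes conv: "\<And>s. convex_on UNIV (\<psi> s)" and crit: "GDERIV (Fz \<mu>) c :> 0" and "h \<noteq> c"
  shows "Fz \<mu> c < Fz \<mu> h"
proof -
  have "Gz \<mu> c = 0"
    using GDERIV_unique[OF GDERIV_Fz[OF \<mu>_sym] crit] .
  then have "Fz \<mu> c + 1/2 * ((h - c) \<bullet> (snd (snd \<mu>) *v (h - c))) + 1/2 * ((h - c) \<bullet> (V0 *v (h - c))) \<le> Fz \<mu> h"
    using Fz_expansion[OF \<mu>_sym, of h c] Psi_convex_tangent[OF conv, of c h] by simp
  moreover have "0 < \<epsilon> * (norm (h - c))\<^sup>2"
    using \<epsilon> \<open>h \<noteq> c\<close> by simp
  ultimately show ?thesis
    using coercive[of "h - c"] by (simp add: matrix_vector_mult_add_rdistrib inner_add_right)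
qed

end

end

section \<open>Moments of the data\<close>

lemma bounded_bilinear_matrix_matrix:
  "bounded_bilinear ((**) :: real^'n^'m \<Rightarrow> real^'k^'n \<Rightarrow> real^'k^'m)"
proof -
  have "bilinear ((**) :: real^'n^'m \<Rightarrow> real^'k^'n \<Rightarrow> real^'k^'m)"
    unfolding bilinear_def
    by (auto intro!: linearI simp: matrix_matrix_mult_def Finite_Cartesian_Product.vec_eq_iff
        sum.distrib distrib_left distrib_right sum_distrib_left mult_ac)
  then show ?thesis
    by (simp add: bilinear_conv_bounded_bilinear)
qed

lemma bounded_linear_transpose: "bounded_linear (transpose :: real^'n^'m \<Rightarrow> real^'m^'n)"
  by (rule linear_conv_bounded_linear[THEN iffD1])
     (auto intro!: linearI simp: transpose_def Finite_Cartesian_Product.vec_eq_iff)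

definition moments :: "real^'q^'n \<Rightarrow> real^'q \<Rightarrow> real \<times> (real^'n) \<times> (real^'n^'n)" where
  "moments X y = ((norm y)\<^sup>2, X *v y, X ** transpose X)"

text \<open>The moments are quadratic in \<open>(X, y)\<close>, so their squared norm has quartic
  growth: this is where the fourth-order moments of the data enter.\<close>

lemma norm_moments_le:
  obtains K where "0 \<le> K"
    "\<And>(X :: real^'q^'n) y. (norm (moments X y))\<^sup>2 \<le> K * (norm X ^ 4 + norm y ^ 4)"
proof -
  obtain K1 where K1: "0 < K1" "\<And>(X :: real^'q^'n) y. norm (X *v y) \<le> norm X * norm y * K1"
    using bounded_bilinear.pos_bounded[OF bounded_bilinear_matrix_vector] by blast
  obtain K2 where K2: "0 < K2" "\<And>(X :: real^'q^'n) (Y :: real^'n^'q). norm (X ** Y) \<le> norm X * norm Y * K2"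
    using bounded_bilinear.pos_bounded[OF bounded_bilinear_matrix_matrix] by blast
  obtain K3 where K3: "0 < K3" "\<And>(X :: real^'q^'n). norm (transpose X) \<le> norm X * K3"
    using bounded_linear.pos_bounded[OF bounded_linear_transpose] by blast
  define K where "K = 1 + K1 + K3 * K2"
  have K: "0 \<le> K" using K1 K2 K3 by (simp add: K_def)
  have le: "norm (moments X y) \<le> K * ((norm X)\<^sup>2 + (norm y)\<^sup>2)" for X :: "real^'q^'n" and y
  proof -
    have "norm X * norm y \<le> (norm X)\<^sup>2 + (norm y)\<^sup>2"
    proof -
      have "2 * (norm X * norm y) \<le> (norm X)\<^sup>2 + (norm y)\<^sup>2"
        using sum_squares_bound[of "norm X" "norm y"] by simp
      moreover have "0 \<le> norm X * norm y" by simp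
      ultimately show ?thesis by linarith
    qed
    then have "norm (X *v y) \<le> ((norm X)\<^sup>2 + (norm y)\<^sup>2) * K1"
      using K1(2)[of X y] K1(1) by (meson mult_right_mono less_imp_le order_trans)
    moreover have "norm (X ** transpose X) \<le> ((norm X)\<^sup>2 + (norm y)\<^sup>2) * (K3 * K2)"
    proof -
      have "norm (X ** transpose X) \<le> norm X * (norm X * K3) * K2"
        using K2(2)[of X "transpose X"] mult_right_mono[OF mult_left_mono[OF K3(2)[of X], of "norm X"], of K2] K2(1)
        by simp
      also have "\<dots> = (norm X)\<^sup>2 * (K3 * K2)"
        by (simp add: power2_eq_square)
      also have "\<dots> \<le> ((norm X)\<^sup>2 + (norm y)\<^sup>2) * (K3 * K2)"
        using K2(1) K3(1) by (intro mult_right_mono) auto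
      finally show ?thesis .
    qed
    moreover have "norm (moments X y) \<le> (norm y)\<^sup>2 + (norm (X *v y) + norm (X ** transpose X))"
      unfolding moments_def
      using norm_Pair_le[of "(norm y)\<^sup>2" "(X *v y, X ** transpose X)"] norm_Pair_le[of "X *v y" "X ** transpose X"]
      by simp
    moreover have "(norm y)\<^sup>2 \<le> (norm X)\<^sup>2 + (norm y)\<^sup>2"
      by simp
    moreover have "K * ((norm X)\<^sup>2 + (norm y)\<^sup>2) = ((norm X)\<^sup>2 + (norm y)\<^sup>2)
        + ((norm X)\<^sup>2 + (norm y)\<^sup>2) * K1 + ((norm X)\<^sup>2 + (norm y)\<^sup>2) * (K3 * K2)"
      by (simp add: K_def algebra_simps)
    ultimately show ?thesis
      by linarith
  qed
  have "(norm (moments X y))\<^sup>2 \<le> (2 * K\<^sup>2) * (norm X ^ 4 + norm y ^ 4)" for X :: "real^'q^'n" and y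
  proof -
    have "(norm (moments X y))\<^sup>2 \<le> (K * ((norm X)\<^sup>2 + (norm y)\<^sup>2))\<^sup>2"
      using le by (rule power_mono) simp
    also have "\<dots> = K\<^sup>2 * ((norm X)\<^sup>2 + (norm y)\<^sup>2)\<^sup>2"
      by (simp add: power_mult_distrib)
    also have "\<dots> \<le> K\<^sup>2 * (2 * (norm X ^ 4 + norm y ^ 4))"
      using sum_squares_bound[of "(norm X)\<^sup>2" "(norm y)\<^sup>2"]
      by (intro mult_left_mono) (auto simp: power2_sum simp flip: power_mult)
    finally show ?thesis by (simp add: algebra_simps)
  qed
  then show thesis
    using that[of "2 * K\<^sup>2"] by simp
qed

lemma borel_measurable_moments: "(\<lambda>(X, y). moments X y) \<in> borel_measurable (borel :: ((real^'q^'n) \<times> (real^'q)) measure)"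
proof -
  have "continuous_on UNIV (\<lambda>p :: (real^'q^'n) \<times> (real^'q). moments (fst p) (snd p))"
    unfolding moments_def
    by (intro continuous_intros bounded_bilinear.continuous_on[OF bounded_bilinear_matrix_vector]
        bounded_bilinear.continuous_on[OF bounded_bilinear_matrix_matrix]
        bounded_linear.continuous_on[OF bounded_linear_transpose])
  then show ?thesis
    by (simp add: borel_measurable_continuous_onI case_prod_unfold)
qed

lemma residual_eq: "(norm (y - transpose X *v h))\<^sup>2 = 2 * (moments X y \<bullet> qvec h)"
proof -
  have 1: "(transpose X *v h) \<bullet> y = (X *v y) \<bullet> h"
    by (metis dot_lmul_matrix inner_commute transpose_matrix_vector)
  have 2: "(transpose X *v h) \<bullet> (transpose X *v h) = h \<bullet> ((X ** transpose X) *v h)"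
    by (metis dot_lmul_matrix matrix_vector_mul_assoc transpose_matrix_vector)
  have "(norm (y - transpose X *v h))\<^sup>2
      = (norm y)\<^sup>2 - 2 * ((transpose X *v h) \<bullet> y) + (transpose X *v h) \<bullet> (transpose X *v h)"
    unfolding power2_norm_eq_inner
    using inner_commute[of y "transpose X *v h"]
    by (simp add: inner_diff_left inner_diff_right del: transpose_matrix_vector)
  then show ?thesis
    unfolding 1 2 moments_def inner_qvec by simp
qed

text \<open>Cauchy-Schwarz for the sum of squared components, with factor \<open>DIM('e)\<close>,
  reduces the norm to single entries.\<close>

lemma integrable_norm_pow4:
  fixes f :: "'a \<Rightarrow> 'e::euclidean_space"
  assumes meas: "f \<in> borel_measurable M" and int: "\<And>b. b \<in> Basis \<Longrightarrow> integrable M (\<lambda>\<omega>. (f \<omega> \<bullet> b) ^ 4)"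
  shows "integrable M (\<lambda>\<omega>. norm (f \<omega>) ^ 4)"
proof (rule Bochner_Integration.integrable_bound)
  show "integrable M (\<lambda>\<omega>. DIM('e) * (\<Sum>b\<in>Basis. (f \<omega> \<bullet> b) ^ 4))"
    using int by (intro integrable_mult_right Bochner_Integration.integrable_sum) auto
  show "(\<lambda>\<omega>. norm (f \<omega>) ^ 4) \<in> borel_measurable M"
    using meas by measurable
  have "norm (f \<omega>) ^ 4 \<le> DIM('e) * (\<Sum>b\<in>Basis. (f \<omega> \<bullet> b) ^ 4)" for \<omega>
  proof -
    have "(norm (f \<omega>))\<^sup>2 = (\<Sum>b\<in>Basis. (f \<omega> \<bullet> b)\<^sup>2)"
      unfolding power2_norm_eq_inner euclidean_inner[of "f \<omega>" "f \<omega>"] by (simp add: power2_eq_square)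
    then have "norm (f \<omega>) ^ 4 = (\<Sum>b\<in>Basis. (f \<omega> \<bullet> b)\<^sup>2)\<^sup>2"
      by (metis mult_2 numeral_Bit0 power_even_eq power_mult)
    also have "\<dots> \<le> (\<Sum>b\<in>Basis. ((f \<omega> \<bullet> b)\<^sup>2)\<^sup>2) * DIM('e)"
      by (rule sum_squared_le_sum_of_squares)
    finally show ?thesis
      by (simp add: mult.commute flip: power_mult)
  qed
  then show "AE \<omega> in M. norm (norm (f \<omega>) ^ 4) \<le> norm (DIM('e) * (\<Sum>b\<in>Basis. (f \<omega> \<bullet> b) ^ 4))"
    by (intro always_eventually) (auto intro: order_trans[OF _ abs_ge_self])
qed

section \<open>Stationarity and the filtration generated by the data\<close>

lemma stationary_seq_integral:
  fixes Z :: "nat \<Rightarrow> 'a \<Rightarrow> 'z::topological_space" and g :: "'z \<Rightarrow> real"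
  assumes st: "stationary_seq M Z" and Z: "\<And>k. Z k \<in> borel_measurable M" and g: "g \<in> borel_measurable borel"
  shows "(\<integral>\<omega>. g (Z k \<omega>) \<partial>M) = (\<integral>\<omega>. g (Z 0 \<omega>) \<partial>M)"
proof (induction k)
  case (Suc k)
  have comp: "(\<lambda>x. g (x k)) \<in> borel_measurable (PiM UNIV (\<lambda>_::nat. borel :: 'z measure))"
    using g by measurable
  have path: "(\<lambda>\<omega> k. Y k \<omega>) \<in> measurable M (PiM UNIV (\<lambda>_::nat. borel))"
    if "\<And>k. Y k \<in> borel_measurable M" for Y :: "nat \<Rightarrow> 'a \<Rightarrow> 'z"
    using that by (intro measurable_PiM_single') auto
  have law: "(\<integral>x. g (x k) \<partial>path_law M Y) = (\<integral>\<omega>. g (Y k \<omega>) \<partial>M)"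
    if "\<And>k. Y k \<in> borel_measurable M" for Y
    unfolding path_law_def by (rule integral_distr[OF path comp]) fact
  \<comment> \<open>Coordinate \<open>k\<close> of the shifted path is coordinate
    \<open>Suc k\<close> of the original one, and both paths have the same law.\<close>
  have "(\<integral>\<omega>. g (Z (Suc k) \<omega>) \<partial>M) = (\<integral>\<omega>. g (Z k \<omega>) \<partial>M)"
    using law[of "\<lambda>k. Z (Suc k)"] law[of Z] Z st by (simp add: stationary_seq_def)
  with Suc show ?case by simp
qed simp

lemma space_history: "space (history M Z n) = space M"
  unfolding history_def by (intro space_measure_of) auto

lemma measurable_history:
  fixes Z :: "nat \<Rightarrow> 'a \<Rightarrow> 'z::topological_space"
  assumes "1 \<le> k" "k \<le> n"
  shows "Z k \<in> borel_measurable (history M Z n)"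
proof (rule measurableI)
  fix B :: "'z set" assume "B \<in> sets borel"
  then have "Z k -` B \<inter> space M \<in> {Z k -` B \<inter> space M | k B. k \<in> {1..n} \<and> B \<in> sets borel}"
    using assms by auto
  then show "Z k -` B \<inter> space (history M Z n) \<in> sets (history M Z n)"
    unfolding space_history unfolding history_def by (subst sets_measure_of) auto
qed simp

lemma subalgebra_history:
  fixes Z :: "nat \<Rightarrow> 'a \<Rightarrow> 'z::topological_space"
  assumes "\<And>k. 1 \<le> k \<Longrightarrow> Z k \<in> borel_measurable M"
  shows "subalgebra M (history M Z n)"
  unfolding subalgebra_def space_history
proof safe
  fix A assume "A \<in> sets (history M Z n)"
  then have "A \<in> sigma_sets (space M) {Z k -` B \<inter> space M | k B. k \<in> {1..n} \<and> B \<in> sets borel}"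
    unfolding history_def by (subst (asm) sets_measure_of) auto
  then show "A \<in> sets M"
    by (rule sets.sigma_sets_subset[THEN subsetD, rotated])
       (use assms in \<open>auto intro: measurable_sets\<close>)
qed

lemma subalgebra_history_Suc: "subalgebra (history M Z (Suc n)) (history M Z n)"
  unfolding subalgebra_def space_history
proof (intro conjI refl)
  have "{Z k -` B \<inter> space M | k B. k \<in> {1..n} \<and> B \<in> sets borel}
      \<subseteq> {Z k -` B \<inter> space M | k B. k \<in> {1..Suc n} \<and> B \<in> sets borel}"
    by (intro Collect_mono impI, elim exE conjE, intro exI conjI) auto
  then show "sets (history M Z n) \<subseteq> sets (history M Z (Suc n))"
    unfolding history_def
    by (subst (1 2) sets_measure_of) (auto intro!: sigma_sets_mono')
qed

section \<open>Measurability of the update\<close>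

lemma (in mm_regularizer) borel_measurable_wt:
  assumes "g \<in> borel_measurable N" shows "(\<lambda>\<omega>. wt (g \<omega>) $ p) \<in> borel_measurable N"
  using measurable_compose[OF assms borel_measurable_continuous_onI[OF continuous_on_wt]] by simp

lemma (in mm_regularizer) continuous_on_Psi: "continuous_on S Psi"
proof -
  have c: "continuous_on UNIV (\<psi> s)" for s
    using mm_potential.isCont_self[OF potential] by (simp add: continuous_at_imp_continuous_on)
  have n: "continuous_on S (block_norm V v blk s)" for s
    unfolding block_norm_def L2_set_def by (intro continuous_intros)
  show ?thesis
    unfolding regularizer_def by (intro continuous_intros continuous_on_compose2[OF c n]) auto
qed

lemma (in mm_regularizer) borel_measurable_mm_update:
  assumes \<zeta>: "\<zeta> \<in> borel_measurable N" and g: "g \<in> borel_measurable N"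
    and d: "\<And>j. j < m \<Longrightarrow> (\<lambda>\<omega>. d \<omega> j) \<in> borel_measurable N"
    and sym: "\<And>\<omega>. transpose (snd (snd (\<zeta> \<omega>))) = snd (snd (\<zeta> \<omega>))"
  shows "(\<lambda>\<omega>. subspace_step m (d \<omega>) (Az (\<zeta> \<omega>) (g \<omega>)) (fst (snd (\<zeta> \<omega>)) + dvec (g \<omega>))) \<in> borel_measurable N"
proof (rule borel_measurable_subspace_step)
  have R: "(\<lambda>\<omega>. snd (snd (\<zeta> \<omega>))) \<in> borel_measurable N" and r: "(\<lambda>\<omega>. fst (snd (\<zeta> \<omega>))) \<in> borel_measurable N"
    using \<zeta> by (auto intro!: borel_measurable_continuous_onI[THEN measurable_compose[OF \<zeta>]] continuous_intros)
  have mv: "(\<lambda>\<omega>. M *v d \<omega> j) \<in> borel_measurable N" if "j < m" for j and M :: "real^'n^'k::finite"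
    by (intro borel_measurable_matrix_vector d that borel_measurable_const)
  have comp: "(\<lambda>\<omega>. (V *v d \<omega> j) $ p) \<in> borel_measurable N" if "j < m" for j p
    by (rule measurable_compose[OF mv[OF that]]) (intro borel_measurable_continuous_onI continuous_intros)
  fix i j assume ij: "i < m" "j < m"
  show "(\<lambda>\<omega>. d \<omega> i \<bullet> (Az (\<zeta> \<omega>) (g \<omega>) *v d \<omega> j)) \<in> borel_measurable N"
    unfolding Az_mult inner_add_right inner_B using ij
    by (intro borel_measurable_add borel_measurable_inner borel_measurable_sum borel_measurable_times
        borel_measurable_matrix_vector R d mv comp borel_measurable_wt g)
next
  have r: "(\<lambda>\<omega>. fst (snd (\<zeta> \<omega>))) \<in> borel_measurable N"
    using \<zeta> by (auto intro!: borel_measurable_continuous_onI[THEN measurable_compose[OF \<zeta>]] continuous_intros)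
  fix i assume i: "i < m"
  have comp: "(\<lambda>\<omega>. (V *v d \<omega> i) $ p) \<in> borel_measurable N" for p
    by (rule measurable_compose[OF borel_measurable_matrix_vector[OF borel_measurable_const d[OF i]]])
       (intro borel_measurable_continuous_onI continuous_intros)
  show "(\<lambda>\<omega>. d \<omega> i \<bullet> (fst (snd (\<zeta> \<omega>)) + dvec (g \<omega>))) \<in> borel_measurable N"
    unfolding inner_add_right inner_dvec
    by (intro borel_measurable_add borel_measurable_inner borel_measurable_sum borel_measurable_times
        r d i comp borel_measurable_wt g borel_measurable_const)
qed (use d Az_sym[OF sym] in auto)

section \<open>Convergence of the algorithm\<close>

theorem proposition2:
  fixes M :: "'a measure"
    and X :: "nat \<Rightarrow> 'a \<Rightarrow> real^'q^'n" and y :: "nat \<Rightarrow> 'a \<Rightarrow> real^'q"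
    and \<rho> :: real and r :: "real^'n" and R :: "real^'n^'n"
    and \<psi> :: "'s::finite \<Rightarrow> real \<Rightarrow> real"
    and V0 :: "real^'n^'n" and v0 :: "real^'n"
    and V :: "real^'n^'p" and v :: "real^'p" and blk :: "'p \<Rightarrow> 's"
    and m :: "nat \<Rightarrow> nat" and D :: "nat \<Rightarrow> 'a \<Rightarrow> nat \<Rightarrow> real^'n"
    and h :: "nat \<Rightarrow> 'a \<Rightarrow> real^'n"
  defines "\<Psi> \<equiv> regularizer \<psi> V0 v0 V v blk"
  defines "F \<equiv> cost M X y \<Psi>"
    and "Fn \<equiv> emp_cost X y \<Psi>"
    and "A \<equiv> maj_A X \<psi> V0 V v blk"
    and "c \<equiv> maj_c X y \<psi> v0 V v blk"
  defines "\<Theta> \<equiv> (\<lambda>n \<omega>. quad_majorant (Fn n \<omega>) (A n \<omega>))"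
    and "\<X> \<equiv> history M (\<lambda>k \<omega>. (X k \<omega>, y k \<omega>))"
  assumes prob: "prob_space M"
    and X_meas: "\<And>n. 1 \<le> n \<Longrightarrow> X n \<in> borel_measurable M"
    and y_meas: "\<And>n. 1 \<le> n \<Longrightarrow> y n \<in> borel_measurable M"
    and E_rho: "\<And>n. 1 \<le> n \<Longrightarrow> has_bochner_integral M (\<lambda>\<omega>. (norm (y n \<omega>))\<^sup>2) \<rho>"
    and E_r: "\<And>n. 1 \<le> n \<Longrightarrow> has_bochner_integral M (\<lambda>\<omega>. X n \<omega> *v y n \<omega>) r"
    and E_R: "\<And>n. 1 \<le> n \<Longrightarrow> has_bochner_integral M (\<lambda>\<omega>. X n \<omega> ** transpose (X n \<omega>)) R"
    and rho_pos: "0 < \<rho>"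
    and R_psd: "sym_psd R"
    and V0_psd: "sym_psd V0"
    and h_meas: "\<And>n. 1 \<le> n \<Longrightarrow> h n \<in> borel_measurable M"
    and argmin: "\<And>n. 1 \<le> n \<Longrightarrow> AE \<omega> in M.
           is_arg_min (\<lambda>g. \<Theta> n \<omega> g (h n \<omega>)) (\<lambda>g. g \<in> ran_cols (m n) (D n \<omega>)) (h (Suc n) \<omega>)"
    and step: "\<And>n. 1 \<le> n \<Longrightarrow> AE \<omega> in M.
           h (Suc n) \<omega> = subspace_step (m n) (D n \<omega>) (A n \<omega> (h n \<omega>)) (c n \<omega> (h n \<omega>))"
    and A1a_even: "\<And>s t. \<psi> s (- t) = \<psi> s t"
    and A1a_bdd: "\<And>s. bdd_below (range (\<psi> s))"
    and A1a_C1: "\<And>s. \<psi> s C1_differentiable_on UNIV"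
    and A1a_lim: "\<And>s. \<exists>l. ((\<lambda>t. deriv (\<psi> s) t / t) \<longlongrightarrow> l) (at 0)"
    and A1b: "\<And>s. concave_on {0..} (\<lambda>t. \<psi> s (sqrt t))"
    and A1c: "\<exists>\<nu>max\<ge>0. \<forall>s. \<forall>t\<ge>0. 0 \<le> nu (\<psi> s) t \<and> nu (\<psi> s) t \<le> \<nu>max"
    and A2: "\<And>n. 1 \<le> n \<Longrightarrow> AE \<omega> in M.
           {grad (Fn n \<omega>) (h n \<omega>), h n \<omega>} \<subseteq> ran_cols (m n) (D n \<omega>)"
    and A3a: "sym_pd (R + V0)"
    and A3b_stat: "stationary_seq M (\<lambda>k \<omega>. (X (Suc k) \<omega>, y (Suc k) \<omega>))"
    and A3b_erg: "ergodic_seq M (\<lambda>k \<omega>. (X (Suc k) \<omega>, y (Suc k) \<omega>))"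
    and A3b_X4: "\<And>n i j. 1 \<le> n \<Longrightarrow> integrable M (\<lambda>\<omega>. (X n \<omega> $ i $ j) ^ 4)"
    and A3b_y4: "\<And>n j. 1 \<le> n \<Longrightarrow> integrable M (\<lambda>\<omega>. (y n \<omega> $ j) ^ 4)"
    and A3c_rho: "\<And>n. 1 \<le> n \<Longrightarrow> AE \<omega> in M.
           real_cond_exp M (\<X> n) (\<lambda>\<omega>. (norm (y (Suc n) \<omega>))\<^sup>2) \<omega> = \<rho>"
    and A3c_r: "\<And>n i. 1 \<le> n \<Longrightarrow> AE \<omega> in M.
           real_cond_exp M (\<X> n) (\<lambda>\<omega>. (X (Suc n) \<omega> *v y (Suc n) \<omega>) $ i) \<omega> = r $ i"
    and A3c_R: "\<And>n i j. 1 \<le> n \<Longrightarrow> AE \<omega> in M.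
           real_cond_exp M (\<X> n)
             (\<lambda>\<omega>. (X (Suc n) \<omega> ** transpose (X (Suc n) \<omega>)) $ i $ j) \<omega> = R $ i $ j"
    and A3d_h: "h 1 \<in> borel_measurable (\<X> 1)"
    and A3d_D: "\<And>n j. 1 \<le> n \<Longrightarrow> j < m n \<Longrightarrow> (\<lambda>\<omega>. D n \<omega> j) \<in> borel_measurable (\<X> n)"
  shows "(AE \<omega> in M. cluster_points (\<lambda>n. h n \<omega>) \<noteq> {} \<and>
             compact (cluster_points (\<lambda>n. h n \<omega>)) \<and> connected (cluster_points (\<lambda>n. h n \<omega>))) \<and>
         (AE \<omega> in M. \<forall>g \<in> cluster_points (\<lambda>n. h n \<omega>). critical_point F g) \<and>
         ((\<forall>s. convex_on UNIV (\<psi> s)) \<longrightarrow>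
           (\<exists>g. is_arg_min F (\<lambda>_. True) g \<and> (\<forall>g'. is_arg_min F (\<lambda>_. True) g' \<longrightarrow> g' = g) \<and>
               (AE \<omega> in M. (\<lambda>n. h n \<omega>) \<longlonglongrightarrow> g)))"
proof -
  obtain \<nu>max where \<nu>max: "\<And>s t. 0 \<le> t \<Longrightarrow> 0 \<le> nu (\<psi> s) t \<and> nu (\<psi> s) t \<le> \<nu>max"
    using A1c by blast
  interpret reg: mm_regularizer \<psi> V0 v0 V v blk \<nu>max
    using A1a_C1 A1a_lim A1b V0_psd \<nu>max by unfold_locales
  interpret prob_space M by fact
  define \<mu> where "\<mu> = (\<rho>, r, R)"
  define Z where "Z n \<omega> = (X n \<omega>, y n \<omega>)" for n \<omega>
  define z where "z n \<omega> = moments (X n \<omega>) (y n \<omega>)" for n \<omega>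
  have X_def: "\<X> = history M Z"
    by (simp add: \<X>_def Z_def[abs_def])
  have Z_meas: "Z n \<in> borel_measurable M" if "1 \<le> n" for n
    unfolding Z_def[abs_def] using X_meas[OF that] y_meas[OF that] by (rule borel_measurable_Pair)
  have z_Z: "z n \<omega> = (case Z n \<omega> of (a, b) \<Rightarrow> moments a b)" for n \<omega>
    by (simp add: z_def Z_def)
  have z_hist: "z n \<in> borel_measurable (\<X> n)" if "1 \<le> n" for n
    unfolding z_Z[abs_def] X_def
    by (rule measurable_compose[OF measurable_history[OF that order_refl] borel_measurable_moments])
  have sub: "subalgebra M (\<X> n)" for n
    unfolding X_def by (rule subalgebra_history[OF Z_meas])
  have sub_Suc: "subalgebra (\<X> (Suc n)) (\<X> n)" for n
    unfolding X_def by (rule subalgebra_history_Suc)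
  have z_meas: "z n \<in> borel_measurable M" if "1 \<le> n" for n
    by (rule measurable_from_subalg[OF sub z_hist[OF that]])
  have z_L2: "integrable M (\<lambda>\<omega>. (norm (z n \<omega> - \<mu>))\<^sup>2)" if n: "1 \<le> n" for n
  proof -
    obtain K where K: "0 \<le> K" "\<And>(X :: real^'q^'n) y. (norm (moments X y))\<^sup>2 \<le> K * (norm X ^ 4 + norm y ^ 4)"
      by (rule norm_moments_le) blast
    have X4: "integrable M (\<lambda>\<omega>. norm (X n \<omega>) ^ 4)"
    proof (rule integrable_norm_pow4[OF X_meas[OF n]])
      fix b :: "real^'q^'n" assume "b \<in> Basis"
      then obtain i j where "b = axis i (axis j 1)"
        by (auto simp: Basis_vec_def)
      then show "integrable M (\<lambda>\<omega>. (X n \<omega> \<bullet> b) ^ 4)"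
        using A3b_X4[OF n, of i j] by (simp add: inner_axis)
    qed
    have y4: "integrable M (\<lambda>\<omega>. norm (y n \<omega>) ^ 4)"
    proof (rule integrable_norm_pow4[OF y_meas[OF n]])
      fix b :: "real^'q" assume "b \<in> Basis"
      then obtain j where "b = axis j 1"
        by (auto simp: Basis_vec_def)
      then show "integrable M (\<lambda>\<omega>. (y n \<omega> \<bullet> b) ^ 4)"
        using A3b_y4[OF n, of j] by (simp add: inner_axis)
    qed
    have le: "(norm (z n \<omega> - \<mu>))\<^sup>2 \<le> 2 * (K * (norm (X n \<omega>) ^ 4 + norm (y n \<omega>) ^ 4)) + 2 * (norm \<mu>)\<^sup>2" for \<omega>
    proof -
      have "(norm (z n \<omega> - \<mu>))\<^sup>2 \<le> (norm (z n \<omega>) + norm \<mu>)\<^sup>2"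
        by (intro power_mono norm_triangle_ineq4) simp
      also have "\<dots> \<le> 2 * (norm (z n \<omega>))\<^sup>2 + 2 * (norm \<mu>)\<^sup>2"
        using sum_squares_bound[of "norm (z n \<omega>)" "norm \<mu>"] by (simp add: power2_sum)
      finally show ?thesis
        using K(2)[of "X n \<omega>" "y n \<omega>"] by (simp add: z_def)
    qed
    show ?thesis
    proof (rule Bochner_Integration.integrable_bound)
      show "integrable M (\<lambda>\<omega>. 2 * (K * (norm (X n \<omega>) ^ 4 + norm (y n \<omega>) ^ 4)) + 2 * (norm \<mu>)\<^sup>2)"
        using X4 y4 by simp
      show "(\<lambda>\<omega>. (norm (z n \<omega> - \<mu>))\<^sup>2) \<in> borel_measurable M"
        using z_meas[OF n] by measurable
      show "AE \<omega> in M. norm ((norm (z n \<omega> - \<mu>))\<^sup>2)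
          \<le> norm (2 * (K * (norm (X n \<omega>) ^ 4 + norm (y n \<omega>) ^ 4)) + 2 * (norm \<mu>)\<^sup>2)"
        using le by (intro always_eventually) (auto intro: order_trans[OF _ abs_ge_self])
    qed
  qed
  \<comment> \<open>Stationarity gives \<open>z n\<close> the same variance at every index
    \<open>n\<close>, so that of index 1 serves for all.\<close>
  define C where "C = (\<integral>\<omega>. (norm (z 1 \<omega> - \<mu>))\<^sup>2 \<partial>M)"
  have z_var: "(\<integral>\<omega>. (norm (z n \<omega> - \<mu>))\<^sup>2 \<partial>M) \<le> C" if n: "1 \<le> n" for n
  proof -
    let ?g = "\<lambda>p :: (real^'q^'n) \<times> (real^'q). (norm ((case p of (a, b) \<Rightarrow> moments a b) - \<mu>))\<^sup>2"
    have "?g \<in> borel_measurable borel"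
      using borel_measurable_moments by measurable
    moreover have "stationary_seq M (\<lambda>k. Z (Suc k))"
      using A3b_stat by (simp add: Z_def[abs_def])
    ultimately have "(\<integral>\<omega>. ?g (Z (Suc (n - 1)) \<omega>) \<partial>M) = (\<integral>\<omega>. ?g (Z (Suc 0) \<omega>) \<partial>M)"
      by (intro stationary_seq_integral[where Z = "\<lambda>k. Z (Suc k)"] Z_meas) auto
    then show ?thesis
      using n by (simp add: C_def z_Z)
  qed
  have z_cond: "AE \<omega> in M. real_cond_exp M (\<X> n) (\<lambda>\<omega>. z (Suc n) \<omega> \<bullet> b) \<omega> = \<mu> \<bullet> b"
    if n: "1 \<le> n" and b: "b \<in> Basis" for n b
  proof -
    consider "b = (1, 0, 0)" | i where "b = (0, axis i 1, 0)" | i j where "b = (0, 0, axis i (axis j 1))"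
      using b by (auto simp: Basis_prod_def Basis_vec_def zero_prod_def)
    then show ?thesis
    proof cases
      case 1
      then show ?thesis using A3c_rho[OF n] by (simp add: z_def moments_def \<mu>_def)
    next
      case 2
      then show ?thesis using A3c_r[OF n] by (simp add: z_def moments_def \<mu>_def inner_axis)
    next
      case 3
      then show ?thesis using A3c_R[OF n] by (simp add: z_def moments_def \<mu>_def inner_axis)
    qed
  qed
  interpret noise: noise_seq M \<X> z \<mu> C
    using sub sub_Suc z_hist z_L2 z_var z_cond by unfold_locales
  let ?zb = noise.zbar
  have zb_R: "snd (snd (?zb n \<omega>)) = emp_R X n \<omega>" and zb_r: "fst (snd (?zb n \<omega>)) = emp_r X y n \<omega>" for n \<omega>
    by (simp_all add: noise.zbar_def emp_R_def emp_r_def snd_sum fst_sum z_def moments_def)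
  have zb_sym: "transpose (snd (snd (?zb n \<omega>))) = snd (snd (?zb n \<omega>))" for n \<omega>
  proof -
    note lin = bounded_linear.linear[OF bounded_linear_transpose]
    show ?thesis
      by (simp add: zb_R emp_R_def linear_cmul[OF lin] linear_sum[OF lin] o_def matrix_transpose_mul)
  qed
  have zb_q: "?zb n \<omega> \<bullet> qvec g
      = 1 / (2 * real n) * (\<Sum>k=1..n. (norm (y k \<omega> - transpose (X k \<omega>) *v g))\<^sup>2)" for n \<omega> g
  proof -
    have "?zb n \<omega> \<bullet> qvec g = 1 / real n * (\<Sum>k=1..n. moments (X k \<omega>) (y k \<omega>) \<bullet> qvec g)"
      by (simp add: noise.zbar_def inner_sum_left z_def)
    then show ?thesis
      unfolding residual_eq by (simp flip: sum_distrib_left)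
  qed
  have A_eq: "A n \<omega> = reg.Az (?zb n \<omega>)" for n \<omega>
    by (simp add: A_def fun_eq_iff maj_A_def reg.Az_def reg.B_def reg.wt_def zb_R add.assoc)
  have c_eq: "c n \<omega> g = fst (snd (?zb n \<omega>)) + reg.dvec g" for n \<omega> g
    by (simp add: c_def maj_c_def reg.dvec_def reg.wt_def zb_r add.assoc)
  have Fn_eq: "Fn n \<omega> = reg.Fz (?zb n \<omega>)" for n \<omega>
    by (simp add: fun_eq_iff Fn_def emp_cost_def reg.Fz_def zb_q \<Psi>_def)
  have F_eq: "F = reg.Fz \<mu>"
  proof
    fix g
    show "F g = reg.Fz \<mu> g"
      unfolding F_def cost_def mean_square_error_eq[where n = 1 and X = X and y = y,
          OF E_rho[OF order_refl] E_r[OF order_refl] E_R[OF order_refl]]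
      by (simp add: reg.Fz_def \<mu>_def inner_qvec \<Psi>_def)
  qed
  have \<mu>_sym: "transpose (snd (snd \<mu>)) = snd (snd \<mu>)"
    using R_psd by (simp add: \<mu>_def sym_psd_def)
  obtain \<epsilon> where \<epsilon>: "0 < \<epsilon>" and coercive: "\<And>x. 2 * \<epsilon> * (norm x)\<^sup>2 \<le> x \<bullet> ((snd (snd \<mu>) + V0) *v x)"
  proof -
    obtain e where e: "0 < e" "\<And>x. e * (norm x)\<^sup>2 \<le> x \<bullet> ((R + V0) *v x)"
      using sym_pd_coercive[OF A3a] by blast
    then show thesis
      by (intro that[of "e / 2"]) (auto simp: \<mu>_def)
  qed
  \<comment> \<open>\<open>k n\<close> is a version of \<open>h (Suc n)\<close> that obeys the
    recursion everywhere. The recursion for \<open>h\<close> may fail on a null set, which the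
    history need not contain, so \<open>h\<close> itself could fail to be adapted.\<close>
  define k where "k = rec_nat (h 1) (\<lambda>n g \<omega>. subspace_step (m (Suc n)) (D (Suc n) \<omega>)
      (A (Suc n) \<omega> (g \<omega>)) (c (Suc n) \<omega> (g \<omega>)))"
  have k_0: "k 0 = h 1" and k_Suc: "k (Suc n) = (\<lambda>\<omega>. subspace_step (m (Suc n)) (D (Suc n) \<omega>)
      (A (Suc n) \<omega> (k n \<omega>)) (c (Suc n) \<omega> (k n \<omega>)))" for n
    by (simp_all add: k_def)
  have k_next: "k (Suc n) \<in> borel_measurable (\<X> (Suc n))" if "k n \<in> borel_measurable (\<X> (Suc n))" for n
    unfolding k_Suc A_eq c_eq
    using noise.zbar_meas[of "Suc n"] that A3d_D[of "Suc n"] zb_sym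
    by (intro reg.borel_measurable_mm_update) auto
  \<comment> \<open>The induction runs with the later history \<open>\<X> (Suc n)\<close> because
    \<open>k 0 = h 1\<close> is known only at time 1. One application of the update then shows that
    \<open>k n\<close> is known at time \<open>n\<close> for \<open>n \<ge> 1\<close>.\<close>
  have k_prev: "k n \<in> borel_measurable (\<X> (Suc n))" for n
  proof (induction n)
    case 0
    then show ?case using A3d_h by (simp add: k_0)
  next
    case (Suc n)
    then show ?case
      using measurable_from_subalg[OF sub_Suc k_next] by blast
  qed
  have k_meas: "k n \<in> borel_measurable (\<X> n)" if "1 \<le> n" for n
    using k_next[OF k_prev, of "n - 1"] that by simp
  have kM: "k n \<in> borel_measurable M" for n
    by (rule measurable_from_subalg[OF sub k_prev])
  have AE_path: "AE \<omega> in M. \<forall>n\<ge>1.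
      is_arg_min (\<lambda>g. quad_majorant (reg.Fz (?zb n \<omega>)) (reg.Az (?zb n \<omega>)) g (h n \<omega>))
        (\<lambda>g. g \<in> ran_cols (m n) (D n \<omega>)) (h (Suc n) \<omega>) \<and>
      reg.Gz (?zb n \<omega>) (h n \<omega>) \<in> ran_cols (m n) (D n \<omega>) \<and> h n \<omega> \<in> ran_cols (m n) (D n \<omega>)"
  proof (intro AE_all_countable[THEN iffD2] allI)
    fix n
    show "AE \<omega> in M. 1 \<le> n \<longrightarrow>
      is_arg_min (\<lambda>g. quad_majorant (reg.Fz (?zb n \<omega>)) (reg.Az (?zb n \<omega>)) g (h n \<omega>))
        (\<lambda>g. g \<in> ran_cols (m n) (D n \<omega>)) (h (Suc n) \<omega>) \<and>
      reg.Gz (?zb n \<omega>) (h n \<omega>) \<in> ran_cols (m n) (D n \<omega>) \<and> h n \<omega> \<in> ran_cols (m n) (D n \<omega>)"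
    proof (cases "1 \<le> n")
      case True
      show ?thesis
        using argmin[OF True] A2[OF True]
        by eventually_elim (simp add: \<Theta>_def Fn_eq A_eq grad_eq[OF reg.GDERIV_Fz[OF zb_sym]])
    qed simp
  qed
  have AE_k: "AE \<omega> in M. \<forall>n. h (Suc n) \<omega> = k n \<omega>"
  proof -
    have "AE \<omega> in M. \<forall>n. h (Suc (Suc n)) \<omega> = subspace_step (m (Suc n)) (D (Suc n) \<omega>)
        (A (Suc n) \<omega> (h (Suc n) \<omega>)) (c (Suc n) \<omega> (h (Suc n) \<omega>))"
      using step by (intro AE_all_countable[THEN iffD2] allI) auto
    then show ?thesis
    proof eventually_elim
      case (elim \<omega>)
      show ?case
      proof
        fix n
        show "h (Suc n) \<omega> = k n \<omega>"
          by (induction n) (simp_all add: k_0 k_Suc elim)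
      qed
    qed
  qed
  \<comment> \<open>The bound \<open>K\<close> replaces the missing moments of the iterates, and
    closeness of the mean to \<open>\<mu>\<close> ensures coercivity with constant
    \<open>\<epsilon>\<close>. Both conditions concern indices up to \<open>n\<close> only, so the
    event is known at time \<open>n\<close>.\<close>
  define E where "E n0 K n = {\<omega> \<in> space M. \<forall>j\<in>{n0..n}. norm (k j \<omega>) \<le> real K \<and> norm (?zb j \<omega> - \<mu>) \<le> \<epsilon>}" for n0 K n :: nat
  \<comment> \<open>The factor is the 1/2 of the majorant times the coercivity constant
    \<open>\<epsilon>\<close>.\<close>
  define \<delta> where "\<delta> n \<omega> = \<epsilon> / 2 * (norm (k n \<omega> - k (n - 1) \<omega>))\<^sup>2" for n \<omega>
  have decrease: "AE \<omega> in M. (\<forall>n\<ge>n0. \<omega> \<in> E n0 K n) \<longrightarrow> summable (\<lambda>n. \<delta> n \<omega>)" if n0: "1 \<le> n0" for n0 K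
  proof -
    have "bounded (qvec ` cball (0 :: real^'n) (real K))" "bounded (reg.Psi ` cball 0 (real K))"
      by (intro compact_imp_bounded compact_continuous_image continuous_on_qvec reg.continuous_on_Psi compact_cball)+
    then obtain K1 K2 where
      "\<forall>g\<in>cball (0 :: real^'n) (real K). norm (qvec g) \<le> K1" "\<forall>g\<in>cball 0 (real K). \<bar>reg.Psi g\<bar> \<le> K2"
      unfolding bounded_iff by auto
    then have K1: "\<And>g :: real^'n. norm g \<le> K \<Longrightarrow> norm (qvec g) \<le> K1"
      and K2: "\<And>g. norm g \<le> K \<Longrightarrow> \<bar>reg.Psi g\<bar> \<le> K2"
      by (simp_all add: dist_norm)
    have qvec_meas: "(\<lambda>\<omega>. qvec (g \<omega>)) \<in> borel_measurable N" if "g \<in> borel_measurable N"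
      for g :: "'a \<Rightarrow> real^'n" and N
      by (rule measurable_compose[OF that borel_measurable_continuous_onI[OF continuous_on_qvec]])
    \<comment> \<open>As \<open>k (n - 1)\<close> stands for \<open>h n\<close>, the sum
      \<open>?zb n \<omega> \<bullet> p n \<omega> + s n \<omega>\<close> is almost surely the cost
      \<open>Fn n \<omega>\<close> at \<open>h n \<omega>\<close>. Compactness of the ball of radius
      \<open>K\<close> bounds \<open>p\<close> and \<open>s\<close> on the events.\<close>
    show ?thesis
    proof (rule noise.summable_decrease[where p = "\<lambda>n \<omega>. qvec (k (n - 1) \<omega>)" and s = "\<lambda>n \<omega>. reg.Psi (k (n - 1) \<omega>)"
          and K = "max 0 (max K1 K2)"])
      fix n assume n: "n0 \<le> n"
      then have n1: "1 \<le> n" using n0 by simp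
      show "E n0 K n \<in> sets (\<X> n)"
      proof -
        have "{\<omega> \<in> space (\<X> n). norm (k j \<omega>) \<le> real K \<and> norm (?zb j \<omega> - \<mu>) \<le> \<epsilon>} \<in> sets (\<X> n)"
          if j: "j \<in> {n0..n}" for j
        proof -
          have [measurable]: "k j \<in> borel_measurable (\<X> n)" "?zb j \<in> borel_measurable (\<X> n)"
            using j n0 noise.subalg_mono[of j n] k_meas[of j] noise.zbar_meas[of j]
            by (auto intro: measurable_from_subalg)
          show ?thesis by measurable
        qed
        then have "{\<omega> \<in> space (\<X> n). \<forall>j\<in>{n0..n}. norm (k j \<omega>) \<le> real K \<and> norm (?zb j \<omega> - \<mu>) \<le> \<epsilon>} \<in> sets (\<X> n)"
          by (intro sets.sets_Collect_finite_All') (use n in auto)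
        then show ?thesis
          by (simp add: E_def X_def space_history)
      qed
      show "E n0 K (Suc n) \<subseteq> E n0 K n"
        by (auto simp: E_def)
      show "(\<lambda>\<omega>. qvec (k (Suc n - 1) \<omega>)) \<in> borel_measurable (\<X> n)"
        using k_meas[OF n1] by (auto intro: qvec_meas)
      show "(\<lambda>\<omega>. reg.Psi (k (Suc n - 1) \<omega>)) \<in> borel_measurable M"
        by (rule measurable_compose[OF kM borel_measurable_continuous_onI[OF reg.continuous_on_Psi]])
      show "\<delta> n \<in> borel_measurable M"
        unfolding \<delta>_def[abs_def] using kM[of n] kM[of "n - 1"] by measurable
      fix \<omega> assume \<omega>: "\<omega> \<in> E n0 K n"
      then have "norm (k n \<omega>) \<le> K"
        using n by (auto simp: E_def)
      then show "norm (qvec (k (Suc n - 1) \<omega>)) \<le> max 0 (max K1 K2)"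
          "\<bar>reg.Psi (k (Suc n - 1) \<omega>)\<bar> \<le> max 0 (max K1 K2)"
        using K1[of "k n \<omega>"] K2[of "k n \<omega>"] by auto
      show "0 \<le> ?zb (Suc n) \<omega> \<bullet> qvec (k (Suc n - 1) \<omega>)"
        unfolding zb_q by (intro mult_nonneg_nonneg sum_nonneg) auto
    next
      fix n assume n: "Suc n0 \<le> n"
      then have n1: "1 \<le> n" by simp
      show "AE \<omega> in M. \<omega> \<in> E n0 K n \<longrightarrow>
          ?zb n \<omega> \<bullet> qvec (k (Suc n - 1) \<omega>) + reg.Psi (k (Suc n - 1) \<omega>) + \<delta> n \<omega>
          \<le> ?zb n \<omega> \<bullet> qvec (k (n - 1) \<omega>) + reg.Psi (k (n - 1) \<omega>)"
        using AE_path AE_k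
      proof eventually_elim
        case (elim \<omega>)
        show ?case
        proof
          assume "\<omega> \<in> E n0 K n"
          then have near: "norm (?zb n \<omega> - \<mu>) \<le> \<epsilon>"
            using n by (auto simp: E_def)
          have k: "h (Suc n) \<omega> = k n \<omega>" "h n \<omega> = k (n - 1) \<omega>"
            using elim(2) n1 by (auto dest: spec[of _ "n - 1"])
          have "reg.Fz (?zb n \<omega>) (k n \<omega>)
              + 1/2 * ((k n \<omega> - k (n - 1) \<omega>) \<bullet> (reg.Az (?zb n \<omega>) (k (n - 1) \<omega>) *v (k n \<omega> - k (n - 1) \<omega>)))
              \<le> reg.Fz (?zb n \<omega>) (k (n - 1) \<omega>)"
            using elim(1) n1 unfolding k[symmetric]
            by (intro reg.mm_step_descent[OF zb_sym subspace_ran_cols]) auto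
          then show "?zb n \<omega> \<bullet> qvec (k (Suc n - 1) \<omega>) + reg.Psi (k (Suc n - 1) \<omega>) + \<delta> n \<omega>
              \<le> ?zb n \<omega> \<bullet> qvec (k (n - 1) \<omega>) + reg.Psi (k (n - 1) \<omega>)"
            using reg.Az_coercive[OF \<mu>_sym \<epsilon> coercive near, of "k n \<omega> - k (n - 1) \<omega>" "k (n - 1) \<omega>"]
            by (simp add: reg.Fz_def \<delta>_def)
        qed
      qed
    qed (use n0 \<epsilon> in \<open>auto simp: \<delta>_def\<close>)
  qed
  \<comment> \<open>Starting time and radius are natural numbers, so one null set serves for all of
    them. Almost every path stays in \<open>E n0 K n\<close> for all \<open>n\<close> once both are
    large enough for it.\<close>
  have AE_decrease: "AE \<omega> in M. \<forall>n0 K. 1 \<le> n0 \<longrightarrow> (\<forall>n\<ge>n0. \<omega> \<in> E n0 K n) \<longrightarrow> summable (\<lambda>n. \<delta> n \<omega>)"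
    using decrease by (intro AE_all_countable[THEN iffD2] allI) auto
  have main: "AE \<omega> in M. bounded (range (\<lambda>n. h n \<omega>)) \<and> (\<lambda>n. h (Suc n) \<omega> - h n \<omega>) \<longlonglongrightarrow> 0 \<and>
      (\<forall>g \<in> cluster_points (\<lambda>n. h n \<omega>). critical_point F g)"
    using AE_path AE_k AE_decrease noise.zbar_strong_law AE_space
  proof eventually_elim
    case (elim \<omega>)
    note path = elim(1)[rule_format, THEN conjunct1] elim(1)[rule_format, THEN conjunct2, THEN conjunct1]
      elim(1)[rule_format, THEN conjunct2, THEN conjunct2]
    have bd: "bounded (range (\<lambda>n. h n \<omega>))"
      by (rule reg.mm_path_bounded[OF \<mu>_sym \<epsilon> coercive elim(4) zb_sym subspace_ran_cols path(3) path(1)])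
    then obtain K0 where K0: "\<And>n. norm (h n \<omega>) \<le> K0"
      by (auto simp: bounded_iff)
    obtain n0 where n0: "1 \<le> n0" "\<And>n. n0 \<le> n \<Longrightarrow> norm (?zb n \<omega> - \<mu>) \<le> \<epsilon>"
    proof (rule reg.mm_path_near[OF \<mu>_sym \<epsilon> coercive elim(4) zb_sym subspace_ran_cols path(3) path(1)])
      fix N assume "1 \<le> N" "\<And>n. N \<le> n \<Longrightarrow> norm (?zb n \<omega> - \<mu>) \<le> \<epsilon>"
      then show thesis by (rule that)
    qed
    obtain K :: nat where "K0 \<le> real K"
      using real_arch_simple by blast
    then have "norm (k n \<omega>) \<le> real K" for n
      using K0[of "Suc n"] elim(2) by simp
    then have "\<omega> \<in> E n0 K n" for n
      using n0 elim(5) by (auto simp: E_def)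
    then have "summable (\<lambda>n. \<delta> n \<omega>)"
      using elim(3) n0(1) by blast
    then have "(\<lambda>n. 2 / \<epsilon> * \<delta> (Suc n) \<omega>) \<longlonglongrightarrow> 2 / \<epsilon> * 0"
      by (intro tendsto_mult tendsto_const LIMSEQ_Suc summable_LIMSEQ_zero)
    moreover have "2 / \<epsilon> * \<delta> (Suc n) \<omega> = (norm (h (Suc (Suc n)) \<omega> - h (Suc n) \<omega>))\<^sup>2" for n
      using \<epsilon> elim(2) by (simp add: \<delta>_def)
    ultimately have "(\<lambda>n. (norm (h (Suc (Suc n)) \<omega> - h (Suc n) \<omega>))\<^sup>2) \<longlonglongrightarrow> 0"
      by simp
    then have "(\<lambda>n. norm (h (Suc (Suc n)) \<omega> - h (Suc n) \<omega>)) \<longlonglongrightarrow> 0"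
      using power_tendsto_0_iff[of 2] by fastforce
    then have "(\<lambda>n. h (Suc (Suc n)) \<omega> - h (Suc n) \<omega>) \<longlonglongrightarrow> 0"
      by (rule tendsto_norm_zero_cancel)
    then have steps: "(\<lambda>n. h (Suc n) \<omega> - h n \<omega>) \<longlonglongrightarrow> 0"
      by (rule LIMSEQ_imp_Suc)
    have "critical_point F g" if "g \<in> cluster_points (\<lambda>n. h n \<omega>)" for g
      unfolding critical_point_def F_eq
      by (rule reg.mm_path_critical[OF \<mu>_sym \<epsilon> coercive elim(4) zb_sym subspace_ran_cols path(3) path(1)
            steps path(2) that])
    with bd steps show ?case by blast
  qed
  have limit: "\<exists>g. is_arg_min F (\<lambda>_. True) g \<and> (\<forall>g'. is_arg_min F (\<lambda>_. True) g' \<longrightarrow> g' = g) \<and>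
      (AE \<omega> in M. (\<lambda>n. h n \<omega>) \<longlonglongrightarrow> g)" if conv: "\<forall>s. convex_on UNIV (\<psi> s)"
  proof -
    \<comment> \<open>The existence of a critical point does not depend on \<open>\<omega>\<close>,
      so in a probability space it is enough that almost every bounded path has a cluster
      point.\<close>
    have "AE \<omega> in M. \<exists>g. critical_point F g"
      using main by eventually_elim (use cluster_points_nonempty in blast)
    then have "\<exists>g. critical_point F g"
      by simp
    then obtain g where g: "critical_point F g" ..
    have strict: "F g < F g'" if "g' \<noteq> g" for g'
      using reg.critical_strict_minimum[OF \<mu>_sym \<epsilon> coercive _ _ that] conv g
      unfolding F_eq critical_point_def by blast
    have unique: "g' = g" if g': "critical_point F g'" for g'
    proof (rule ccontr)
      assume "g' \<noteq> g"
      then have "F g' < F g"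
        using reg.critical_strict_minimum[OF \<mu>_sym \<epsilon> coercive _ _ \<open>g' \<noteq> g\<close>[symmetric]] conv g'
        unfolding F_eq critical_point_def by blast
      with strict[OF \<open>g' \<noteq> g\<close>] show False by simp
    qed
    have "is_arg_min F (\<lambda>_. True) g"
      unfolding is_arg_min_def using strict by (metis less_asym less_irrefl)
    moreover have "\<forall>g'. is_arg_min F (\<lambda>_. True) g' \<longrightarrow> g' = g"
      unfolding is_arg_min_def using strict by blast
    moreover have "AE \<omega> in M. (\<lambda>n. h n \<omega>) \<longlonglongrightarrow> g"
      using main
    proof eventually_elim
      case (elim \<omega>)
      then show ?case
        using unique by (intro LIMSEQ_unique_cluster_point) auto
    qed
    ultimately show ?thesis by blast
  qed
  have "AE \<omega> in M. cluster_points (\<lambda>n. h n \<omega>) \<noteq> {} \<and>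
      compact (cluster_points (\<lambda>n. h n \<omega>)) \<and> connected (cluster_points (\<lambda>n. h n \<omega>))"
    using main
    by eventually_elim (simp add: cluster_points_nonempty compact_cluster_points connected_cluster_points)
  moreover have "AE \<omega> in M. \<forall>g \<in> cluster_points (\<lambda>n. h n \<omega>). critical_point F g"
    using main by eventually_elim blast
  ultimately show ?thesis
    using limit by blast
qed

end
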